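(* The zero map on $\Omega^1_q(\mathrm{SU}_3)$ is a left $\mathcal{O}_q(\mathrm{SU}_3)$-covariant principal connection for the quantum principal bundle $(\mathcal{O}_q(\mathrm{SU}_3),\Omega^1_q(\mathrm{SU}_3))$ over $\mathcal{O}_q(\mathrm{F}_3)$.
   Context: For a quantum homogeneous space $B\subseteq A$ with $\pi_B(A)=A/B^+A$ and a left $A$-covariant first-order calculus $\Omega^1(A)=A\otimes\Lambda^1$ giving a quantum principal bundle (i.e. right $\pi_B(A)$-covariant), a left $A$-covariant principal connection is equivalent to (and may here be taken to be) a map $\mathrm{id}_A\otimes p:\Omega^1(A)\to\Omega^1(A)$, where $p:\Lambda^1\to\Lambda^1$ is a left $\pi_B(A)$-comodule projection ($p^2=p$) with kernel the image of $V^1$ in $\Lambda^1$. Here $V^1$ is the cotangent space of the restriction of $\Omega^1(A)$ to $B$, mapped to $\Lambda^1$ by $[b]\mapsto[b]$, and $\Lambda^1$ (a quotient of $A^+$) has the comodule structure $[a]\mapsto\pi_B(a_{(1)}S(a_{(3)}))\otimes[a_{(2)}]$. Let $q\in\mathbb{R}\setminus\{-1,0,1\}$. Let $\Delta^+=\{\alpha_1,\alpha_2,\alpha_1+\alpha_2\}$ be the positive roots of $\mathfrak{sl}_3$, with Cartan matrix $a_{11}=a_{22}=2$, $a_{12}=a_{21}=-1$. $U_q(\mathfrak{sl}_3)$ is the complex algebra generated by $E_i,F_i,K_i^{\pm1}$ ($i=1,2$) with $K_iK_j=K_jK_i$, $K_iE_j=q^{a_{ij}}E_jK_i$, $K_iF_j=q^{-a_{ij}}F_jK_i$,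 $[E_i,F_j]=\delta_{ij}\frac{K_i-K_i^{-1}}{q-q^{-1}}$, and $E_i^2E_j-(q+q^{-1})E_iE_jE_i+E_jE_i^2=0$, $F_i^2F_j-(q+q^{-1})F_iF_jF_i+F_jF_i^2=0$ for $i\ne j$. It is a Hopf $*$-algebra with $\Delta(E_i)=E_i\otimes K_i+1\otimes E_i$, $\Delta(F_i)=F_i\otimes1+K_i^{-1}\otimes F_i$, $\Delta(K_i)=K_i\otimes K_i$, $\varepsilon(E_i)=\varepsilon(F_i)=0$, $\varepsilon(K_i)=1$, $E_i^*=K_iF_i$, $F_i^*=E_iK_i^{-1}$, $K_i^*=K_i$. $A:=\mathcal{O}_q(\mathrm{SU}_3)$ is the Hopf subalgebra of the Hopf dual of $U_q(\mathfrak{sl}_3)$ generated by $u_{ij}$ ($1\le i,j\le3$), where $\Delta(u_{ij})=\sum_a u_{ia}\otimes u_{aj}$ and the only nonzero pairings of the $u_{ij}$ with the generators are $\langle E_1,u_{21}\rangle=\langle E_2,u_{32}\rangle=\langle F_1,u_{12}\rangle=\langle F_2,u_{23}\rangle=1$, $\langle K_i^{\pm1},u_{jj}\rangle=q^{\pm(\delta_{i,j-1}-\delta_{ij})}$. Put $X\triangleright a:=a_{(1)}\langle X,a_{(2)}\rangle$. Then $B:=\mathcal{O}_q(\mathrm{F}_3):=\{b\in A: K_i^{\pm1}\triangleright b=b,\ i=1,2\}$. Put $E_{\alpha_i}:=E_i$, $E_{\alpha_1+\alpha_2}:=E_2E_1-q^{-1}E_1E_2$, $F_\gamma:=E_\gamma^*$,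 and $T:=\mathrm{span}_{\mathbb{C}}\{E_\gamma,F_\gamma:\gamma\in\Delta^+\}$. $\Omega^1_q(\mathrm{SU}_3)=A\otimes\Lambda^1$ is the left $A$-covariant first-order differential calculus over $A$ with $\Lambda^1:=A^+/\{y\in A^+:X(y)=0\ \forall X\in T\}$ (where $A^+=\ker\varepsilon$), a right $A$-module with basis $\{e_\gamma,f_\gamma\}$ dual to $\{E_\gamma,F_\gamma\}$, bimodule structure $a(b\otimes v)c=abc_{(1)}\otimes vc_{(2)}$, and $\mathrm{d}a=\sum_\gamma (E_\gamma\triangleright a)\otimes e_\gamma+(F_\gamma\triangleright a)\otimes f_\gamma$. Its restriction to $B$ is $\Omega^1_q(\mathrm{F}_3)$, with cotangent space $V^1:=B^+/\{y\in B^+:X(y)=0\ \forall X\in T\}$. *)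

theory Defs
  imports
    Complex_Main
    "HOL-Library.Poly_Mapping"
    "HOL-Library.Function_Algebras"
    "HOL-Library.Product_Plus"
    "HOL-Library.Set_Algebras"
begin

section \<open>Quotients and tensor products of spaces of complex functions\<close>

definition fscale :: "complex \<Rightarrow> ('x \<Rightarrow> complex) \<Rightarrow> 'x \<Rightarrow> complex" where
  "fscale c f = (\<lambda>x. c * f x)"

global_interpretation fs: vector_space "fscale :: complex \<Rightarrow> ('x \<Rightarrow> complex) \<Rightarrow> 'x \<Rightarrow> complex"
  by unfold_locales (auto simp: fscale_def fun_eq_iff algebra_simps)

text \<open>
  For spaces \<open>V\<close>, \<open>W\<close> of functions on \<open>X\<close>, \<open>Y\<close>, the algebraic tensor product is
  realised as the span of the functions \<open>(x, y) \<mapsto> v x * w y\<close> on \<open>X \<times> Y\<close>; the canonical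
  map from the abstract tensor product onto this span is an isomorphism.
\<close>

definition tens :: "('x \<Rightarrow> complex) \<Rightarrow> ('y \<Rightarrow> complex) \<Rightarrow> 'x \<times> 'y \<Rightarrow> complex" where
  "tens v w = (\<lambda>(x, y). v x * w y)"

definition tens_space ::
    "('x \<Rightarrow> complex) set \<Rightarrow> ('y \<Rightarrow> complex) set \<Rightarrow> ('x \<times> 'y \<Rightarrow> complex) set" where
  "tens_space V W = fs.span {tens v w |v w. v \<in> V \<and> w \<in> W}"

text \<open>
  A pair \<open>(V, N)\<close> of subspaces with \<open>N \<subseteq> V\<close> stands for the quotient space \<open>V / N\<close>. Its
  elements are the cosets \<open>v +o N\<close>; their sum is the elementwise sum of sets, and the zero
  vector is \<open>N\<close> itself. Adding \<open>N\<close> in \<open>qscale\<close>, \<open>qsum\<close> and \<open>qtensor\<close> makes the result a full coset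
  also for the scalar 0 and for the empty sum.
\<close>

type_synonym 'x qspace = "('x \<Rightarrow> complex) set \<times> ('x \<Rightarrow> complex) set"

definition qcarrier :: "'x qspace \<Rightarrow> ('x \<Rightarrow> complex) set set" where
  "qcarrier Q = {v +o snd Q |v. v \<in> fst Q}"

definition qzero :: "'x qspace \<Rightarrow> ('x \<Rightarrow> complex) set" where
  "qzero Q = snd Q"

definition qscale :: "'x qspace \<Rightarrow> complex \<Rightarrow> ('x \<Rightarrow> complex) set \<Rightarrow> ('x \<Rightarrow> complex) set" where
  "qscale Q c X = fscale c ` X + snd Q"

definition qsum :: "'x qspace \<Rightarrow> ('x \<Rightarrow> complex) set list \<Rightarrow> ('x \<Rightarrow> complex) set" where
  "qsum Q Xs = sum_list Xs + snd Q"

definition qlinear ::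
    "'x qspace \<Rightarrow> 'y qspace \<Rightarrow> (('x \<Rightarrow> complex) set \<Rightarrow> ('y \<Rightarrow> complex) set) \<Rightarrow> bool" where
  "qlinear Q R f \<longleftrightarrow>
     (\<forall>X\<in>qcarrier Q. f X \<in> qcarrier R) \<and>
     (\<forall>X\<in>qcarrier Q. \<forall>Y\<in>qcarrier Q. f (X + Y) = f X + f Y) \<and>
     (\<forall>c. \<forall>X\<in>qcarrier Q. f (qscale Q c X) = qscale R c (f X))"

text \<open>\<open>(V/N) \<otimes> (W/M) = (V \<otimes> W) / (N \<otimes> W + V \<otimes> M)\<close>\<close>

definition qtensor_space :: "'x qspace \<Rightarrow> 'y qspace \<Rightarrow> ('x \<times> 'y) qspace" where
  "qtensor_space Q R =
     (tens_space (fst Q) (fst R),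
      tens_space (snd Q) (fst R) + tens_space (fst Q) (snd R))"

definition qtensor ::
    "'x qspace \<Rightarrow> 'y qspace \<Rightarrow> ('x \<Rightarrow> complex) set \<Rightarrow> ('y \<Rightarrow> complex) set \<Rightarrow> ('x \<times> 'y \<Rightarrow> complex) set" where
  "qtensor Q R X Y = {tens v w |v w. v \<in> X \<and> w \<in> Y} + snd (qtensor_space Q R)"

text \<open>\<open>g = id\<^sub>Q \<otimes> p\<close>, for an endomorphism \<open>p\<close> of \<open>R\<close>\<close>

definition is_id_tensor ::
    "'x qspace \<Rightarrow> 'y qspace \<Rightarrow> (('y \<Rightarrow> complex) set \<Rightarrow> ('y \<Rightarrow> complex) set) \<Rightarrow>
     (('x \<times> 'y \<Rightarrow> complex) set \<Rightarrow> ('x \<times> 'y \<Rightarrow> complex) set) \<Rightarrow> bool" where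
  "is_id_tensor Q R p g \<longleftrightarrow>
     qlinear (qtensor_space Q R) (qtensor_space Q R) g \<and>
     (\<forall>X\<in>qcarrier Q. \<forall>Y\<in>qcarrier R. g (qtensor Q R X Y) = qtensor Q R X (p Y))"


section \<open>The quantum enveloping algebra of $\mathfrak{sl}_3$\<close>

datatype node = N1 | N2

primrec nd :: "node \<Rightarrow> nat" where
  "nd N1 = 1"
| "nd N2 = 2"

datatype gen = GE node | GF node | GK node | GKi node

datatype word = Word (letters: "gen list")

instantiation word :: monoid_add
begin
definition zero_word_def: "0 = Word []"
definition plus_word_def: "v + w = Word (letters v @ letters w)"
instance by standard (simp_all add: zero_word_def plus_word_def)
end

text \<open>
  With concatenation as the addition of words, the convolution product of \<open>poly_mapping\<close>
  makes \<open>free\<close> the free complex algebra on \<open>gen\<close>, and \<open>free2\<close> its tensor square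
  with the componentwise product.
\<close>

type_synonym free = "word \<Rightarrow>\<^sub>0 complex"
type_synonym free2 = "(word \<times> word) \<Rightarrow>\<^sub>0 complex"

abbreviation scal :: "complex \<Rightarrow> ('m::monoid_add \<Rightarrow>\<^sub>0 complex)" where
  "scal c \<equiv> Poly_Mapping.single 0 c"

definition free_scale :: "complex \<Rightarrow> free \<Rightarrow> free" where
  "free_scale c x = scal c * x"

global_interpretation fa: vector_space free_scale
  by unfold_locales
    (simp_all add: free_scale_def algebra_simps single_add mult_single flip: mult.assoc)

definition gn :: "gen \<Rightarrow> free" where
  "gn g = Poly_Mapping.single (Word [g]) 1"

abbreviation "EE i \<equiv> gn (GE i)"
abbreviation "FF i \<equiv> gn (GF i)"
abbreviation "KK i \<equiv> gn (GK i)"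
abbreviation "KI i \<equiv> gn (GKi i)"

definition cartan :: "node \<Rightarrow> node \<Rightarrow> int" where
  "cartan i j = (if i = j then 2 else -1)"

definition uq_relations :: "real \<Rightarrow> free set" where
  "uq_relations q =
     (let Q = complex_of_real q in
       {KK i * KI i - 1 |i. True}
     \<union> {KI i * KK i - 1 |i. True}
     \<union> {KK i * KK j - KK j * KK i |i j. True}
     \<union> {KK i * EE j - scal (Q powi cartan i j) * EE j * KK i |i j. True}
     \<union> {KK i * FF j - scal (Q powi (- cartan i j)) * FF j * KK i |i j. True}
     \<union> {EE i * FF j - FF j * EE i
          - (if i = j then scal (1 / (Q - inverse Q)) * (KK i - KI i) else 0) |i j. True}
     \<union> {EE i * EE i * EE j - scal (Q + inverse Q) * EE i * EE j * EE i + EE j * EE i * EE i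
          |i j. i \<noteq> j}
     \<union> {FF i * FF i * FF j - scal (Q + inverse Q) * FF i * FF j * FF i + FF j * FF i * FF i
          |i j. i \<noteq> j})"

text \<open>
  The two-sided ideal generated by the relations; \<open>U\<^sub>q(sl\<^sub>3)\<close> is \<open>free\<close> modulo \<open>uq_ideal q\<close>.
  It enters only through its linear functionals (\<open>uq_dual\<close> below) and through elements written
  in the generators, for which representatives in \<open>free\<close> are used.
\<close>

inductive_set uq_ideal :: "real \<Rightarrow> free set" for q where
  zero: "0 \<in> uq_ideal q"
| gen: "r \<in> uq_relations q \<Longrightarrow> x * r * y \<in> uq_ideal q"
| add: "x \<in> uq_ideal q \<Longrightarrow> y \<in> uq_ideal q \<Longrightarrow> x + y \<in> uq_ideal q"

definition pure2 :: "free \<Rightarrow> free \<Rightarrow> free2" where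
  "pure2 x y = (\<Sum>v\<in>Poly_Mapping.keys x. \<Sum>w\<in>Poly_Mapping.keys y.
     Poly_Mapping.single (v, w) (Poly_Mapping.lookup x v * Poly_Mapping.lookup y w))"

primrec gen_comult :: "gen \<Rightarrow> free2" where
  "gen_comult (GE i) = pure2 (EE i) (KK i) + pure2 1 (EE i)"
| "gen_comult (GF i) = pure2 (FF i) 1 + pure2 (KI i) (FF i)"
| "gen_comult (GK i) = pure2 (KK i) (KK i)"
| "gen_comult (GKi i) = pure2 (KI i) (KI i)"

definition uq_comult :: "free \<Rightarrow> free2" where
  "uq_comult x = (\<Sum>w\<in>Poly_Mapping.keys x.
     scal (Poly_Mapping.lookup x w) * prod_list (map gen_comult (letters w)))"

primrec gen_counit :: "gen \<Rightarrow> complex" where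
  "gen_counit (GE i) = 0"
| "gen_counit (GF i) = 0"
| "gen_counit (GK i) = 1"
| "gen_counit (GKi i) = 1"

definition uq_counit :: "free \<Rightarrow> complex" where
  "uq_counit x = (\<Sum>w\<in>Poly_Mapping.keys x.
     Poly_Mapping.lookup x w * prod_list (map gen_counit (letters w)))"

text \<open>The antipode is forced by the coproduct: \<open>S(E) = -E K\<^sup>-\<^sup>1\<close>, \<open>S(F) = -K F\<close>, \<open>S(K) = K\<^sup>-\<^sup>1\<close>.\<close>

primrec gen_antipode :: "gen \<Rightarrow> free" where
  "gen_antipode (GE i) = - (EE i * KI i)"
| "gen_antipode (GF i) = - (KK i * FF i)"
| "gen_antipode (GK i) = KI i"
| "gen_antipode (GKi i) = KK i"

definition uq_antipode :: "free \<Rightarrow> free" where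
  "uq_antipode x = (\<Sum>w\<in>Poly_Mapping.keys x.
     scal (Poly_Mapping.lookup x w) * prod_list (rev (map gen_antipode (letters w))))"

primrec gen_star :: "gen \<Rightarrow> free" where
  "gen_star (GE i) = KK i * FF i"
| "gen_star (GF i) = EE i * KI i"
| "gen_star (GK i) = KK i"
| "gen_star (GKi i) = KI i"

definition uq_star :: "free \<Rightarrow> free" where
  "uq_star x = (\<Sum>w\<in>Poly_Mapping.keys x.
     scal (cnj (Poly_Mapping.lookup x w)) * prod_list (rev (map gen_star (letters w))))"


section \<open>The Hopf dual and the quantum coordinate algebra\<close>

type_synonym func = "free \<Rightarrow> complex"

definition uq_dual :: "real \<Rightarrow> func set" where
  "uq_dual q = {a. Vector_Spaces.linear free_scale (*) a \<and> (\<forall>x\<in>uq_ideal q. a x = 0)}"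

text \<open>
  The structure maps of the dual: the product of \<open>a\<close> and \<open>b\<close> is
  \<open>x \<mapsto> a(x\<^sub>1) b(x\<^sub>2)\<close>, the unit is \<open>uq_counit\<close>, the counit is \<open>a \<mapsto> a 1\<close>.
\<close>

definition conv :: "func \<Rightarrow> func \<Rightarrow> func" where
  "conv a b = (\<lambda>x. \<Sum>(v, w)\<in>Poly_Mapping.keys (uq_comult x).
     Poly_Mapping.lookup (uq_comult x) (v, w)
       * a (Poly_Mapping.single v 1) * b (Poly_Mapping.single w 1))"

definition comult :: "func \<Rightarrow> free \<times> free \<Rightarrow> complex" where
  "comult a = (\<lambda>(x, y). a (x * y))"

definition antipode :: "func \<Rightarrow> func" where
  "antipode a = (\<lambda>x. a (uq_antipode x))"

definition hopf_dual :: "real \<Rightarrow> func set" where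
  "hopf_dual q = {a \<in> uq_dual q. comult a \<in> tens_space (uq_dual q) (uq_dual q)}"

definition hopf_subalgebra :: "real \<Rightarrow> func set \<Rightarrow> bool" where
  "hopf_subalgebra q C \<longleftrightarrow>
     C \<subseteq> hopf_dual q \<and> fs.subspace C \<and>
     uq_counit \<in> C \<and> (\<forall>a\<in>C. \<forall>b\<in>C. conv a b \<in> C) \<and>
     (\<forall>a\<in>C. comult a \<in> tens_space C C) \<and> (\<forall>a\<in>C. antipode a \<in> C)"

fun gen_pairing :: "real \<Rightarrow> gen \<Rightarrow> nat \<Rightarrow> nat \<Rightarrow> complex" where
  "gen_pairing q (GE i) j k = (if j = nd i + 1 \<and> k = nd i then 1 else 0)"
| "gen_pairing q (GF i) j k = (if j = nd i \<and> k = nd i + 1 then 1 else 0)"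
| "gen_pairing q (GK i) j k =
     (if j = k then complex_of_real q powi (of_bool (j = nd i + 1) - of_bool (j = nd i)) else 0)"
| "gen_pairing q (GKi i) j k =
     (if j = k then complex_of_real q powi (- (of_bool (j = nd i + 1) - of_bool (j = nd i))) else 0)"

text \<open>
  The coproduct \<open>\<Delta>(u\<^sub>j\<^sub>k) = \<Sum>\<^sub>a u\<^sub>j\<^sub>a \<otimes> u\<^sub>a\<^sub>k\<close> and counit \<open>u\<^sub>j\<^sub>k \<mapsto> \<delta>\<^sub>j\<^sub>k\<close> extend the pairing
  from generators to words.
\<close>

fun word_pairing :: "real \<Rightarrow> gen list \<Rightarrow> nat \<Rightarrow> nat \<Rightarrow> complex" where
  "word_pairing q [] j k = (if j = k then 1 else 0)"
| "word_pairing q (g # gs) j k = (\<Sum>a\<in>{1..3}. gen_pairing q g j a * word_pairing q gs a k)"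

definition uu :: "real \<Rightarrow> nat \<Rightarrow> nat \<Rightarrow> func" where
  "uu q j k = (\<lambda>x. \<Sum>w\<in>Poly_Mapping.keys x.
     Poly_Mapping.lookup x w * word_pairing q (letters w) j k)"

definition OSU3 :: "real \<Rightarrow> func set" where
  "OSU3 q = \<Inter>{C. hopf_subalgebra q C \<and> (\<forall>j\<in>{1..3}. \<forall>k\<in>{1..3}. uu q j k \<in> C)}"

text \<open>\<open>X \<triangleright> a = a\<^sub>1 \<langle>X, a\<^sub>2\<rangle>\<close>, that is, \<open>y \<mapsto> a (y X)\<close>\<close>

definition act :: "free \<Rightarrow> func \<Rightarrow> func" where
  "act X a = (\<lambda>y. comult a (y, X))"

definition OF3 :: "real \<Rightarrow> func set" where
  "OF3 q = {b \<in> OSU3 q. \<forall>i. act (KK i) b = b \<and> act (KI i) b = b}"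

definition aug :: "func set \<Rightarrow> func set" where
  "aug C = {a \<in> C. a 1 = 0}"

text \<open>\<open>\<pi>\<^sub>B(A) = A / B\<^sup>+A\<close>\<close>

definition piB :: "real \<Rightarrow> free qspace" where
  "piB q = (OSU3 q, fs.span {conv b a |b a. b \<in> aug (OF3 q) \<and> a \<in> OSU3 q})"

definition piB_proj :: "real \<Rightarrow> func \<Rightarrow> func set" where
  "piB_proj q a = a +o snd (piB q)"

definition sweedler2 :: "real \<Rightarrow> func \<Rightarrow> (func \<times> func) list \<Rightarrow> bool" where
  "sweedler2 q a ps \<longleftrightarrow>
     set ps \<subseteq> OSU3 q \<times> OSU3 q \<and> comult a = (\<Sum>(b, c)\<leftarrow>ps. tens b c)"

definition sweedler3 :: "real \<Rightarrow> func \<Rightarrow> (func \<times> func \<times> func) list \<Rightarrow> bool" where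
  "sweedler3 q a ps \<longleftrightarrow>
     set ps \<subseteq> OSU3 q \<times> OSU3 q \<times> OSU3 q \<and>
     (\<lambda>(x, y, z). a (x * y * z)) = (\<Sum>(b, c, d)\<leftarrow>ps. tens b (tens c d))"


section \<open>The calculus\<close>

datatype pos_root = R1 | R2 | R12

primrec Eroot :: "real \<Rightarrow> pos_root \<Rightarrow> free" where
  "Eroot q R1 = EE N1"
| "Eroot q R2 = EE N2"
| "Eroot q R12 = EE N2 * EE N1 - scal (inverse (complex_of_real q)) * EE N1 * EE N2"

definition Froot :: "real \<Rightarrow> pos_root \<Rightarrow> free" where
  "Froot q \<gamma> = uq_star (Eroot q \<gamma>)"

definition tangent_basis :: "real \<Rightarrow> free list" where
  "tangent_basis q = map (Eroot q) [R1, R2, R12] @ map (Froot q) [R1, R2, R12]"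

definition tangent :: "real \<Rightarrow> free set" where
  "tangent q = fa.span (range (Eroot q) \<union> range (Froot q))"

definition Lambda1 :: "real \<Rightarrow> free qspace" where
  "Lambda1 q = (aug (OSU3 q), {y \<in> aug (OSU3 q). \<forall>X\<in>tangent q. y X = 0})"

definition V1 :: "real \<Rightarrow> free qspace" where
  "V1 q = (aug (OF3 q), {y \<in> aug (OF3 q). \<forall>X\<in>tangent q. y X = 0})"

text \<open>\<open>[b] \<mapsto> [b]\<close>\<close>

definition V1_to_Lambda1 :: "real \<Rightarrow> func set \<Rightarrow> func set" where
  "V1_to_Lambda1 q Y = Y + snd (Lambda1 q)"

text \<open>The element of \<open>\<Lambda>\<^sup>1\<close> dual to the \<open>n\<close>-th vector of \<open>tangent_basis\<close>, as a coset.\<close>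

definition dual_form :: "real \<Rightarrow> nat \<Rightarrow> func set" where
  "dual_form q n =
     {y \<in> aug (OSU3 q). \<forall>m<length (tangent_basis q). y (tangent_basis q ! m) = of_bool (m = n)}"

definition Aspace :: "real \<Rightarrow> free qspace" where
  "Aspace q = (OSU3 q, {0})"

definition Omega1 :: "real \<Rightarrow> (free \<times> free) qspace" where
  "Omega1 q = qtensor_space (Aspace q) (Lambda1 q)"

definition dd :: "real \<Rightarrow> func \<Rightarrow> (free \<times> free \<Rightarrow> complex) set" where
  "dd q a = qsum (Omega1 q)
     (map (\<lambda>n. qtensor (Aspace q) (Lambda1 q) {act (tangent_basis q ! n) a} (dual_form q n))
        [0..<length (tangent_basis q)])"

text \<open>The left action \<open>a (b \<otimes> v) = a b \<otimes> v\<close>, written for functions of two variables.\<close>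

definition lact :: "real \<Rightarrow> func \<Rightarrow> (free \<times> free \<Rightarrow> complex) set \<Rightarrow> (free \<times> free \<Rightarrow> complex) set" where
  "lact q a \<omega> = (\<lambda>t (x, y). conv a (\<lambda>z. t (z, y)) x) ` \<omega> + snd (Omega1 q)"

text \<open>
  Right \<open>\<pi>\<^sub>B(A)\<close>-covariance of the calculus: the map
  \<open>a db \<mapsto> a\<^sub>1 db\<^sub>1 \<otimes> \<pi>\<^sub>B(a\<^sub>2 b\<^sub>2)\<close> is well defined on \<open>\<Omega>\<^sup>1\<close>.
\<close>

definition quantum_principal_bundle :: "real \<Rightarrow> bool" where
  "quantum_principal_bundle q \<longleftrightarrow>
     (let \<Omega>H = qtensor_space (Omega1 q) (piB q) in
      \<exists>D. qlinear (Omega1 q) \<Omega>H D \<and>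
        (\<forall>a\<in>OSU3 q. \<forall>b\<in>OSU3 q. \<forall>ps qs. sweedler2 q a ps \<longrightarrow> sweedler2 q b qs \<longrightarrow>
           D (lact q a (dd q b)) =
             qsum \<Omega>H [qtensor (Omega1 q) (piB q) (lact q a1 (dd q b1)) (piB_proj q (conv a2 b2)).
                       (a1, a2) \<leftarrow> ps, (b1, b2) \<leftarrow> qs]))"

text \<open>
  The left \<open>\<pi>\<^sub>B(A)\<close>-coaction \<open>[a] \<mapsto> \<pi>\<^sub>B(a\<^sub>1 S(a\<^sub>3)) \<otimes> [a\<^sub>2]\<close> on \<open>\<Lambda>\<^sup>1\<close>. The individual
  \<open>a\<^sub>2\<close> need not lie in \<open>A\<^sup>+\<close>, but the whole sum lies in \<open>A \<otimes> A\<^sup>+\<close> when \<open>a \<in> A\<^sup>+\<close>.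
\<close>

definition is_coaction :: "real \<Rightarrow> (func set \<Rightarrow> (free \<times> free \<Rightarrow> complex) set) \<Rightarrow> bool" where
  "is_coaction q \<delta> \<longleftrightarrow>
     (let H\<Lambda> = qtensor_space (piB q) (Lambda1 q) in
      qlinear (Lambda1 q) H\<Lambda> \<delta> \<and>
      (\<forall>a\<in>aug (OSU3 q). \<forall>ps. sweedler3 q a ps \<longrightarrow>
         \<delta> (a +o snd (Lambda1 q)) =
           (\<Sum>(a1, a2, a3)\<leftarrow>ps. tens (conv a1 (antipode a3)) a2) +o snd H\<Lambda>))"

definition comodule_map :: "real \<Rightarrow> (func set \<Rightarrow> func set) \<Rightarrow> bool" where
  "comodule_map q p \<longleftrightarrow>
     qlinear (Lambda1 q) (Lambda1 q) p \<and>
     (\<exists>\<delta> g. is_coaction q \<delta> \<and> is_id_tensor (piB q) (Lambda1 q) p g \<and>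
        (\<forall>X\<in>qcarrier (Lambda1 q). g (\<delta> X) = \<delta> (p X)))"

definition principal_connection ::
    "real \<Rightarrow> ((free \<times> free \<Rightarrow> complex) set \<Rightarrow> (free \<times> free \<Rightarrow> complex) set) \<Rightarrow> bool" where
  "principal_connection q \<Pi> \<longleftrightarrow>
     (\<exists>p. comodule_map q p \<and>
        (\<forall>X\<in>qcarrier (Lambda1 q). p (p X) = p X) \<and>
        {X \<in> qcarrier (Lambda1 q). p X = qzero (Lambda1 q)} =
          V1_to_Lambda1 q ` qcarrier (V1 q) \<and>
        is_id_tensor (Aspace q) (Lambda1 q) p \<Pi>)"

end

theory Submission
  imports Defs
begin

text \<open>
  Write \<open>A\<close> and \<open>B\<close> for the coordinate algebras of the quantum group and of the flag manifold, and
  \<open>X\<^sub>n\<close> for the six root vectors. An element of \<open>A\<close> of fixed weight \<open>c\<close> under the action \<open>\<triangleright>\<close> of the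
  \<open>K\<^sub>i\<close> and with vanishing counit lies in \<open>B\<^sup>+A\<close>: writing \<open>1 = \<Sum> s t\<close> with \<open>s\<close> of weight \<open>1/c\<close> (for
  instance \<open>1 = \<Sum>\<^sub>j S(u\<^sub>k\<^sub>j) u\<^sub>j\<^sub>k\<close>) gives \<open>a = \<Sum> (a s) t\<close>. So in \<open>A / B\<^sup>+A\<close> an element of fixed weight
  is determined by its counit.

  The elements \<open>u\<^sub>j\<^sub>k S(u\<^sub>k\<^sub>k)\<close>, \<open>j \<noteq> k\<close>, lie in \<open>B\<^sup>+\<close> and are, up to nonzero scalars, dual to the six
  root vectors. Hence \<open>V\<^sup>1\<close> maps onto \<open>\<Lambda>\<^sup>1\<close>, and the projection with kernel \<open>\<Lambda>\<^sup>1\<close> is zero.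
  The coaction on \<open>\<Lambda>\<^sup>1\<close> and the right coaction on \<open>A \<otimes> \<Lambda>\<^sup>1\<close> are well defined because each \<open>X\<^sub>n\<close> is a
  weight vector for conjugation by the \<open>K\<^sub>i\<close>: both are given by explicit formulas in the dual basis
  that only involve the values at the \<open>X\<^sub>n\<close>, and these agree with the Sweedler formulas modulo
  \<open>B\<^sup>+A\<close> by comparing weights and counits.
\<close>

section \<open>Linear functionals on monoid algebras\<close>

text \<open>The obstacle that shapes the proof is that \<open>U_q\<close> is seen only through
  functionals on the free algebra, and \<open>A\<close> only as an intersection of Hopf subalgebras.
  So relations of \<open>U_q\<close> are used under a functional, identities between functionals are
  proved by induction over words, and \<open>A\<close> has to be exhibited as a concrete span before
  anything can be checked on it. In return, tensors are functions of several variables. A Sweedler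
  expression then becomes an explicit function, such as \<open>a(x_1 y S(x_2))\<close> for the
  coaction, in which the chosen representatives no longer occur; and vanishing modulo the kernel of
  \<open>A -> Lambda^1\<close> is tested by putting the six \<open>X_n\<close> (and
  \<open>1\<close>) into the corresponding variable. The quotient \<open>A / B^+A\<close> plays the
  part of the functions on the maximal torus. The classes of \<open>u_jj S(u_kk)\<close>, one for
  each \<open>X_n\<close>, are the characters of the torus belonging to the roots; they are what the
  explicit formulas for both coactions multiply by.\<close>

definition lin :: "(('m::monoid_add \<Rightarrow>\<^sub>0 complex) \<Rightarrow> complex) \<Rightarrow> bool" where
  "lin a \<longleftrightarrow> (\<forall>x y. a (x + y) = a x + a y) \<and> (\<forall>c x. a (scal c * x) = c * a x)"

lemma linI:
  assumes "\<And>x y. a (x + y) = a x + a y" "\<And>c x. a (scal c * x) = c * a x"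
  shows "lin a"
  using assms by (simp add: lin_def)

lemma lin_add: "lin a \<Longrightarrow> a (x + y) = a x + a y"
  and lin_scal: "lin a \<Longrightarrow> a (scal c * x) = c * a x"
  by (simp_all add: lin_def)

lemma lin_zero: "lin a \<Longrightarrow> a 0 = 0"
  using lin_add[of a 0 0] by simp

lemma lin_uminus: "lin a \<Longrightarrow> a (- x) = - a x"
  using lin_add[of a x "- x"] by (simp add: lin_zero add_eq_0_iff)

lemma lin_diff: "lin a \<Longrightarrow> a (x - y) = a x - a y"
  using lin_add[of a x "- y"] by (simp add: lin_uminus)

lemma poly_mapping_additive_induct [case_names zero single add]:
  assumes "P 0" "\<And>w c. P (Poly_Mapping.single w c)" "\<And>x y. P x \<Longrightarrow> P y \<Longrightarrow> P (x + y)"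
  shows "P (x :: 'm \<Rightarrow>\<^sub>0 complex)"
proof -
  have "P (\<Sum>w\<in>W. Poly_Mapping.single w (Poly_Mapping.lookup x w))" if "finite W" for W
    using that by induction (use assms in auto)
  moreover have "x = (\<Sum>w\<in>Poly_Mapping.keys x. Poly_Mapping.single w (Poly_Mapping.lookup x w))"
    by (rule poly_mapping_eqI)
      (auto simp: lookup_sum lookup_single "when_def" in_keys_iff sum.delta)
  ultimately show ?thesis
    by (metis finite_keys)
qed

lemma scal_central: "x * scal c = scal c * (x :: 'm::monoid_add \<Rightarrow>\<^sub>0 complex)"
  by (induction x rule: poly_mapping_additive_induct)
    (simp_all add: mult_single algebra_simps)

lemma single_eq_scal_mult:
  "Poly_Mapping.single w c = scal c * Poly_Mapping.single (w :: 'm::monoid_add) (1::complex)"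
  by (simp add: mult_single)

lemma mult_scal_left: "x * (scal c * y) = scal c * (x * (y :: 'm::monoid_add \<Rightarrow>\<^sub>0 complex))"
  by (metis mult.assoc scal_central)

lemma scal_mult_mult:
  "(scal c * x) * (scal d * y) = scal (c * d) * (x * (y :: 'm::monoid_add \<Rightarrow>\<^sub>0 complex))"
proof -
  have "(scal c * x) * (scal d * y) = scal c * (x * scal d) * y"
    by (simp only: mult.assoc)
  also have "\<dots> = (scal c * scal d) * (x * y)"
    by (simp only: scal_central[of x d] mult.assoc)
  finally show ?thesis
    by (simp add: mult_single)
qed

lemma lin_eqI:
  assumes "lin a" "lin b"
    and "\<And>w. a (Poly_Mapping.single w 1) = b (Poly_Mapping.single w 1)"
  shows "a x = b x"
proof (induction x rule: poly_mapping_additive_induct)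
  case (single w c)
  then show ?case
    by (subst (1 2) single_eq_scal_mult) (simp add: assms lin_scal)
qed (simp_all add: assms lin_zero lin_add)

definition ext :: "('m \<Rightarrow> complex) \<Rightarrow> ('m \<Rightarrow>\<^sub>0 complex) \<Rightarrow> complex" where
  "ext f x = (\<Sum>w\<in>Poly_Mapping.keys x. Poly_Mapping.lookup x w * f w)"

lemma ext_add: "ext f (x + y) = ext f x + ext f y"
  unfolding ext_def by (rule setsum_keys_plus_distrib) (simp_all add: algebra_simps)

lemma ext_single: "ext f (Poly_Mapping.single w c) = c * f w"
  by (simp add: ext_def)

lemma ext_scal: "ext f (scal c * x) = c * ext (f :: 'm::monoid_add \<Rightarrow> complex) x"
  by (induction x rule: poly_mapping_additive_induct)
    (simp_all add: ext_add ext_single mult_single algebra_simps, simp_all add: ext_def)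

lemma lin_ext: "lin (ext f)"
  by (rule linI) (simp_all add: ext_add ext_scal)

lemma linear_iff_lin: "Vector_Spaces.linear free_scale (*) a \<longleftrightarrow> lin a"
  unfolding lin_def Vector_Spaces.linear_def module_hom_def module_hom_axioms_def free_scale_def
  using fa.vector_space_axioms fa.module_axioms
  by (auto simp: free_scale_def[abs_def] vector_space_def module_def algebra_simps)

section \<open>The free algebra\<close>

lemma single_word_Nil: "Poly_Mapping.single (Word []) 1 = (1 :: free)"
  by (metis single_one zero_word_def)

lemma single_word_Cons:
  "Poly_Mapping.single (Word (g # gs)) 1 = gn g * Poly_Mapping.single (Word gs) 1"
  by (simp add: gn_def mult_single plus_word_def)

lemma single_word_snoc:
  "Poly_Mapping.single (Word (gs @ [g])) 1 = Poly_Mapping.single (Word gs) 1 * gn g"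
  by (simp add: gn_def mult_single plus_word_def)

lemma lin_word_eqI:
  assumes "lin a" "lin b"
    and "\<And>gs. a (Poly_Mapping.single (Word gs) 1) = b (Poly_Mapping.single (Word gs) 1)"
  shows "a x = b x"
proof (rule lin_eqI[OF assms(1,2)])
  show "a (Poly_Mapping.single w 1) = b (Poly_Mapping.single w 1)" for w
    by (cases w) (simp add: assms(3))
qed

lemma lin_lmult: "lin a \<Longrightarrow> lin (\<lambda>x. a (y * x))"
  by (auto simp: lin_def distrib_left mult_scal_left)

lemma lin_rmult: "lin a \<Longrightarrow> lin (\<lambda>x. a (x * y))"
  by (auto simp: lin_def distrib_right mult.assoc)

lemma lin_times_left: "lin a \<Longrightarrow> lin (\<lambda>x. c * a x)"
  by (auto simp: lin_def algebra_simps)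

lemma lin_times_right: "lin a \<Longrightarrow> lin (\<lambda>x. a x * c)"
  by (auto simp: lin_def algebra_simps)

lemma lin_plus: "lin a \<Longrightarrow> lin b \<Longrightarrow> lin (\<lambda>x. a x + b x)"
  by (auto simp: lin_def algebra_simps)

lemma lin_sum: "(\<And>i. i \<in> I \<Longrightarrow> lin (a i)) \<Longrightarrow> lin (\<lambda>x. \<Sum>i\<in>I. a i x)"
  by (auto simp: lin_def sum.distrib sum_distrib_left)


subsection \<open>The antipode\<close>

lemma uq_antipode_add: "uq_antipode (x + y) = uq_antipode x + uq_antipode y"
  unfolding uq_antipode_def
  by (rule setsum_keys_plus_distrib) (simp_all add: single_add algebra_simps)

lemma uq_antipode_single:
  "uq_antipode (Poly_Mapping.single w c) = scal c * prod_list (rev (map gen_antipode (letters w)))"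
  by (simp add: uq_antipode_def)

lemma uq_antipode_mult: "uq_antipode (x * y) = uq_antipode y * uq_antipode x"
proof -
  have 0: "uq_antipode 0 = 0" by (simp add: uq_antipode_def)
  have *: "uq_antipode (Poly_Mapping.single w c * y)
      = uq_antipode y * uq_antipode (Poly_Mapping.single w c)" for w c
    by (induction y rule: poly_mapping_additive_induct)
      (simp_all add: 0 uq_antipode_add uq_antipode_single mult_single plus_word_def
        distrib_left distrib_right scal_mult_mult mult.commute[of c])
  show ?thesis
    by (induction x rule: poly_mapping_additive_induct)
      (simp_all add: 0 uq_antipode_add * distrib_left distrib_right)
qed

lemma uq_antipode_1: "uq_antipode 1 = 1"
  using uq_antipode_single[of "Word []" 1] by (simp add: single_word_Nil)

lemma uq_antipode_gn: "uq_antipode (gn g) = gen_antipode g"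
  by (simp add: gn_def uq_antipode_single)

lemma uq_antipode_scal: "uq_antipode (scal c * x) = scal c * uq_antipode x"
proof -
  have "uq_antipode (scal c) = scal c"
    using uq_antipode_single[of 0 c] by (simp add: zero_word_def)
  then show ?thesis
    by (simp add: uq_antipode_mult scal_central)
qed

lemma uq_antipode_uminus: "uq_antipode (- x) = - uq_antipode x"
  using uq_antipode_add[of x "- x"] uq_antipode_def[of 0] by (simp add: add_eq_0_iff)

lemma lin_antipode: "lin a \<Longrightarrow> lin (\<lambda>x. a (uq_antipode x))"
  by (auto simp: lin_def uq_antipode_add uq_antipode_scal)

subsection \<open>The coproduct\<close>

lemma uq_comult_add: "uq_comult (x + y) = uq_comult x + uq_comult y"
  unfolding uq_comult_def
  by (rule setsum_keys_plus_distrib) (simp_all add: single_add algebra_simps)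

lemma uq_comult_single:
  "uq_comult (Poly_Mapping.single w c) = scal c * prod_list (map gen_comult (letters w))"
  by (simp add: uq_comult_def)

lemma uq_comult_mult: "uq_comult (x * y) = uq_comult x * uq_comult y"
proof -
  have 0: "uq_comult 0 = 0" by (simp add: uq_comult_def)
  have *: "uq_comult (Poly_Mapping.single w c * y)
      = uq_comult (Poly_Mapping.single w c) * uq_comult y" for w c
    by (induction y rule: poly_mapping_additive_induct)
      (simp_all add: 0 uq_comult_add uq_comult_single mult_single plus_word_def
        distrib_left distrib_right scal_mult_mult)
  show ?thesis
    by (induction x rule: poly_mapping_additive_induct)
      (simp_all add: 0 uq_comult_add * distrib_left distrib_right)
qed

lemma uq_comult_1: "uq_comult 1 = 1"
  using uq_comult_single[of "Word []" 1] by (simp add: single_word_Nil)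

lemma uq_comult_scal: "uq_comult (scal c * x) = scal c * uq_comult x"
proof -
  have "uq_comult (scal c) = scal c"
    using uq_comult_single[of 0 c] by (simp add: zero_word_def)
  then show ?thesis
    by (simp add: uq_comult_mult)
qed

lemma uq_comult_gn: "uq_comult (gn g) = gen_comult g"
  by (simp add: gn_def uq_comult_single)

text \<open>This is \<open>\<beta>(x_1, x_2)\<close> for a function \<open>\<beta>\<close> of two
  variables. The product form of \<open>conv\<close> is too narrow: the antipode axioms and the
  coaction lead to \<open>a(S(x_1) x_2)\<close> and \<open>a(x_1 y S(x_2))\<close>.\<close>

definition cop :: "(free \<Rightarrow> free \<Rightarrow> complex) \<Rightarrow> free \<Rightarrow> complex" where
  "cop \<beta> x = ext (\<lambda>(v, w). \<beta> (Poly_Mapping.single v 1) (Poly_Mapping.single w 1)) (uq_comult x)"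

lemma conv_eq_cop: "conv a b = cop (\<lambda>v w. a v * b w)"
  by (auto simp: fun_eq_iff conv_def cop_def ext_def case_prod_beta mult.assoc intro!: sum.cong)

lemma lin_cop: "lin (cop \<beta>)"
  by (rule linI) (simp_all add: cop_def uq_comult_add uq_comult_scal ext_add ext_scal)

lemma cop_fun_add: "cop (\<lambda>v w. \<beta> v w + \<gamma> v w) x = cop \<beta> x + cop \<gamma> x"
  by (simp add: cop_def ext_def case_prod_beta algebra_simps sum.distrib)

lemma cop_fun_scale: "cop (\<lambda>v w. c * \<beta> v w) x = c * cop \<beta> x"
  by (simp add: cop_def ext_def case_prod_beta algebra_simps sum_distrib_left)

lemma cop_fun_divide: "cop (\<lambda>v w. \<beta> v w / c) x = cop \<beta> x / c"
  using cop_fun_scale[of "inverse c" \<beta> x] by (simp add: divide_inverse mult.commute)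

lemma cop_fun_zero: "cop (\<lambda>v w. 0) x = 0"
  by (simp add: cop_def ext_def)

lemma cop_fun_uminus: "cop (\<lambda>v w. - \<beta> v w) x = - cop \<beta> x"
  using cop_fun_scale[of "-1" \<beta> x] by simp

lemma cop_fun_diff: "cop (\<lambda>v w. \<beta> v w - \<gamma> v w) x = cop \<beta> x - cop \<gamma> x"
  using cop_fun_add[of \<beta> "\<lambda>v w. - \<gamma> v w" x] by (simp add: cop_fun_uminus)

lemma cop_fun_sum_list: "cop (\<lambda>v w. \<Sum>i\<leftarrow>I. \<beta> i v w) x = (\<Sum>i\<leftarrow>I. cop (\<beta> i) x)"
  by (induction I) (simp_all add: cop_fun_zero cop_fun_add)

lemma cop_1: "cop \<beta> 1 = \<beta> 1 1"
proof -
  have "uq_comult 1 = Poly_Mapping.single (0, 0) 1"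
    by (simp add: uq_comult_1 flip: zero_prod_def)
  then show ?thesis
    by (simp add: cop_def ext_single)
qed

lemma pure2_single:
  "pure2 (Poly_Mapping.single v 1) (Poly_Mapping.single w 1) = Poly_Mapping.single (v, w) 1"
  by (simp add: pure2_def)

lemma pure2_gn: "pure2 (gn g) (gn h) = Poly_Mapping.single (Word [g], Word [h]) 1"
  "pure2 1 (gn h) = Poly_Mapping.single (0, Word [h]) 1"
  "pure2 (gn g) 1 = Poly_Mapping.single (Word [g], 0) 1"
  using pure2_single[of 0] pure2_single[of _ 0] by (simp_all add: gn_def pure2_single)

lemma ext_lmult_single:
  fixes \<beta> :: "free \<Rightarrow> free \<Rightarrow> complex"
  shows
  "ext (\<lambda>(v, w). \<beta> (Poly_Mapping.single v 1) (Poly_Mapping.single w 1))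
     (Poly_Mapping.single (v', w') 1 * t)
   = ext (\<lambda>(v, w). \<beta> (Poly_Mapping.single v' 1 * Poly_Mapping.single v 1)
                     (Poly_Mapping.single w' 1 * Poly_Mapping.single w 1)) (t :: free2)"
  by (rule lin_eqI[OF lin_lmult[OF lin_ext] lin_ext])
    (auto simp: mult_single ext_single split: prod.splits)

lemma ext_rmult_single:
  fixes \<beta> :: "free \<Rightarrow> free \<Rightarrow> complex"
  shows
  "ext (\<lambda>(v, w). \<beta> (Poly_Mapping.single v 1) (Poly_Mapping.single w 1))
     (t * Poly_Mapping.single (v', w') 1)
   = ext (\<lambda>(v, w). \<beta> (Poly_Mapping.single v 1 * Poly_Mapping.single v' 1)
                     (Poly_Mapping.single w 1 * Poly_Mapping.single w' 1)) (t :: free2)"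
  by (rule lin_eqI[OF lin_rmult[OF lin_ext] lin_ext])
    (auto simp: mult_single ext_single split: prod.splits)

text \<open>Multiplicativity of the coproduct, one letter at a time: the letter is absorbed into
  \<open>\<beta>\<close>. Inductions over words therefore have to leave \<open>\<beta>\<close> (or
  the functionals it is made of) arbitrary.\<close>

lemma cop_lmult:
  "cop \<beta> (EE i * x) = cop (\<lambda>v w. \<beta> (EE i * v) (KK i * w)) x + cop (\<lambda>v w. \<beta> v (EE i * w)) x"
  "cop \<beta> (FF i * x) = cop (\<lambda>v w. \<beta> (FF i * v) w) x + cop (\<lambda>v w. \<beta> (KI i * v) (FF i * w)) x"
  "cop \<beta> (KK i * x) = cop (\<lambda>v w. \<beta> (KK i * v) (KK i * w)) x"
  "cop \<beta> (KI i * x) = cop (\<lambda>v w. \<beta> (KI i * v) (KI i * w)) x"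
  by (simp_all add: cop_def uq_comult_mult uq_comult_gn pure2_gn distrib_right ext_add
      ext_lmult_single flip: gn_def)

lemma cop_rmult:
  "cop \<beta> (x * EE i) = cop (\<lambda>v w. \<beta> (v * EE i) (w * KK i)) x + cop (\<lambda>v w. \<beta> v (w * EE i)) x"
  "cop \<beta> (x * FF i) = cop (\<lambda>v w. \<beta> (v * FF i) w) x + cop (\<lambda>v w. \<beta> (v * KI i) (w * FF i)) x"
  "cop \<beta> (x * KK i) = cop (\<lambda>v w. \<beta> (v * KK i) (w * KK i)) x"
  "cop \<beta> (x * KI i) = cop (\<lambda>v w. \<beta> (v * KI i) (w * KI i)) x"
  by (simp_all add: cop_def uq_comult_mult uq_comult_gn pure2_gn distrib_left ext_add
      ext_rmult_single flip: gn_def)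

section \<open>Functionals vanishing on the ideal of relations\<close>

lemma uq_ideal_lmult: "x \<in> uq_ideal q \<Longrightarrow> y * x \<in> uq_ideal q"
  by (induction rule: uq_ideal.induct)
    (auto simp: distrib_left intro: uq_ideal.zero uq_ideal.add,
      metis mult.assoc uq_ideal.gen)

lemma uq_ideal_rmult: "x \<in> uq_ideal q \<Longrightarrow> x * y \<in> uq_ideal q"
  by (induction rule: uq_ideal.induct)
    (auto simp: distrib_right intro: uq_ideal.zero uq_ideal.add,
      metis mult.assoc uq_ideal.gen)

text \<open>The ideal consists of finite sums of terms \<open>x * r * y\<close>, so a linear
  functional has to be tested on these alone.\<close>

lemma uq_dual_iff:
  "a \<in> uq_dual q \<longleftrightarrow> lin a \<and> (\<forall>r\<in>uq_relations q. \<forall>x y. a (x * r * y) = 0)"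
proof -
  have "a x = 0" if "lin a" "\<forall>r\<in>uq_relations q. \<forall>x y. a (x * r * y) = 0" "x \<in> uq_ideal q" for x
    using that(3) by induction (use that in \<open>auto simp: lin_zero lin_add\<close>)
  then show ?thesis
    unfolding uq_dual_def linear_iff_lin by (auto intro: uq_ideal.gen)
qed

lemma uq_dual_lin: "a \<in> uq_dual q \<Longrightarrow> lin a"
  by (simp add: uq_dual_iff)

lemma uq_dual_lmult: "a \<in> uq_dual q \<Longrightarrow> (\<lambda>x. a (y * x)) \<in> uq_dual q"
  unfolding uq_dual_def linear_iff_lin by (auto intro: lin_lmult uq_ideal_lmult)

lemma uq_dual_rmult: "a \<in> uq_dual q \<Longrightarrow> (\<lambda>x. a (x * y)) \<in> uq_dual q"
  unfolding uq_dual_def linear_iff_lin by (auto intro: lin_rmult uq_ideal_rmult)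

lemma uq_dual_subspace: "fs.subspace (uq_dual q)"
  unfolding uq_dual_def linear_iff_lin
  by (auto intro!: fs.subspaceI linI simp: lin_def fscale_def algebra_simps)

lemma uq_dual_times: "a \<in> uq_dual q \<Longrightarrow> (\<lambda>x. c * a x) \<in> uq_dual q"
  using fs.subspace_scale[OF uq_dual_subspace, of a q c] by (simp add: fscale_def)

lemma uq_dual_times_right: "a \<in> uq_dual q \<Longrightarrow> (\<lambda>x. a x * c) \<in> uq_dual q"
  using uq_dual_times[of a q c] by (simp add: mult.commute)

lemma uq_dual_rel: "a \<in> uq_dual q \<Longrightarrow> r \<in> uq_relations q \<Longrightarrow> a (x * (r * y)) = 0"
  by (simp add: uq_dual_iff mult.assoc)

text \<open>A relation holds in \<open>free\<close> only modulo the ideal, so it is stated under a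
  functional, between an arbitrary prefix \<open>x\<close> and suffix \<open>y\<close>. The nesting
  to the right is the normal form under \<open>mult.assoc\<close>, which lets these facts act as
  rewrite rules inside words.\<close>

lemma dual_K_KI:
  assumes "a \<in> uq_dual q"
  shows "a (x * (KK i * (KI i * y))) = a (x * y)" "a (x * (KI i * (KK i * y))) = a (x * y)"
    "a (x * (KK i * (KK j * y))) = a (x * (KK j * (KK i * y)))"
proof -
  have rels: "KK i * KI i - 1 \<in> uq_relations q" "KI i * KK i - 1 \<in> uq_relations q"
    "KK i * KK j - KK j * KK i \<in> uq_relations q"
    unfolding uq_relations_def Let_def by blast+
  show "a (x * (KK i * (KI i * y))) = a (x * y)" "a (x * (KI i * (KK i * y))) = a (x * y)"
    "a (x * (KK i * (KK j * y))) = a (x * (KK j * (KK i * y)))"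
    using uq_dual_rel[OF assms rels(1), of x y] uq_dual_rel[OF assms rels(2), of x y]
      uq_dual_rel[OF assms rels(3), of x y]
    by (simp_all add: left_diff_distrib right_diff_distrib mult.assoc
        lin_diff[OF uq_dual_lin[OF assms]])
qed

lemma dual_K_E:
  assumes "a \<in> uq_dual q"
  shows "a (x * (KK i * (EE j * y)))
    = complex_of_real q powi cartan i j * a (x * (EE j * (KK i * y)))"
proof -
  have "KK i * EE j - scal (complex_of_real q powi cartan i j) * EE j * KK i \<in> uq_relations q"
    unfolding uq_relations_def Let_def by blast
  from uq_dual_rel[OF assms this, of x y] show ?thesis
    by (simp add: algebra_simps lin_diff[OF uq_dual_lin[OF assms]]
        mult_scal_left lin_scal[OF uq_dual_lin[OF assms]])
qed

lemma dual_K_F: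
  assumes "a \<in> uq_dual q"
  shows "a (x * (KK i * (FF j * y)))
    = complex_of_real q powi (- cartan i j) * a (x * (FF j * (KK i * y)))"
proof -
  have "KK i * FF j - scal (complex_of_real q powi (- cartan i j)) * FF j * KK i \<in> uq_relations q"
    unfolding uq_relations_def Let_def by blast
  from uq_dual_rel[OF assms this, of x y] show ?thesis
    by (simp add: algebra_simps lin_diff[OF uq_dual_lin[OF assms]]
        mult_scal_left lin_scal[OF uq_dual_lin[OF assms]])
qed

lemma dual_E_F:
  assumes "a \<in> uq_dual q"
  shows "a (x * (EE i * (FF j * y))) = a (x * (FF j * (EE i * y)))
    + (if i = j then 1 / (complex_of_real q - inverse (complex_of_real q))
         * (a (x * (KK i * y)) - a (x * (KI i * y))) else 0)"
proof -
  let ?Q = "complex_of_real q"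
  have "EE i * FF j - FF j * EE i
      - (if i = j then scal (1 / (?Q - inverse ?Q)) * (KK i - KI i) else 0) \<in> uq_relations q"
    unfolding uq_relations_def Let_def by blast
  from uq_dual_rel[OF assms this, of x y] show ?thesis
    by (cases "i = j") (simp_all add: algebra_simps lin_diff[OF uq_dual_lin[OF assms]]
        lin_add[OF uq_dual_lin[OF assms]] mult_scal_left lin_scal[OF uq_dual_lin[OF assms]])
qed

lemma dual_Serre_E:
  assumes "a \<in> uq_dual q" "i \<noteq> j"
  shows "a (x * (EE i * (EE i * (EE j * y))))
    = (complex_of_real q + inverse (complex_of_real q)) * a (x * (EE i * (EE j * (EE i * y))))
      - a (x * (EE j * (EE i * (EE i * y))))"
proof -
  let ?Q = "complex_of_real q"
  have "EE i * EE i * EE j - scal (?Q + inverse ?Q) * EE i * EE j * EE i + EE j * EE i * EE i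
      \<in> uq_relations q"
    unfolding uq_relations_def Let_def using assms(2) by blast
  from uq_dual_rel[OF assms(1) this, of x y] show ?thesis
    by (simp add: distrib_left distrib_right left_diff_distrib right_diff_distrib mult.assoc
        lin_diff[OF uq_dual_lin[OF assms(1)]] lin_add[OF uq_dual_lin[OF assms(1)]]
        mult_scal_left lin_scal[OF uq_dual_lin[OF assms(1)]] del: single_add) (simp add: algebra_simps)
qed

lemma dual_Serre_F:
  assumes "a \<in> uq_dual q" "i \<noteq> j"
  shows "a (x * (FF i * (FF i * (FF j * y))))
    = (complex_of_real q + inverse (complex_of_real q)) * a (x * (FF i * (FF j * (FF i * y))))
      - a (x * (FF j * (FF i * (FF i * y))))"
proof -
  let ?Q = "complex_of_real q"
  have "FF i * FF i * FF j - scal (?Q + inverse ?Q) * FF i * FF j * FF i + FF j * FF i * FF i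
      \<in> uq_relations q"
    unfolding uq_relations_def Let_def using assms(2) by blast
  from uq_dual_rel[OF assms(1) this, of x y] show ?thesis
    by (simp add: distrib_left distrib_right left_diff_distrib right_diff_distrib mult.assoc
        lin_diff[OF uq_dual_lin[OF assms(1)]] lin_add[OF uq_dual_lin[OF assms(1)]]
        mult_scal_left lin_scal[OF uq_dual_lin[OF assms(1)]] del: single_add) (simp add: algebra_simps)
qed

text \<open>The defining relations move only \<open>KK\<close> past \<open>EE\<close>. Inserting
  \<open>KK i * KI i\<close> behind \<open>EE j\<close>, moving the \<open>KK i\<close> to the left
  and cancelling it against \<open>KI i\<close> gives the rule for the inverse.\<close>

lemma dual_KI_E:
  assumes "a \<in> uq_dual q" "q \<noteq> 0"
  shows "a (x * (KI i * (EE j * y)))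
    = complex_of_real q powi (- cartan i j) * a (x * (EE j * (KI i * y)))"
proof -
  let ?Q = "complex_of_real q"
  have "a (x * (KI i * (EE j * y))) = a ((x * KI i * EE j) * (KK i * (KI i * y)))"
    by (simp only: dual_K_KI[OF assms(1)]) (simp add: mult.assoc)
  also have "\<dots> = a ((x * KI i) * (EE j * (KK i * (KI i * y))))"
    by (simp only: mult.assoc)
  also have "\<dots> = ?Q powi (- cartan i j) * a ((x * KI i) * (KK i * (EE j * (KI i * y))))"
    using assms(2) by (simp add: dual_K_E[OF assms(1)] power_int_minus)
  also have "a ((x * KI i) * (KK i * (EE j * (KI i * y)))) = a (x * (EE j * (KI i * y)))"
    by (simp only: dual_K_KI[OF assms(1)] mult.assoc)
  finally show ?thesis .
qed

lemma dual_KI_F: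
  assumes "a \<in> uq_dual q" "q \<noteq> 0"
  shows "a (x * (KI i * (FF j * y)))
    = complex_of_real q powi cartan i j * a (x * (FF j * (KI i * y)))"
proof -
  let ?Q = "complex_of_real q"
  have "a (x * (KI i * (FF j * y))) = a ((x * KI i * FF j) * (KK i * (KI i * y)))"
    by (simp only: dual_K_KI[OF assms(1)]) (simp add: mult.assoc)
  also have "\<dots> = a ((x * KI i) * (FF j * (KK i * (KI i * y))))"
    by (simp only: mult.assoc)
  also have "\<dots> = ?Q powi cartan i j * a ((x * KI i) * (KK i * (FF j * (KI i * y))))"
    using assms(2) by (simp add: dual_K_F[OF assms(1)] power_int_minus)
  also have "a ((x * KI i) * (KK i * (FF j * (KI i * y)))) = a (x * (FF j * (KI i * y)))"
    by (simp only: dual_K_KI[OF assms(1)] mult.assoc)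
  finally show ?thesis .
qed

lemma dual_KI_KI:
  assumes "a \<in> uq_dual q"
  shows "a (x * (KI i * (KI j * y))) = a (x * (KI j * (KI i * y)))"
proof -
  note d = dual_K_KI[OF assms]
  \<comment> \<open>The inserted word \<open>KK i * KK j * KI j * KI i\<close> is trivial;
    exchanging its first two letters lets them cancel the prefix \<open>KI i * KI j\<close> and
    leaves \<open>KI j * KI i\<close>.\<close>
  have "a (x * (KI i * (KI j * y))) = a ((x * KI i * KI j * KK i * KK j * KI j * KI i) * y)"
    using d(1)[of "x * KI i * KI j" i y] d(1)[of "x * KI i * KI j * KK i" j "KI i * y"]
    by (simp only: mult.assoc)
  also have "\<dots> = a ((x * KI i * KI j * KK j * KK i * KI j * KI i) * y)"
    using d(3)[of "x * KI i * KI j" i j "KI j * (KI i * y)"] by (simp only: mult.assoc)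
  also have "\<dots> = a (x * (KI j * (KI i * y)))"
    using d(2)[of "x * KI i" j "KK i * (KI j * (KI i * y))"] d(2)[of x i "KI j * (KI i * y)"]
    by (simp only: mult.assoc)
  finally show ?thesis .
qed

lemma dual_KI_K:
  assumes "a \<in> uq_dual q"
  shows "a (x * (KI i * (KK j * y))) = a (x * (KK j * (KI i * y)))"
proof -
  note d = dual_K_KI[OF assms]
  have "a (x * (KI i * (KK j * y))) = a ((x * KI i * KK j * KK i * KI i) * y)"
    using d(1)[of "x * KI i * KK j" i y] by (simp only: mult.assoc)
  also have "\<dots> = a ((x * KI i * KK i * KK j * KI i) * y)"
    using d(3)[of "x * KI i" i j "KI i * y"] by (simp only: mult.assoc)
  also have "\<dots> = a (x * (KK j * (KI i * y)))"
    using d(2)[of x i "KK j * (KI i * y)"] by (simp only: mult.assoc)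
  finally show ?thesis .
qed

section \<open>The convolution product\<close>

definition bidual :: "real \<Rightarrow> (free \<Rightarrow> free \<Rightarrow> complex) \<Rightarrow> bool" where
  "bidual q \<beta> \<longleftrightarrow> (\<forall>w. (\<lambda>v. \<beta> v w) \<in> uq_dual q) \<and> (\<forall>v. \<beta> v \<in> uq_dual q)"

lemma bidual_lmult: "bidual q \<beta> \<Longrightarrow> bidual q (\<lambda>v w. \<beta> (x * v) (y * w))"
  by (auto simp: bidual_def intro: uq_dual_lmult)

lemma bidual_lmult_left: "bidual q \<beta> \<Longrightarrow> bidual q (\<lambda>v w. \<beta> (x * v) w)"
  by (auto simp: bidual_def intro: uq_dual_lmult)

lemma bidual_lmult_right: "bidual q \<beta> \<Longrightarrow> bidual q (\<lambda>v w. \<beta> v (y * w))"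
  by (auto simp: bidual_def intro: uq_dual_lmult)

text \<open>Moving a letter of \<open>x\<close> into \<open>\<beta>\<close> replaces
  \<open>\<beta>\<close> by translates, which are again \<open>bidual\<close>; this is why the
  vanishing at \<open>z\<close> is assumed for every \<open>\<beta>\<close> of that kind.\<close>

lemma cop_lmult_zero:
  assumes "bidual q \<beta>" "\<And>\<beta>. bidual q \<beta> \<Longrightarrow> cop \<beta> z = 0"
  shows "cop \<beta> (x * z) = 0"
proof (rule lin_word_eqI[where b = "\<lambda>_. 0" and a = "\<lambda>x. cop \<beta> (x * z)"])
  show "cop \<beta> (Poly_Mapping.single (Word gs) 1 * z) = 0" for gs
    using assms(1)
  proof (induction gs arbitrary: \<beta>)
    case Nil
    then show ?case by (simp add: single_word_Nil assms(2))
  next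
    case (Cons g gs)
    show ?case
      by (cases g) (simp_all add: single_word_Cons mult.assoc cop_lmult Cons.IH Cons.prems
          bidual_lmult bidual_lmult_left bidual_lmult_right)
  qed
qed (simp_all add: lin_rmult lin_cop, simp add: lin_def)

lemma uq_relations_cases:
  assumes "r \<in> uq_relations q"
  obtains
      (KKI) i where "r = KK i * KI i - 1"
    | (KIK) i where "r = KI i * KK i - 1"
    | (KK) i j where "r = KK i * KK j - KK j * KK i"
    | (KE) i j where "r = KK i * EE j - scal (complex_of_real q powi cartan i j) * EE j * KK i"
    | (KF) i j where "r = KK i * FF j - scal (complex_of_real q powi (- cartan i j)) * FF j * KK i"
    | (EF) i j where "r = EE i * FF j - FF j * EE i
          - (if i = j then scal (1 / (complex_of_real q - inverse (complex_of_real q))) * (KK i - KI i) else 0)"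
    | (SE) i j where "i \<noteq> j"
        "r = EE i * EE i * EE j - scal (complex_of_real q + inverse (complex_of_real q)) * EE i * EE j * EE i + EE j * EE i * EE i"
    | (SF) i j where "i \<noteq> j"
        "r = FF i * FF i * FF j - scal (complex_of_real q + inverse (complex_of_real q)) * FF i * FF j * FF i + FF j * FF i * FF i"
  using assms unfolding uq_relations_def Let_def by blast

lemma cartan_commute: "cartan i j = cartan j i"
  by (auto simp: cartan_def)

text \<open>The coproduct respects the relations: \<open>\<Delta>(r)\<close> is zero once each
  tensor factor is read modulo the ideal. Since \<open>\<beta>\<close> lies in the dual in each
  variable, the rewrite rules for functionals apply to either factor.\<close>

lemma cop_relation_zero:
  assumes b: "bidual q \<beta>" and q: "q \<noteq> 0" "r \<in> uq_relations q"
  shows "cop \<beta> (r * y) = 0"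
proof -
  let ?Q = "complex_of_real q"
  note cop_simps = cop_lmult mult.assoc left_diff_distrib distrib_right mult_scal_left
    lin_diff[OF lin_cop] lin_add[OF lin_cop] lin_scal[OF lin_cop]
    cop_fun_add cop_fun_diff cop_fun_scale
  have l: "(\<lambda>v. \<beta> v w) \<in> uq_dual q" and r: "\<beta> v \<in> uq_dual q" for v w
    using b by (auto simp: bidual_def)
  note kk = dual_K_KI[OF l] dual_K_KI[OF r] dual_KI_KI[OF l] dual_KI_KI[OF r]
    dual_K_KI[OF l, where x = 1, unfolded mult_1_left] dual_K_KI[OF r, where x = 1, unfolded mult_1_left]
    dual_KI_KI[OF l, where x = 1, unfolded mult_1_left] dual_KI_KI[OF r, where x = 1, unfolded mult_1_left]
  note ke = dual_K_E[OF l] dual_K_E[OF r]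
    dual_K_E[OF l, where x = 1, unfolded mult_1_left] dual_K_E[OF r, where x = 1, unfolded mult_1_left]
  note kf = dual_K_F[OF l] dual_K_F[OF r]
    dual_K_F[OF l, where x = 1, unfolded mult_1_left] dual_K_F[OF r, where x = 1, unfolded mult_1_left]
  note kie = dual_KI_E[OF l q(1)] dual_KI_E[OF r q(1)]
    dual_KI_E[OF l q(1), where x = 1, unfolded mult_1_left] dual_KI_E[OF r q(1), where x = 1, unfolded mult_1_left]
  note kif = dual_KI_F[OF l q(1)] dual_KI_F[OF r q(1)]
    dual_KI_F[OF l q(1), where x = 1, unfolded mult_1_left] dual_KI_F[OF r q(1), where x = 1, unfolded mult_1_left]
  note ef = dual_E_F[OF l, where x = 1, unfolded mult_1_left] dual_E_F[OF r, where x = 1, unfolded mult_1_left]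
  note serre = dual_Serre_E[OF l, where x = 1, unfolded mult_1_left]
    dual_Serre_E[OF r, where x = 1, unfolded mult_1_left]
    dual_Serre_F[OF l, where x = 1, unfolded mult_1_left]
    dual_Serre_F[OF r, where x = 1, unfolded mult_1_left]
  have powi: "?Q powi (- n) * ?Q powi n = 1" "?Q powi n * ?Q powi (- n) = 1"
    "?Q powi n * (?Q powi (- n) * z) = z" "?Q powi (- n) * (?Q powi n * z) = z" for n z
    using q(1) by (simp_all add: power_int_minus)
  from q(2) show ?thesis
  proof (cases rule: uq_relations_cases)
    case KKI
    then show ?thesis by (simp add: cop_simps kk)
  next
    case KIK
    then show ?thesis by (simp add: cop_simps kk)
  next
    case KK
    then show ?thesis by (simp add: cop_simps kk)
  next
    case KE
    then show ?thesis by (simp add: cop_simps kk ke distrib_left)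
  next
    case KF
    then show ?thesis by (simp add: cop_simps kk kf dual_KI_K[OF l, where x = 1, unfolded mult_1_left] distrib_left)
  next
    case (EF i j)
    \<comment> \<open>The mixed terms \<open>E_i K_j^-1 (x) K_i F_j\<close> and
      \<open>K_j^-1 E_i (x) F_j K_i\<close> agree because the powers of \<open>q\<close> from the
      two reorderings cancel; this uses the symmetry of the Cartan matrix.\<close>
    show ?thesis
      unfolding EF
      by (cases "i = j") (simp_all add: cop_simps kk kf kie ef powi cartan_commute[of j i] cop_fun_divide
          flip: add_divide_distrib)
  next
    case (SE i j)
    \<comment> \<open>With these exponents and the \<open>KK\<close> letters moved to the right, the
      coefficients of the remaining terms are rational in \<open>Q\<close>, and
      \<open>field_simps\<close> settles their cancellation.\<close>
    have c: "cartan i i = 2" "cartan j j = 2" "cartan i j = -1" "cartan j i = -1"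
      using SE(1) by (auto simp: cartan_def)
    show ?thesis
      using q(1) SE(1) unfolding SE(2)
      apply (simp add: cop_simps kk ke serre c SE(1)[symmetric] power_int_minus)
      apply (simp add: field_simps power2_eq_square)
      done
  next
    case (SF i j)
    have c: "cartan i i = 2" "cartan j j = 2" "cartan i j = -1" "cartan j i = -1"
      using SF(1) by (auto simp: cartan_def)
    show ?thesis
      using q(1) SF(1) unfolding SF(2)
      apply (simp add: cop_simps kk kf kif serre c SF(1)[symmetric] power_int_minus)
      apply (simp add: field_simps power2_eq_square)
      done
  qed
qed

lemma cop_in_uq_dual:
  assumes "bidual q \<beta>" "q \<noteq> 0"
  shows "cop \<beta> \<in> uq_dual q"
  unfolding uq_dual_iff
proof (intro conjI ballI allI lin_cop)
  fix r x y assume "r \<in> uq_relations q"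
  then show "cop \<beta> (x * r * y) = 0"
    unfolding mult.assoc using assms(2) by (intro cop_lmult_zero[OF assms(1)] cop_relation_zero)
qed

lemma conv_in_uq_dual:
  assumes "a \<in> uq_dual q" "b \<in> uq_dual q" "q \<noteq> 0"
  shows "conv a b \<in> uq_dual q"
  unfolding conv_eq_cop using assms
  by (intro cop_in_uq_dual) (auto simp: bidual_def uq_dual_times uq_dual_times_right)

lemma lin_conv: "lin (conv a b)"
  by (simp add: conv_eq_cop lin_cop)

lemma conv_1: "conv a b 1 = a 1 * b 1"
  by (simp add: conv_eq_cop cop_1)

lemma conv_lmult:
  "conv a b (EE i * x) = conv (\<lambda>v. a (EE i * v)) (\<lambda>w. b (KK i * w)) x + conv a (\<lambda>w. b (EE i * w)) x"
  "conv a b (FF i * x) = conv (\<lambda>v. a (FF i * v)) b x + conv (\<lambda>v. a (KI i * v)) (\<lambda>w. b (FF i * w)) x"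
  "conv a b (KK i * x) = conv (\<lambda>v. a (KK i * v)) (\<lambda>w. b (KK i * w)) x"
  "conv a b (KI i * x) = conv (\<lambda>v. a (KI i * v)) (\<lambda>w. b (KI i * w)) x"
  by (simp_all add: conv_eq_cop cop_lmult)

lemma conv_rmult:
  "conv a b (x * EE i) = conv (\<lambda>v. a (v * EE i)) (\<lambda>w. b (w * KK i)) x + conv a (\<lambda>w. b (w * EE i)) x"
  "conv a b (x * FF i) = conv (\<lambda>v. a (v * FF i)) b x + conv (\<lambda>v. a (v * KI i)) (\<lambda>w. b (w * FF i)) x"
  "conv a b (x * KK i) = conv (\<lambda>v. a (v * KK i)) (\<lambda>w. b (w * KK i)) x"
  "conv a b (x * KI i) = conv (\<lambda>v. a (v * KI i)) (\<lambda>w. b (w * KI i)) x"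
  by (simp_all add: conv_eq_cop cop_rmult)

lemma conv_add_left: "conv (\<lambda>v. a v + a' v) b x = conv a b x + conv a' b x"
  by (simp add: conv_eq_cop distrib_right cop_fun_add)

lemma conv_add_right: "conv a (\<lambda>v. b v + b' v) x = conv a b x + conv a b' x"
  by (simp add: conv_eq_cop distrib_left cop_fun_add)

lemma conv_times_left: "conv (\<lambda>v. c * a v) b x = c * conv a b x"
  by (simp add: conv_eq_cop mult.assoc cop_fun_scale)

lemma conv_times_right: "conv a (\<lambda>v. c * b v) x = c * conv a b x"
  by (simp add: conv_eq_cop mult.left_commute cop_fun_scale)

lemma conv_zero_left: "conv (\<lambda>v. 0) b x = 0"
  and conv_zero_right: "conv a (\<lambda>v. 0) x = 0"
  by (simp_all add: conv_eq_cop cop_fun_zero)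

lemma conv_uminus_left: "conv (\<lambda>v. - a v) b x = - conv a b x"
  and conv_uminus_right: "conv a (\<lambda>v. - b v) x = - conv a b x"
  by (simp_all add: conv_eq_cop cop_fun_uminus)

lemma conv_sum_list_left: "conv (\<lambda>v. \<Sum>i\<leftarrow>I. f i v) b x = (\<Sum>i\<leftarrow>I. conv (f i) b x)"
  by (induction I) (simp_all add: conv_zero_left conv_add_left)

lemma conv_sum_list_right: "conv a (\<lambda>v. \<Sum>i\<leftarrow>I. f i v) x = (\<Sum>i\<leftarrow>I. conv a (f i) x)"
  by (induction I) (simp_all add: conv_zero_right conv_add_right)

lemmas conv_linear = conv_add_left conv_add_right conv_times_left conv_times_right
  conv_zero_left conv_zero_right conv_uminus_left conv_uminus_right

lemma conv_assoc: "conv (conv a b) c = conv a (conv b c)"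
proof
  fix x
  show "conv (conv a b) c x = conv a (conv b c) x"
  proof (rule lin_word_eqI[OF lin_conv lin_conv])
    show "conv (conv a b) c (Poly_Mapping.single (Word gs) 1)
        = conv a (conv b c) (Poly_Mapping.single (Word gs) 1)" for gs
    proof (induction gs arbitrary: a b c)
      case (Cons g gs)
      show ?case
        by (cases g) (simp_all add: single_word_Cons conv_lmult conv_linear Cons.IH)
    qed (simp add: single_word_Nil conv_1)
  qed
qed

lemma lin_counit: "lin uq_counit"
  using lin_ext[of "\<lambda>w. prod_list (map gen_counit (letters w))"]
  by (simp add: ext_def[abs_def] uq_counit_def[abs_def])

lemma counit_1: "uq_counit 1 = 1"
proof -
  have "uq_counit (Poly_Mapping.single (Word []) 1) = 1"
    by (simp add: uq_counit_def)
  then show ?thesis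
    by (simp add: single_word_Nil)
qed

lemma counit_lmult: "uq_counit (gn g * x) = gen_counit g * uq_counit x"
proof (rule lin_word_eqI[OF lin_lmult[OF lin_counit] lin_times_left[OF lin_counit]])
  show "uq_counit (gn g * Poly_Mapping.single (Word gs) 1)
      = gen_counit g * uq_counit (Poly_Mapping.single (Word gs) 1)" for gs
    by (simp add: uq_counit_def flip: single_word_Cons)
qed

lemma counit_mult: "uq_counit (x * y) = uq_counit x * uq_counit y"
proof (rule lin_word_eqI[OF lin_rmult[OF lin_counit] lin_times_right[OF lin_counit]])
  show "uq_counit (Poly_Mapping.single (Word gs) 1 * y)
      = uq_counit (Poly_Mapping.single (Word gs) 1) * uq_counit y" for gs
    by (induction gs)
      (simp_all add: single_word_Nil single_word_Cons counit_1 counit_lmult mult.assoc)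
qed

lemma counit_gn: "uq_counit (gn g) = gen_counit g"
  using counit_lmult[of g 1] by (simp add: counit_1)

lemma counit_in_uq_dual: "uq_counit \<in> uq_dual q"
proof -
  have "uq_counit r = 0" if "r \<in> uq_relations q" for r
    using that unfolding uq_relations_def Let_def
    by (auto simp: lin_diff[OF lin_counit] lin_add[OF lin_counit] counit_mult counit_gn counit_1
        lin_zero[OF lin_counit])
  then show ?thesis
    by (simp add: uq_dual_iff lin_counit counit_mult)
qed

lemma conv_counit_left:
  assumes "lin a" shows "conv uq_counit a = a"
proof
  fix x
  show "conv uq_counit a x = a x"
  proof (rule lin_word_eqI[OF lin_conv assms])
    show "conv uq_counit a (Poly_Mapping.single (Word gs) 1) = a (Poly_Mapping.single (Word gs) 1)" for gs
    proof (induction gs arbitrary: a)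
      case (Cons g gs)
      show ?case
        by (cases g) (simp_all add: single_word_Cons conv_lmult counit_lmult conv_linear Cons.IH)
    qed (simp add: single_word_Nil conv_1 counit_1)
  qed
qed

lemma conv_counit_right:
  assumes "lin a" shows "conv a uq_counit = a"
proof
  fix x
  show "conv a uq_counit x = a x"
  proof (rule lin_word_eqI[OF lin_conv assms])
    show "conv a uq_counit (Poly_Mapping.single (Word gs) 1) = a (Poly_Mapping.single (Word gs) 1)" for gs
    proof (induction gs arbitrary: a)
      case (Cons g gs)
      show ?case
        by (cases g) (simp_all add: single_word_Cons conv_lmult counit_lmult conv_linear Cons.IH)
    qed (simp add: single_word_Nil conv_1 counit_1)
  qed
qed

lemma lin_sum_list: "(\<And>i. i \<in> set I \<Longrightarrow> lin (f i)) \<Longrightarrow> lin (\<lambda>x. \<Sum>i\<leftarrow>I. f i x)"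
  by (induction I) (auto simp: lin_plus, simp add: lin_def)

text \<open>This is \<open>\<Delta>(ab) = a_1 b_1 (x) a_2 b_2\<close> for any given expansions of
  the coproducts. Letters of the left argument are absorbed by \<open>a1\<close> and
  \<open>b1\<close> alone, so \<open>a2\<close>, \<open>b2\<close> and \<open>y\<close> stay fixed
  in the induction; at the empty word the expansions recover \<open>a\<close> and \<open>b\<close>
  from their right factors.\<close>

lemma conv_comult:
  assumes "\<And>x y. a (x * y) = (\<Sum>i\<leftarrow>I. a1 i x * a2 i y)"
    and "\<And>x y. b (x * y) = (\<Sum>j\<leftarrow>J. b1 j x * b2 j y)"
  shows "conv a b (x * y) = (\<Sum>i\<leftarrow>I. \<Sum>j\<leftarrow>J. conv (a1 i) (b1 j) x * conv (a2 i) (b2 j) y)"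
proof (rule lin_word_eqI[where x = x])
  show "lin (\<lambda>x. conv a b (x * y))"
    by (intro lin_rmult lin_conv)
  show "lin (\<lambda>x. \<Sum>i\<leftarrow>I. \<Sum>j\<leftarrow>J. conv (a1 i) (b1 j) x * conv (a2 i) (b2 j) y)"
    by (intro lin_sum_list lin_times_right lin_conv)
  show "conv a b (Poly_Mapping.single (Word gs) 1 * y)
      = (\<Sum>i\<leftarrow>I. \<Sum>j\<leftarrow>J. conv (a1 i) (b1 j) (Poly_Mapping.single (Word gs) 1) * conv (a2 i) (b2 j) y)" for gs
    using assms
  proof (induction gs arbitrary: a b a1 b1)
    case Nil
    have "a = (\<lambda>y. \<Sum>i\<leftarrow>I. a1 i 1 * a2 i y)" "b = (\<lambda>y. \<Sum>j\<leftarrow>J. b1 j 1 * b2 j y)"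
      using Nil(1)[of 1] Nil(2)[of 1] by auto
    then show ?case
      by (simp add: single_word_Nil conv_1 conv_sum_list_left conv_sum_list_right
          conv_times_left conv_times_right sum_list_const_mult mult.assoc mult.left_commute)
  next
    case (Cons g gs)
    have a: "a (z * (x * y)) = (\<Sum>i\<leftarrow>I. a1 i (z * x) * a2 i y)" for x y z
      using Cons.prems(1)[of "z * x" y] by (simp add: mult.assoc)
    have b: "b (z * (x * y)) = (\<Sum>j\<leftarrow>J. b1 j (z * x) * b2 j y)" for x y z
      using Cons.prems(2)[of "z * x" y] by (simp add: mult.assoc)
    show ?case
      by (cases g) (simp_all add: single_word_Cons mult.assoc conv_lmult
          Cons.IH[OF a b] Cons.IH[OF a Cons.prems(2)] Cons.IH[OF Cons.prems(1) b]
          sum_list_addf distrib_right)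
  qed
qed

text \<open>The antipode turns the letters \<open>EE\<close> and \<open>FF\<close> into two-letter
  words. These are kept as blocks here, because the induction hypotheses for
  \<open>antipode_conv\<close> speak of right translates by such a block.\<close>

lemma conv_rmult_antipode:
  "conv a b (x * (EE i * KI i)) = conv (\<lambda>v. a (v * (EE i * KI i))) (\<lambda>w. b (w * (KK i * KI i))) x
    + conv (\<lambda>v. a (v * KI i)) (\<lambda>w. b (w * (EE i * KI i))) x"
  "conv a b (x * (KK i * FF i)) = conv (\<lambda>v. a (v * (KK i * FF i))) (\<lambda>w. b (w * KK i)) x
    + conv (\<lambda>v. a (v * (KK i * KI i))) (\<lambda>w. b (w * (KK i * FF i))) x"
  by (simp_all only: mult.assoc[symmetric] conv_rmult)

lemma antipode_conv:
  assumes "a \<in> uq_dual q" "b \<in> uq_dual q"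
  shows "antipode (conv a b) = conv (antipode b) (antipode a)"
proof
  fix x
  show "antipode (conv a b) x = conv (antipode b) (antipode a) x"
  proof (rule lin_word_eqI)
    show "lin (antipode (conv a b))" "lin (conv (antipode b) (antipode a))"
      by (simp_all add: antipode_def[abs_def] lin_antipode lin_conv)
    show "antipode (conv a b) (Poly_Mapping.single (Word gs) 1)
        = conv (antipode b) (antipode a) (Poly_Mapping.single (Word gs) 1)" for gs
      using assms
    proof (induction gs arbitrary: a b)
      case (Cons g gs)
      \<comment> \<open>The antipode reverses words, so a letter in front of the argument becomes a
        right translation of \<open>a\<close> and \<open>b\<close>; the hypothesis is needed for the
        translates of both, of one, and of none.\<close>
      note r = uq_dual_rmult[OF Cons.prems(1)] uq_dual_rmult[OF Cons.prems(2)]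
      note IH = Cons.IH[OF Cons.prems] Cons.IH[OF r] Cons.IH[OF r(1) Cons.prems(2)]
        Cons.IH[OF Cons.prems(1) r(2)]
      note lins = uq_dual_lin[OF Cons.prems(1)] uq_dual_lin[OF Cons.prems(2)]
      have k: "a (x * (KK i * KI i)) = a x" "b (x * (KK i * KI i)) = b x"
        "a (x * (KI i * KK i)) = a x" "b (x * (KI i * KK i)) = b x" for x i
        using dual_K_KI[OF Cons.prems(1), where x = x and y = 1 and i = i]
          dual_K_KI[OF Cons.prems(2), where x = x and y = 1 and i = i] by simp_all
      show ?case
        using IH
        by (cases g) (simp_all add: single_word_Cons antipode_def uq_antipode_mult uq_antipode_gn
            conv_lmult conv_rmult conv_rmult_antipode k lin_uminus[OF lin_conv]
            lin_uminus[OF lins(1)] lin_uminus[OF lins(2)] conv_linear)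
    qed (simp add: single_word_Nil conv_1 antipode_def uq_antipode_1)
  qed
qed

lemma cop_antipode_left:
  assumes "a \<in> uq_dual q"
  shows "cop (\<lambda>v w. a (uq_antipode v * w)) x = uq_counit x * a 1"
proof (rule lin_word_eqI[OF lin_cop lin_times_right[OF lin_counit]])
  note d = dual_K_KI[OF assms] and l = uq_dual_lin[OF assms]
  show "cop (\<lambda>v w. a (uq_antipode v * w)) (Poly_Mapping.single (Word gs) 1)
    = uq_counit (Poly_Mapping.single (Word gs) 1) * a 1" for gs
  proof (induction gs)
    case (Cons g gs)
    have d2: "a (x * (EE i * (KI i * (KK i * y)))) = a (x * (EE i * y))" for x y i
      using d(2)[of "x * EE i" i y] by (simp add: mult.assoc)
    show ?case
      by (cases g) (simp_all add: single_word_Cons cop_lmult uq_antipode_mult uq_antipode_gn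
          mult.assoc d d2 lin_uminus[OF l] counit_lmult Cons.IH cop_fun_uminus)
  qed (simp add: single_word_Nil cop_1 uq_antipode_1 counit_1)
qed

text \<open>In \<open>v * S(w)\<close> the factors of the last letter meet in the middle and cancel,
  so letters are split off at the end of the word; for \<open>S(v) * w\<close> it is the first
  letter that cancels.\<close>

lemma cop_antipode_right:
  assumes "a \<in> uq_dual q"
  shows "cop (\<lambda>v w. a (v * uq_antipode w)) x = uq_counit x * a 1"
proof (rule lin_word_eqI[OF lin_cop lin_times_right[OF lin_counit]])
  note d = dual_K_KI[OF assms] and l = uq_dual_lin[OF assms]
  show "cop (\<lambda>v w. a (v * uq_antipode w)) (Poly_Mapping.single (Word gs) 1)
    = uq_counit (Poly_Mapping.single (Word gs) 1) * a 1" for gs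
  proof (induction gs rule: rev_induct)
    case (snoc g gs)
    show ?case
      by (cases g) (simp_all add: single_word_snoc cop_rmult uq_antipode_mult uq_antipode_gn
          mult.assoc d lin_uminus[OF l] counit_mult counit_gn snoc.IH cop_fun_uminus)
  qed (simp add: single_word_Nil cop_1 uq_antipode_1 counit_1)
qed

section \<open>The generators of the quantum coordinate algebra\<close>

lemma sum_upto_3: "(\<Sum>a\<in>{1..3::nat}. f a) = f 1 + f 2 + f 3"
  "(\<Sum>a\<in>{Suc 0..3::nat}. f a) = f 1 + f 2 + f 3"
  by (simp_all add: numeral_3_eq_3 numeral_2_eq_2 add.assoc)

lemma in_upto_3: "j \<in> {1..3::nat} \<longleftrightarrow> j = 1 \<or> j = 2 \<or> j = 3"
  by auto

lemma lin_uu: "lin (uu q j k)"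
  using lin_ext[of "\<lambda>w. word_pairing q (letters w) j k"]
  by (simp add: ext_def[abs_def] uu_def[abs_def])

lemma uu_1: "uu q j k 1 = of_bool (j = k)"
proof -
  have "uu q j k (Poly_Mapping.single (Word []) 1) = of_bool (j = k)"
    by (simp add: uu_def)
  then show ?thesis
    by (simp add: single_word_Nil)
qed

lemma uu_lmult: "uu q j k (gn g * x) = (\<Sum>a\<in>{1..3}. gen_pairing q g j a * uu q a k x)"
proof (rule lin_word_eqI[OF lin_lmult[OF lin_uu]])
  show "lin (\<lambda>x. \<Sum>a\<in>{1..3}. gen_pairing q g j a * uu q a k x)"
    by (intro lin_sum lin_times_left lin_uu)
  show "uu q j k (gn g * Poly_Mapping.single (Word gs) 1)
      = (\<Sum>a\<in>{1..3}. gen_pairing q g j a * uu q a k (Poly_Mapping.single (Word gs) 1))" for gs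
    by (simp add: uu_def flip: single_word_Cons)
qed

lemma uu_gn:
  assumes "k \<in> {1..3}"
  shows "uu q j k (gn g) = gen_pairing q g j k"
  using uu_lmult[of q j k g 1] assms unfolding in_upto_3 by (auto simp: uu_1 sum_upto_3)

lemma uu_mult:
  assumes "j \<in> {1..3}"
  shows "uu q j k (x * y) = (\<Sum>a\<in>{1..3}. uu q j a x * uu q a k y)"
proof (rule lin_word_eqI[OF lin_rmult[OF lin_uu]])
  show "lin (\<lambda>x. \<Sum>a\<in>{1..3}. uu q j a x * uu q a k y)"
    by (intro lin_sum lin_times_right lin_uu)
  show "uu q j k (Poly_Mapping.single (Word gs) 1 * y)
      = (\<Sum>a\<in>{1..3}. uu q j a (Poly_Mapping.single (Word gs) 1) * uu q a k y)" for gs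
    using assms
  proof (induction gs arbitrary: j)
    case Nil
    then show ?case
      unfolding in_upto_3 by (auto simp: single_word_Nil uu_1 sum_upto_3)
  next
    case (Cons g gs)
    have "uu q j k (Poly_Mapping.single (Word (g # gs)) 1 * y)
      = (\<Sum>b\<in>{1..3}. gen_pairing q g j b *
          (\<Sum>a\<in>{1..3}. uu q b a (Poly_Mapping.single (Word gs) 1) * uu q a k y))"
      by (simp only: single_word_Cons mult.assoc uu_lmult) (rule sum.cong, simp_all add: Cons.IH)
    then show ?case
      by (simp add: single_word_Cons uu_lmult sum_upto_3 algebra_simps)
  qed
qed

text \<open>The matrix coproduct strips off the prefix \<open>x\<close>, so it is enough that each
  relation in front of a suffix vanishes. That is the statement that the 3 by 3 matrices of the
  vector representation satisfy the relations, checked entry by entry.\<close>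

lemma uu_in_uq_dual:
  assumes "q \<noteq> 0" "q\<^sup>2 \<noteq> 1" "j \<in> {1..3}" "k \<in> {1..3}"
  shows "uu q j k \<in> uq_dual q"
proof -
  let ?Q = "complex_of_real q"
  have Q: "?Q \<noteq> 0" "?Q\<^sup>2 \<noteq> 1"
    using assms(1,2) by (auto simp flip: of_real_power)
  have QQ: "?Q - inverse ?Q \<noteq> 0" "?Q * ?Q \<noteq> 1"
    using Q by (auto simp: field_simps power2_eq_square)
  have r: "uu q j k (r * y) = 0" if "j \<in> {1..3}" "r \<in> uq_relations q" for r j y
  proof -
    note l = lin_diff[OF lin_uu] lin_add[OF lin_uu] lin_scal[OF lin_uu] lin_zero[OF lin_uu]
    note s = l mult.assoc left_diff_distrib distrib_right uu_lmult sum_upto_3 cartan_def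
      power_int_minus power2_eq_square
    show ?thesis
      using that(2)
    proof (cases rule: uq_relations_cases)
      case (KKI i)
      then show ?thesis
        using that(1) Q unfolding in_upto_3 by (cases i; elim disjE; simp add: s)
    next
      case (KIK i)
      then show ?thesis
        using that(1) Q unfolding in_upto_3 by (cases i; elim disjE; simp add: s)
    next
      case (KK i j)
      then show ?thesis
        using that(1) Q unfolding in_upto_3 by (cases i; cases j; elim disjE; simp add: s)
    next
      case (KE i j)
      then show ?thesis
        using that(1) Q unfolding in_upto_3 by (cases i; cases j; elim disjE; simp add: s)
    next
      case (KF i j)
      then show ?thesis
        using that(1) Q unfolding in_upto_3 by (cases i; cases j; elim disjE; simp add: s)
    next
      case (EF i j)
      define c where "c = 1 / (?Q - inverse ?Q)"
      \<comment> \<open>This is \<open>(q - 1/q) / (q - 1/q) = 1\<close> solved for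
        \<open>c * q\<close>. It is where \<open>q\<close> must differ from its inverse, and as a
        rewrite rule it makes the commutator of \<open>E_i\<close> and \<open>F_i\<close> come out
        on the diagonal.\<close>
      have c: "c * ?Q = 1 + c * inverse ?Q"
        using QQ by (simp add: c_def divide_simps)
      have cz: "c * (?Q * z) = z + c * (inverse ?Q * z)" "c * (z / ?Q) = c * (inverse ?Q * z)" for z
        using arg_cong[OF c, of "\<lambda>t. t * z"] by (simp_all add: algebra_simps divide_inverse)
      show ?thesis
        using that(1) unfolding EF c_def[symmetric] in_upto_3
        by (cases i; cases j; elim disjE; simp add: s cz right_diff_distrib)
    next
      case (SE i j)
      then show ?thesis
        using that(1) Q unfolding in_upto_3 by (cases i; cases j; elim disjE; simp add: s)
    next
      case (SF i j)
      then show ?thesis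
        using that(1) Q unfolding in_upto_3 by (cases i; cases j; elim disjE; simp add: s)
    qed
  qed
  show ?thesis
    unfolding uq_dual_iff
  proof (intro conjI ballI allI lin_uu)
    fix r x y assume "r \<in> uq_relations q"
    then show "uu q j k (x * r * y) = 0"
      unfolding mult.assoc by (subst uu_mult[OF assms(3)], intro sum.neutral) (auto simp: r)
  qed
qed

text \<open>The values \<open>u_jk(S(g))\<close>. From \<open>S(E) = -E K^-1\<close> and the entry
  \<open>q\<close> of \<open>K_i^-1\<close> at \<open>(i,i)\<close> comes \<open>-q\<close>; from
  \<open>S(F) = -K F\<close> and the entry \<open>1/q\<close> of \<open>K_i\<close> there comes
  \<open>-1/q\<close>.\<close>

fun antipode_pairing :: "real \<Rightarrow> gen \<Rightarrow> nat \<Rightarrow> nat \<Rightarrow> complex" where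
  "antipode_pairing q (GE i) j k = (if j = nd i + 1 \<and> k = nd i then - complex_of_real q else 0)"
| "antipode_pairing q (GF i) j k = (if j = nd i \<and> k = nd i + 1 then - inverse (complex_of_real q) else 0)"
| "antipode_pairing q (GK i) j k = gen_pairing q (GKi i) j k"
| "antipode_pairing q (GKi i) j k = gen_pairing q (GK i) j k"

lemma uu_gen_antipode:
  assumes "q \<noteq> 0" "j \<in> {1..3}" "k \<in> {1..3}"
  shows "uu q j k (gen_antipode g) = antipode_pairing q g j k"
proof (cases g)
  case (GE i)
  then show ?thesis
    using assms(2) uu_gn[OF assms(3), of q] assms(3) unfolding in_upto_3
    by (cases i; elim disjE; simp add: lin_uminus[OF lin_uu] uu_lmult sum_upto_3)
next
  case (GF i)
  then show ?thesis
    using assms(2) uu_gn[OF assms(3), of q] assms(3) unfolding in_upto_3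
    by (cases i; elim disjE; simp add: lin_uminus[OF lin_uu] uu_lmult sum_upto_3 power_int_minus)
qed (use uu_gn[OF assms(3), of q] in simp_all)

abbreviation su :: "real \<Rightarrow> nat \<Rightarrow> nat \<Rightarrow> func" where
  "su q j k \<equiv> antipode (uu q j k)"

lemma lin_su: "lin (su q j k)"
  by (simp add: antipode_def[abs_def] lin_antipode lin_uu)

lemma su_1: "su q j k 1 = of_bool (j = k)"
  by (simp add: antipode_def uq_antipode_1 uu_1)

lemma su_mult:
  assumes "j \<in> {1..3}"
  shows "su q j k (x * y) = (\<Sum>a\<in>{1..3}. su q j a y * su q a k x)"
  by (simp add: antipode_def uq_antipode_mult uu_mult[OF assms])

lemma su_lmult:
  assumes "q \<noteq> 0" "j \<in> {1..3}" "k \<in> {1..3}"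
  shows "su q j k (gn g * x) = (\<Sum>a\<in>{1..3}. antipode_pairing q g a k * su q j a x)"
  unfolding su_mult[OF assms(2)]
  by (rule sum.cong) (use assms in \<open>simp_all add: antipode_def uq_antipode_gn uu_gen_antipode\<close>)

lemma su_in_uq_dual:
  assumes q: "q \<noteq> 0" "q\<^sup>2 \<noteq> 1" and j: "j \<in> {1..3}" and k: "k \<in> {1..3}"
  shows "su q j k \<in> uq_dual q"
proof -
  let ?Q = "complex_of_real q"
  have Q: "?Q \<noteq> 0" "?Q\<^sup>2 \<noteq> 1"
    using q by (auto simp flip: of_real_power)
  have QQ: "?Q - inverse ?Q \<noteq> 0" "?Q * ?Q \<noteq> 1"
    using Q by (auto simp: field_simps power2_eq_square)
  have m: "su q j 1 (gn g * x) = (\<Sum>a\<in>{1..3}. antipode_pairing q g a 1 * su q j a x)"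
    "su q j (Suc 0) (gn g * x) = (\<Sum>a\<in>{1..3}. antipode_pairing q g a 1 * su q j a x)"
    "su q j 2 (gn g * x) = (\<Sum>a\<in>{1..3}. antipode_pairing q g a 2 * su q j a x)"
    "su q j 3 (gn g * x) = (\<Sum>a\<in>{1..3}. antipode_pairing q g a 3 * su q j a x)" for g x
    using su_lmult[OF q(1) j, of _ g x] by auto
  have r: "su q j k (r * y) = 0" if "k \<in> {1..3}" "r \<in> uq_relations q" for r k y
  proof -
    note s = lin_diff[OF lin_su] lin_add[OF lin_su] lin_scal[OF lin_su] lin_zero[OF lin_su]
      mult.assoc left_diff_distrib distrib_right m sum_upto_3 cartan_def
      power_int_minus power2_eq_square
    show ?thesis
      using that(2)
    proof (cases rule: uq_relations_cases)
      case (KKI i)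
      then show ?thesis
        using that(1) Q unfolding in_upto_3 by (cases i; elim disjE; simp add: s)
    next
      case (KIK i)
      then show ?thesis
        using that(1) Q unfolding in_upto_3 by (cases i; elim disjE; simp add: s)
    next
      case (KK i j)
      then show ?thesis
        using that(1) Q unfolding in_upto_3 by (cases i; cases j; elim disjE; simp add: s)
    next
      case (KE i j)
      then show ?thesis
        using that(1) Q unfolding in_upto_3 by (cases i; cases j; elim disjE; simp add: s)
    next
      case (KF i j)
      then show ?thesis
        using that(1) Q unfolding in_upto_3 by (cases i; cases j; elim disjE; simp add: s)
    next
      case (EF i j)
      define c where "c = 1 / (?Q - inverse ?Q)"
      have c: "c * ?Q = 1 + c * inverse ?Q"
        using QQ by (simp add: c_def divide_simps)
      have cz: "c * (?Q * z) = z + c * (inverse ?Q * z)" "c * (z / ?Q) = c * (inverse ?Q * z)" for z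
        using arg_cong[OF c, of "\<lambda>t. t * z"] by (simp_all add: algebra_simps divide_inverse)
      show ?thesis
        using that(1) Q(1) unfolding EF c_def[symmetric] in_upto_3
        by (cases i; cases j; elim disjE; simp add: s cz right_diff_distrib)
    next
      case (SE i j)
      then show ?thesis
        using that(1) Q unfolding in_upto_3 by (cases i; cases j; elim disjE; simp add: s)
    next
      case (SF i j)
      then show ?thesis
        using that(1) Q unfolding in_upto_3 by (cases i; cases j; elim disjE; simp add: s)
    qed
  qed
  show ?thesis
    unfolding uq_dual_iff
  proof (intro conjI ballI allI lin_su)
    fix r x y assume "r \<in> uq_relations q"
    then have "su q j a (r * y) = 0" if "a \<in> {1..3}" for a
      using that by (rule_tac r)
    then show "su q j k (x * r * y) = 0"
      unfolding mult.assoc by (subst su_mult[OF j], intro sum.neutral) auto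
  qed
qed

text \<open>On generators the square of the antipode is conjugation by \<open>K_i\<close>, with
  factor \<open>q^2\<close> on \<open>E_i\<close> and \<open>q^-2\<close> on \<open>F_i\<close>. As
  \<open>E_i\<close> lowers and \<open>F_i\<close> raises the index by one from row to column, the
  factor is \<open>q^(2(j-k))\<close> on generators; along a word the exponents telescope over the
  intermediate indices.\<close>

lemma antipode_su:
  assumes q: "q \<noteq> 0" and j: "j \<in> {1..3}" and k: "k \<in> {1..3}"
  shows "antipode (su q j k) = (\<lambda>x. complex_of_real q powi (2 * (int j - int k)) * uu q j k x)"
proof
  let ?Q = "complex_of_real q"
  have Q: "?Q \<noteq> 0" using q by simp
  have g: "uu q j k (uq_antipode (gen_antipode g))
      = ?Q powi (2 * (int j - int k)) * gen_pairing q g j k"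
    if "j \<in> {1..3}" "k \<in> {1..3}" for g j k
  proof (cases g)
    case (GE i)
    then show ?thesis
      using that(1) uu_gn[OF that(2), of q] that(2) Q unfolding in_upto_3
      by (cases i; elim disjE; simp add: uq_antipode_uminus uq_antipode_mult uq_antipode_gn
          lin_uminus[OF lin_uu] mult.assoc uu_lmult sum_upto_3 power_int_minus power2_eq_square)
  next
    case (GF i)
    then show ?thesis
      using that(1) uu_gn[OF that(2), of q] that(2) Q unfolding in_upto_3
      by (cases i; elim disjE; simp add: uq_antipode_uminus uq_antipode_mult uq_antipode_gn
          lin_uminus[OF lin_uu] mult.assoc uu_lmult sum_upto_3 power_int_minus power2_eq_square
          inverse_eq_divide)
  qed (use uu_gn[OF that(2), of q] in \<open>simp_all add: uq_antipode_gn\<close>)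
  fix x
  have "uu q j k (uq_antipode (uq_antipode x)) = ?Q powi (2 * (int j - int k)) * uu q j k x"
  proof (rule lin_word_eqI[OF lin_antipode[OF lin_antipode[OF lin_uu]] lin_times_left[OF lin_uu]])
    show "uu q j k (uq_antipode (uq_antipode (Poly_Mapping.single (Word gs) 1)))
        = ?Q powi (2 * (int j - int k)) * uu q j k (Poly_Mapping.single (Word gs) 1)" for gs
      using j
    proof (induction gs arbitrary: j)
      case (Cons h gs)
      have "uu q j k (uq_antipode (uq_antipode (Poly_Mapping.single (Word (h # gs)) 1)))
        = (\<Sum>a\<in>{1..3}. ?Q powi (2 * (int j - int a)) * gen_pairing q h j a
            * (?Q powi (2 * (int a - int k)) * uu q a k (Poly_Mapping.single (Word gs) 1)))"
        unfolding single_word_Cons uq_antipode_mult uu_mult[OF Cons.prems]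
        by (rule sum.cong) (simp_all only: uq_antipode_gn g[OF Cons.prems] Cons.IH)
      also have "\<dots> = (\<Sum>a\<in>{1..3}. ?Q powi (2 * (int j - int k)) *
            (gen_pairing q h j a * uu q a k (Poly_Mapping.single (Word gs) 1)))"
      proof (rule sum.cong, rule refl)
        fix a
        have "?Q powi (2 * (int j - int a)) * ?Q powi (2 * (int a - int k))
            = ?Q powi (2 * (int j - int k))"
          using Q by (simp flip: power_int_add)
        then show "?Q powi (2 * (int j - int a)) * gen_pairing q h j a
            * (?Q powi (2 * (int a - int k)) * uu q a k (Poly_Mapping.single (Word gs) 1))
          = ?Q powi (2 * (int j - int k)) *
            (gen_pairing q h j a * uu q a k (Poly_Mapping.single (Word gs) 1))"
          by (simp flip: mult.assoc)
      qed
      finally show ?case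
        by (simp add: single_word_Cons uu_lmult sum_distrib_left)
    qed (simp add: single_word_Nil uq_antipode_1 uu_1)
  qed
  then show "antipode (su q j k) x = ?Q powi (2 * (int j - int k)) * uu q j k x"
    by (simp add: antipode_def)
qed

section \<open>Tensors of functions\<close>

lemma sum_list_fun_apply: "(sum_list fs :: 'x \<Rightarrow> complex) x = (\<Sum>f\<leftarrow>fs. f x)"
  by (induction fs) auto

lemma tens_apply [simp]: "tens v w (x, y) = v x * w y"
  by (simp add: tens_def)

lemma tens_in_tens_space: "v \<in> V \<Longrightarrow> w \<in> W \<Longrightarrow> tens v w \<in> tens_space V W"
  unfolding tens_space_def by (rule fs.span_base) auto

lemma tens_space_subspace: "fs.subspace (tens_space V W)"
  by (simp add: tens_space_def)

lemma tens_space_mono: "V \<subseteq> V' \<Longrightarrow> W \<subseteq> W' \<Longrightarrow> tens_space V W \<subseteq> tens_space V' W'"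
  unfolding tens_space_def by (rule fs.span_mono) auto

lemma fs_subspace_sum_list:
  "fs.subspace V \<Longrightarrow> (\<And>f. f \<in> set fs \<Longrightarrow> f \<in> V) \<Longrightarrow> sum_list fs \<in> V"
  by (induction fs) (auto simp: fs.subspace_0 fs.subspace_add)

lemma tens_space_obtain:
  assumes "t \<in> tens_space V W" "fs.subspace V"
  obtains ps where "set ps \<subseteq> V \<times> W" "t = (\<Sum>(v, w)\<leftarrow>ps. tens v w)"
proof -
  have "\<exists>ps. set ps \<subseteq> V \<times> W \<and> t = (\<Sum>(v, w)\<leftarrow>ps. tens v w)"
    using assms(1) unfolding tens_space_def
  proof (induction rule: fs.span_induct_alt)
    case base
    then show ?case by (intro exI[of _ "[]"]) simp
  next
    case (step c x y)
    then obtain v w ps where *: "v \<in> V" "w \<in> W" "x = tens v w"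
      "set ps \<subseteq> V \<times> W" "y = (\<Sum>(v, w)\<leftarrow>ps. tens v w)"
      by auto
    have "fscale c x = tens (fscale c v) w"
      by (auto simp: *(3) fscale_def tens_def)
    then show ?case
      using * assms(2) by (intro exI[of _ "(fscale c v, w) # ps"]) (auto simp: fs.subspace_scale)
  qed
  then show thesis using that by blast
qed

lemma comult_apply: "comult a = (\<Sum>(v, w)\<leftarrow>ps. tens v w) \<longleftrightarrow>
    (\<forall>x y. a (x * y) = (\<Sum>(v, w)\<leftarrow>ps. v x * w y))"
  unfolding case_prod_beta by (auto simp: fun_eq_iff comult_def sum_list_fun_apply comp_def)

text \<open>The spaces of left and right factors are kept separate so that the same lemma serves for
  closure of \<open>A\<close> under the coproduct and, later, for right factors of a fixed
  weight.\<close>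

lemma comult_conv_in_tens_space:
  assumes "comult a \<in> tens_space Va Vb" "comult b \<in> tens_space Wa Wb"
    and "fs.subspace Va" "fs.subspace Wa"
    and 1: "\<And>v w. v \<in> Va \<Longrightarrow> w \<in> Wa \<Longrightarrow> conv v w \<in> Za"
    and 2: "\<And>v w. v \<in> Vb \<Longrightarrow> w \<in> Wb \<Longrightarrow> conv v w \<in> Zb"
  shows "comult (conv a b) \<in> tens_space Za Zb"
proof -
  obtain ps where ps: "set ps \<subseteq> Va \<times> Vb" "comult a = (\<Sum>(v, w)\<leftarrow>ps. tens v w)"
    using tens_space_obtain[OF assms(1,3)] .
  obtain qs where qs: "set qs \<subseteq> Wa \<times> Wb" "comult b = (\<Sum>(v, w)\<leftarrow>qs. tens v w)"
    using tens_space_obtain[OF assms(2,4)] .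
  have "conv a b (x * y) = (\<Sum>i\<leftarrow>ps. \<Sum>j\<leftarrow>qs.
      conv (fst i) (fst j) x * conv (snd i) (snd j) y)" for x y
    using ps(2) qs(2) unfolding comult_apply case_prod_beta by (intro conv_comult) blast+
  then have "comult (conv a b) = (\<Sum>i\<leftarrow>ps. \<Sum>j\<leftarrow>qs.
      tens (conv (fst i) (fst j)) (conv (snd i) (snd j)))"
    by (auto simp: fun_eq_iff comult_def sum_list_fun_apply comp_def)
  also have "\<dots> \<in> tens_space Za Zb"
  proof -
    have "fst i \<in> Va" "snd i \<in> Vb" if "i \<in> set ps" for i
      using ps(1) that by auto
    moreover have "fst j \<in> Wa" "snd j \<in> Wb" if "j \<in> set qs" for j
      using qs(1) that by auto
    ultimately show ?thesis
      by (auto intro!: fs_subspace_sum_list tens_space_subspace tens_in_tens_space 1 2)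
  qed
  finally show ?thesis .
qed

section \<open>The coordinate algebra as a span of monomials\<close>

text \<open>Since \<open>S\<^sup>2(u\<^sub>j\<^sub>k)\<close> is a multiple of \<open>u\<^sub>j\<^sub>k\<close>, the span of these monomials is closed under the antipode;
  no cofactor formula for \<open>S(u\<^sub>j\<^sub>k)\<close> is needed.\<close>

inductive_set mon :: "real \<Rightarrow> func set" for q where
  one: "uq_counit \<in> mon q"
| uu: "m \<in> mon q \<Longrightarrow> j \<in> {1..3} \<Longrightarrow> k \<in> {1..3} \<Longrightarrow> conv (uu q j k) m \<in> mon q"
| su: "m \<in> mon q \<Longrightarrow> j \<in> {1..3} \<Longrightarrow> k \<in> {1..3} \<Longrightarrow> conv (su q j k) m \<in> mon q"

lemma conv_add: "conv (a + a') b = conv a b + conv a' b" "conv a (b + b') = conv a b + conv a b'"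
  by (auto simp: fun_eq_iff conv_add_left[where a = a and a' = a'] plus_fun_def conv_add_right)

lemma conv_fscale: "conv (fscale c a) b = fscale c (conv a b)" "conv a (fscale c b) = fscale c (conv a b)"
  by (auto simp: fun_eq_iff fscale_def conv_linear)

lemma conv_zero: "conv 0 b = 0" "conv a 0 = 0"
  by (auto simp: fun_eq_iff zero_fun_def conv_linear)

lemma conv_in_span:
  assumes "a \<in> fs.span M" "b \<in> fs.span M'"
    and "\<And>a b. a \<in> M \<Longrightarrow> b \<in> M' \<Longrightarrow> conv a b \<in> fs.span N"
  shows "conv a b \<in> fs.span N"
  using assms(1)
proof (induction rule: fs.span_induct_alt)
  case (step c x y)
  have "conv x b \<in> fs.span N"
    using assms(2)
  proof (induction rule: fs.span_induct_alt)
    case (step c' x' y')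
    then show ?case
      using assms(3)[OF \<open>x \<in> M\<close>]
      by (simp only: conv_add conv_fscale) (intro fs.span_add fs.span_scale)
  qed (simp only: conv_zero fs.span_zero)
  with step show ?case
    by (simp only: conv_add conv_fscale) (intro fs.span_add fs.span_scale)
qed (simp only: conv_zero fs.span_zero)

lemma comult_add: "comult (a + b) = comult a + comult b"
  and comult_fscale: "comult (fscale c a) = fscale c (comult a)"
  and comult_zero: "comult 0 = 0"
  by (auto simp: fun_eq_iff comult_def fscale_def)

lemma antipode_add: "antipode (a + b) = antipode a + antipode b"
  and antipode_fscale: "antipode (fscale c a) = fscale c (antipode a)"
  and antipode_zero: "antipode 0 = 0"
  by (auto simp: fun_eq_iff antipode_def fscale_def)

lemma antipode_counit: "antipode uq_counit = uq_counit"
proof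
  fix x
  have "uq_counit (uq_antipode x) = uq_counit x"
  proof (rule lin_word_eqI[OF lin_antipode[OF lin_counit] lin_counit])
    show "uq_counit (uq_antipode (Poly_Mapping.single (Word gs) 1))
        = uq_counit (Poly_Mapping.single (Word gs) 1)" for gs
    proof (induction gs)
      case (Cons g gs)
      then show ?case
        by (cases g) (simp_all add: single_word_Cons uq_antipode_mult uq_antipode_gn counit_mult
            counit_gn lin_uminus[OF lin_counit])
    qed (simp add: single_word_Nil uq_antipode_1)
  qed
  then show "antipode uq_counit x = uq_counit x"
    by (simp add: antipode_def)
qed

section \<open>The span of the monomials is the coordinate algebra\<close>

locale su3 =
  fixes q :: real
  assumes q: "q \<notin> {-1, 0, 1}"
begin

abbreviation Q :: complex where "Q \<equiv> complex_of_real q"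

lemma q_nz: "q \<noteq> 0" "q\<^sup>2 \<noteq> 1" "Q \<noteq> 0"
  using q by (auto simp: power2_eq_1_iff)

lemma mon_subset_uq_dual: "mon q \<subseteq> uq_dual q"
proof
  fix m assume "m \<in> mon q"
  then show "m \<in> uq_dual q"
  proof induction
    case one
    show ?case by (rule counit_in_uq_dual)
  next
    case (uu m j k)
    then show ?case by (intro conv_in_uq_dual uu_in_uq_dual q_nz)
  next
    case (su m j k)
    then show ?case by (intro conv_in_uq_dual su_in_uq_dual q_nz)
  qed
qed

lemma span_mon_subset_uq_dual: "fs.span (mon q) \<subseteq> uq_dual q"
  by (intro fs.span_minimal mon_subset_uq_dual uq_dual_subspace)

lemma conv_in_mon: "m \<in> mon q \<Longrightarrow> n \<in> mon q \<Longrightarrow> conv m n \<in> mon q"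
  by (induction rule: mon.induct)
    (use mon_subset_uq_dual uq_dual_lin in
      \<open>auto simp: conv_counit_left conv_assoc intro: mon.intros\<close>)

lemma uu_in_mon: "j \<in> {1..3} \<Longrightarrow> k \<in> {1..3} \<Longrightarrow> uu q j k \<in> mon q"
  and su_in_mon: "j \<in> {1..3} \<Longrightarrow> k \<in> {1..3} \<Longrightarrow> su q j k \<in> mon q"
  using mon.uu[OF mon.one] mon.su[OF mon.one] by (simp_all add: conv_counit_right lin_uu lin_su)

lemma conv_in_span_mon:
  "a \<in> fs.span (mon q) \<Longrightarrow> b \<in> fs.span (mon q) \<Longrightarrow> conv a b \<in> fs.span (mon q)"
  by (erule (1) conv_in_span) (simp add: conv_in_mon fs.span_base)

lemma comult_counit_in: "uq_counit \<in> V \<Longrightarrow> uq_counit \<in> W \<Longrightarrow> comult uq_counit \<in> tens_space V W"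
proof -
  have "comult uq_counit = tens uq_counit uq_counit"
    by (auto simp: fun_eq_iff comult_def counit_mult)
  then show "uq_counit \<in> V \<Longrightarrow> uq_counit \<in> W \<Longrightarrow> comult uq_counit \<in> tens_space V W"
    by (simp add: tens_in_tens_space)
qed

lemma comult_uu_in:
  assumes "j \<in> {1..3}" "\<And>a. a \<in> {1..3} \<Longrightarrow> uu q j a \<in> V \<and> uu q a k \<in> W"
  shows "comult (uu q j k) \<in> tens_space V W"
proof -
  have "comult (uu q j k) = (\<Sum>a\<in>{1..3}. tens (uu q j a) (uu q a k))"
    by (auto simp: fun_eq_iff comult_def uu_mult[OF assms(1)] sum_upto_3)
  then show ?thesis
    using assms(2) by (auto intro!: fs.subspace_sum tens_space_subspace tens_in_tens_space)
qed

lemma comult_su_in: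
  assumes "j \<in> {1..3}" "\<And>a. a \<in> {1..3} \<Longrightarrow> su q a k \<in> V \<and> su q j a \<in> W"
  shows "comult (su q j k) \<in> tens_space V W"
proof -
  have "comult (su q j k) = (\<Sum>a\<in>{1..3}. tens (su q a k) (su q j a))"
    by (auto simp: fun_eq_iff comult_def su_mult[OF assms(1)] sum_upto_3)
  then show ?thesis
    using assms(2) by (auto intro!: fs.subspace_sum tens_space_subspace tens_in_tens_space)
qed

lemma comult_in_span_mon:
  assumes "a \<in> fs.span (mon q)"
  shows "comult a \<in> tens_space (fs.span (mon q)) (fs.span (mon q))"
proof -
  let ?A = "fs.span (mon q)"
  have m: "comult m \<in> tens_space ?A ?A" if "m \<in> mon q" for m
    using that
  proof induction
    case one
    then show ?case by (simp add: comult_counit_in fs.span_base mon.one)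
  next
    case (uu m j k)
    then have "comult (uu q j k) \<in> tens_space ?A ?A"
      by (intro comult_uu_in conjI fs.span_base uu_in_mon)
    with uu.IH show ?case
      by (rule_tac comult_conv_in_tens_space) (auto intro: conv_in_span_mon)
  next
    case (su m j k)
    then have "comult (su q j k) \<in> tens_space ?A ?A"
      by (intro comult_su_in conjI fs.span_base su_in_mon)
    with su.IH show ?case
      by (rule_tac comult_conv_in_tens_space) (auto intro: conv_in_span_mon)
  qed
  show ?thesis
    using assms
    by (induction rule: fs.span_induct_alt)
      (simp_all only: comult_add comult_fscale comult_zero m fs.subspace_0[OF tens_space_subspace]
        fs.subspace_add[OF tens_space_subspace] fs.subspace_scale[OF tens_space_subspace])
qed

lemma antipode_in_span_mon:
  assumes "a \<in> fs.span (mon q)"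
  shows "antipode a \<in> fs.span (mon q)"
proof -
  have m: "antipode m \<in> fs.span (mon q)" if "m \<in> mon q" for m
    using that
  proof induction
    case one
    then show ?case by (simp add: antipode_counit fs.span_base mon.one)
  next
    case (uu m j k)
    have "antipode (conv (uu q j k) m) = conv (antipode m) (su q j k)"
      using uu mon_subset_uq_dual q_nz by (intro antipode_conv) (auto intro: uu_in_uq_dual)
    with uu show ?case by (auto intro!: conv_in_span_mon fs.span_base[OF su_in_mon])
  next
    case (su m j k)
    have "antipode (conv (su q j k) m) = conv (antipode m) (antipode (su q j k))"
      using su mon_subset_uq_dual q_nz by (intro antipode_conv) (auto intro: su_in_uq_dual)
    moreover have "antipode (su q j k) = fscale (Q powi (2 * (int j - int k))) (uu q j k)"
      using su q_nz by (simp add: antipode_su fscale_def)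
    ultimately show ?case
      using su by (auto intro!: conv_in_span_mon fs.span_scale fs.span_base[OF uu_in_mon])
  qed
  show ?thesis
    using assms
    by (induction rule: fs.span_induct_alt)
      (simp_all only: antipode_add antipode_fscale antipode_zero m fs.span_zero
        fs.span_add fs.span_scale)
qed

text \<open>The span is itself a Hopf subalgebra containing the generators, and any such subalgebra
  contains their antipodes and hence all monomials. From here on statements linear in an element of
  \<open>A\<close> can be checked on \<open>mon q\<close>.\<close>

lemma OSU3_eq: "OSU3 q = fs.span (mon q)"
proof
  have "hopf_subalgebra q (fs.span (mon q))"
    unfolding hopf_subalgebra_def hopf_dual_def
    using span_mon_subset_uq_dual comult_in_span_mon antipode_in_span_mon conv_in_span_mon
      tens_space_mono[OF span_mon_subset_uq_dual span_mon_subset_uq_dual]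
    by (auto intro: fs.span_base mon.one)
  moreover have "\<forall>j\<in>{1..3}. \<forall>k\<in>{1..3}. uu q j k \<in> fs.span (mon q)"
    by (intro ballI fs.span_base uu_in_mon)
  ultimately show "OSU3 q \<subseteq> fs.span (mon q)"
    unfolding OSU3_def by blast
  show "fs.span (mon q) \<subseteq> OSU3 q"
    unfolding OSU3_def
  proof (intro Inter_greatest)
    fix C assume C: "C \<in> {C. hopf_subalgebra q C \<and> (\<forall>j\<in>{1..3}. \<forall>k\<in>{1..3}. uu q j k \<in> C)}"
    have "m \<in> C" if "m \<in> mon q" for m
      using that by induction (use C in \<open>auto simp: hopf_subalgebra_def\<close>)
    then show "fs.span (mon q) \<subseteq> C"
      using C by (intro fs.span_minimal) (auto simp: hopf_subalgebra_def)
  qed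
qed

section \<open>Closure properties of the coordinate algebra\<close>

abbreviation A :: "func set" where "A \<equiv> OSU3 q"

lemma A_subspace: "fs.subspace A"
  by (simp add: OSU3_eq)

lemma A_dual: "a \<in> A \<Longrightarrow> a \<in> uq_dual q"
  using span_mon_subset_uq_dual by (auto simp: OSU3_eq)

lemma A_lin: "a \<in> A \<Longrightarrow> lin a"
  by (rule uq_dual_lin[OF A_dual])

lemma A_counit: "uq_counit \<in> A"
  by (simp add: OSU3_eq fs.span_base mon.one)

lemma A_conv: "a \<in> A \<Longrightarrow> b \<in> A \<Longrightarrow> conv a b \<in> A"
  by (simp add: OSU3_eq conv_in_span_mon)

lemma A_antipode: "a \<in> A \<Longrightarrow> antipode a \<in> A"
  by (simp add: OSU3_eq antipode_in_span_mon)

lemma A_uu: "j \<in> {1..3} \<Longrightarrow> k \<in> {1..3} \<Longrightarrow> uu q j k \<in> A"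
  unfolding OSU3_eq by (intro fs.span_base uu_in_mon)

lemma A_su: "j \<in> {1..3} \<Longrightarrow> k \<in> {1..3} \<Longrightarrow> su q j k \<in> A"
  unfolding OSU3_eq by (intro fs.span_base su_in_mon)

lemma A_comult: "a \<in> A \<Longrightarrow> comult a \<in> tens_space A A"
  by (simp add: OSU3_eq comult_in_span_mon)

lemma sweedler2_obtain:
  assumes "a \<in> A"
  obtains ps where "sweedler2 q a ps"
  using tens_space_obtain[OF A_comult[OF assms] A_subspace] unfolding sweedler2_def by metis

lemma sweedler2_apply: "sweedler2 q a ps \<Longrightarrow> a (x * y) = (\<Sum>(b, c)\<leftarrow>ps. b x * c y)"
  by (simp add: sweedler2_def comult_apply)

lemma A_sum_list: "(\<And>f. f \<in> set fs \<Longrightarrow> f \<in> A) \<Longrightarrow> sum_list fs \<in> A"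
  by (rule fs_subspace_sum_list[OF A_subspace])

lemma A_act: assumes "a \<in> A" shows "act X a \<in> A"
proof -
  obtain ps where ps: "sweedler2 q a ps"
    using sweedler2_obtain[OF assms] .
  have "act X a = (\<Sum>(b, c)\<leftarrow>ps. fscale (c X) b)"
    unfolding case_prod_unfold
    by (auto simp: fun_eq_iff act_def comult_def sweedler2_apply[OF ps] sum_list_fun_apply comp_def
        fscale_def mult.commute case_prod_unfold)
  also have "\<dots> \<in> A"
    using ps by (intro A_sum_list) (auto simp: sweedler2_def intro!: fs.subspace_scale A_subspace)
  finally show ?thesis .
qed

section \<open>Weights\<close>

definition wt :: "(node \<Rightarrow> complex) \<Rightarrow> func set" where
  "wt c = {a \<in> A. \<forall>i x. a (x * KK i) = c i * a x}"

lemma wt_A: "a \<in> wt c \<Longrightarrow> a \<in> A"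
  by (simp add: wt_def)

lemma wt_KK: "a \<in> wt c \<Longrightarrow> a (x * KK i) = c i * a x"
  by (simp add: wt_def)

lemma wt_conv:
  assumes "a \<in> wt c" "b \<in> wt d"
  shows "conv a b \<in> wt (\<lambda>i. c i * d i)"
  using assms by (auto simp: wt_def A_conv conv_rmult conv_linear)

lemma wt_subspace: "fs.subspace (wt c)"
  unfolding wt_def
  using A_subspace by (intro fs.subspaceI)
    (auto simp: fs.subspace_0 fs.subspace_add fs.subspace_scale, auto simp: fscale_def algebra_simps)

text \<open>The diagonal entry of \<open>K_i\<close> at \<open>k\<close>: the common weight of the
  column \<open>u_1k, u_2k, u_3k\<close>.\<close>

definition fund_wt :: "nat \<Rightarrow> node \<Rightarrow> complex" where
  "fund_wt k i = Q powi (of_bool (k = nd i + 1) - of_bool (k = nd i))"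

lemma fund_wt_nz: "fund_wt k i \<noteq> 0"
  using q_nz by (simp add: fund_wt_def)

lemma counit_wt: "uq_counit \<in> wt (\<lambda>i. 1)"
  by (simp add: wt_def A_counit counit_mult counit_gn)

lemma uu_wt:
  assumes "j \<in> {1..3}" "k \<in> {1..3}"
  shows "uu q j k \<in> wt (fund_wt k)"
proof -
  have "uu q j k (x * KK i) = fund_wt k i * uu q j k x" for x i
  proof -
    have "uu q j k (x * KK i) = (\<Sum>a\<in>{1..3}. uu q j a x * gen_pairing q (GK i) a k)"
      by (simp add: uu_mult[OF assms(1)] uu_gn[OF assms(2)])
    then show ?thesis
      using assms(2) unfolding in_upto_3 fund_wt_def by (auto simp: sum_upto_3)
  qed
  then show ?thesis
    by (simp add: wt_def A_uu[OF assms])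
qed

text \<open>Since \<open>S(x K_i) = K_i^-1 S(x)\<close>, the \<open>K_i\<close> acts at the row
  index of \<open>u_jk\<close>, and inversely; so the weight depends on \<open>j\<close> and not on
  \<open>k\<close>.\<close>

lemma su_wt:
  assumes "j \<in> {1..3}" "k \<in> {1..3}"
  shows "su q j k \<in> wt (\<lambda>i. inverse (fund_wt j i))"
proof -
  have "su q j k (x * KK i) = inverse (fund_wt j i) * su q j k x" for x i
  proof -
    have "su q j k (x * KK i) = (\<Sum>a\<in>{1..3}. gen_pairing q (GKi i) j a * su q a k x)"
      unfolding su_mult[OF assms(1)]
      by (rule sum.cong) (simp_all add: antipode_def uq_antipode_gn uu_gn)
    then show ?thesis
      using assms(1) unfolding in_upto_3 fund_wt_def
      by (auto simp: sum_upto_3 power_int_minus[symmetric])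
  qed
  then show ?thesis
    by (simp add: wt_def A_su[OF assms])
qed

text \<open>The two properties of a weight needed to compute modulo \<open>B^+A\<close>: a
  normalised element of that weight, to which others are compared, and a decomposition of the unit
  whose left factors have the opposite weight.\<close>

definition inv_weight :: "(node \<Rightarrow> complex) \<Rightarrow> bool" where
  "inv_weight c \<longleftrightarrow> (\<exists>e\<in>wt c. e 1 = 1) \<and>
     (\<exists>ps. set ps \<subseteq> wt (\<lambda>i. inverse (c i)) \<times> A \<and> (\<forall>x. (\<Sum>(s, t)\<leftarrow>ps. conv s t x) = uq_counit x))"

lemma inv_weight_one: "inv_weight (\<lambda>i. 1)"
  unfolding inv_weight_def
proof (intro conjI bexI[of _ uq_counit] exI[of _ "[(uq_counit, uq_counit)]"])
qed (auto simp: counit_1 counit_wt A_counit conv_counit_left lin_counit)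

lemma inv_weight_mult:
  assumes "inv_weight c" "inv_weight d"
  shows "inv_weight (\<lambda>i. c i * d i)"
proof -
  obtain e ps where c: "e \<in> wt c" "e 1 = 1" "set ps \<subseteq> wt (\<lambda>i. inverse (c i)) \<times> A"
    "\<And>x. (\<Sum>(s, t)\<leftarrow>ps. conv s t x) = uq_counit x"
    using assms(1) unfolding inv_weight_def by blast
  obtain f qs where d: "f \<in> wt d" "f 1 = 1" "set qs \<subseteq> wt (\<lambda>i. inverse (d i)) \<times> A"
    "\<And>x. (\<Sum>(s, t)\<leftarrow>qs. conv s t x) = uq_counit x"
    using assms(2) unfolding inv_weight_def by blast
  \<comment> \<open>Inserting the second decomposition of the unit into the first:
    \<open>1 = \<Sum> s t = \<Sum> s (s' t') t = \<Sum> (s s') (t' t)\<close>.\<close>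
  let ?rs = "concat (map (\<lambda>(s, t). map (\<lambda>(s', t'). (conv s s', conv t' t)) qs) ps)"
  have "set ?rs \<subseteq> wt (\<lambda>i. inverse (c i * d i)) \<times> A"
  proof
    fix z assume "z \<in> set ?rs"
    then obtain s t s' t' where z: "(s, t) \<in> set ps" "(s', t') \<in> set qs" "z = (conv s s', conv t' t)"
      by auto
    then have "s \<in> wt (\<lambda>i. inverse (c i))" "s' \<in> wt (\<lambda>i. inverse (d i))" "t \<in> A" "t' \<in> A"
      using c(3) d(3) by auto
    then show "z \<in> wt (\<lambda>i. inverse (c i * d i)) \<times> A"
      using wt_conv[of s _ s'] by (simp add: z A_conv)
  qed
  moreover have "(\<Sum>(s, t)\<leftarrow>?rs. conv s t x) = uq_counit x" for x
  proof -
    have "(\<Sum>(s, t)\<leftarrow>?rs. conv s t x) = (\<Sum>(s, t)\<leftarrow>ps. \<Sum>(s', t')\<leftarrow>qs. conv (conv s s') (conv t' t) x)"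
      by (induction ps) (auto simp: comp_def case_prod_unfold)
    also have "\<dots> = (\<Sum>(s, t)\<leftarrow>ps. conv s t x)"
    proof (intro arg_cong[of _ _ sum_list] map_cong refl, clarify)
      fix s t assume "(s, t) \<in> set ps"
      then have t: "lin t" using c(3) A_lin by auto
      have "(\<Sum>(s', t')\<leftarrow>qs. conv (conv s s') (conv t' t) x)
          = conv s (conv (\<lambda>y. \<Sum>(s', t')\<leftarrow>qs. conv s' t' y) t) x"
        by (simp add: conv_assoc case_prod_unfold conv_sum_list_left[abs_def] conv_sum_list_right)
      then show "(\<Sum>(s', t')\<leftarrow>qs. conv (conv s s') (conv t' t) x) = conv s t x"
        by (simp add: d(4) conv_counit_left[OF t])
    qed
    finally show ?thesis by (simp add: c(4))
  qed
  moreover have "conv e f \<in> wt (\<lambda>i. c i * d i)" "conv e f 1 = 1"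
    using wt_conv c d by (auto simp: conv_1)
  ultimately show ?thesis
    unfolding inv_weight_def by blast
qed

lemma inv_weight_fund_wt:
  assumes "k \<in> {1..3}"
  shows "inv_weight (fund_wt k)"
proof -
  let ?ps = "map (\<lambda>j. (su q k j, uu q j k)) [1, 2, 3]"
  have "(\<Sum>(s, t)\<leftarrow>?ps. conv s t x) = uq_counit x" for x
  proof -
    have "(\<Sum>(s, t)\<leftarrow>?ps. conv s t x) = cop (\<lambda>v w. uu q k k (uq_antipode v * w)) x"
      by (simp add: conv_eq_cop uu_mult[OF assms] sum_upto_3 cop_fun_add antipode_def)
    also have "\<dots> = uq_counit x"
      using cop_antipode_left[OF uu_in_uq_dual[OF q_nz(1,2) assms assms]] by (simp add: uu_1)
    finally show ?thesis .
  qed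
  moreover have "set ?ps \<subseteq> wt (\<lambda>i. inverse (fund_wt k i)) \<times> A"
    using su_wt[OF assms] A_uu[OF _ assms] by auto
  ultimately show ?thesis
    unfolding inv_weight_def using uu_wt[OF assms assms] uu_1[of q k k]
    by (intro conjI bexI[of _ "uu q k k"] exI[of _ ?ps]) auto
qed

text \<open>The product of the three fundamental weights is trivial, because each \<open>K_i\<close>
  has determinant 1 in the vector representation; so the inverse of one is the product of the other
  two.\<close>

lemma inv_weight_inverse_fund_wt:
  assumes "k \<in> {1..3}"
  shows "inv_weight (\<lambda>i. inverse (fund_wt k i))"
proof -
  have "(\<lambda>i. inverse (fund_wt 1 i)) = (\<lambda>i. fund_wt 2 i * fund_wt 3 i)"
    "(\<lambda>i. inverse (fund_wt 2 i)) = (\<lambda>i. fund_wt 1 i * fund_wt 3 i)"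
    "(\<lambda>i. inverse (fund_wt 3 i)) = (\<lambda>i. fund_wt 1 i * fund_wt 2 i)"
    by (rule ext, rename_tac i, case_tac i; use q_nz in \<open>simp add: fund_wt_def power_int_minus\<close>)+
  moreover have "inv_weight (\<lambda>i. fund_wt a i * fund_wt b i)" if "a \<in> {1..3}" "b \<in> {1..3}" for a b
    using that by (intro inv_weight_mult inv_weight_fund_wt)
  ultimately show ?thesis
    using assms unfolding in_upto_3 by (elim disjE) (auto simp del: One_nat_def)
qed

text \<open>A normalised \<open>e\<close> of weight \<open>c\<close> satisfies
  \<open>1 = e(K_i^-1 K_i) = c_i e(K_i^-1)\<close>.\<close>

lemma inv_weight_nz:
  assumes "inv_weight c"
  shows "c i \<noteq> 0"
proof
  assume "c i = 0"
  obtain e where e: "e \<in> wt c" "e 1 = 1"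
    using assms unfolding inv_weight_def by blast
  have "e (KI i * KK i) = 1"
    using dual_K_KI(2)[OF A_dual[OF wt_A[OF e(1)]], of 1 i 1] e(2) by simp
  then show False
    using wt_KK[OF e(1)] \<open>c i = 0\<close> by simp
qed

section \<open>Membership in \<open>B^+A\<close> by weight and counit\<close>

abbreviation BA :: "func set" where "BA \<equiv> snd (piB q)"

lemma BA_subspace: "fs.subspace BA"
  by (simp add: piB_def)

lemma OF3_subset: "OF3 q \<subseteq> A"
  by (auto simp: OF3_def)

lemma wt_one_subset_OF3: "wt (\<lambda>i. 1) \<subseteq> OF3 q"
proof
  fix b assume b: "b \<in> wt (\<lambda>i. 1)"
  have "b (y * KI i) = b y" for y i
    using wt_KK[OF b, of "y * KI i" i] dual_K_KI(2)[OF A_dual[OF wt_A[OF b]], of y i 1]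
    by (simp add: mult.assoc)
  then show "b \<in> OF3 q"
    using b by (auto simp: OF3_def act_def comult_def fun_eq_iff wt_def)
qed

lemma BA_subset_A: "BA \<subseteq> A"
  unfolding piB_def snd_conv
  using OF3_subset by (intro fs.span_minimal A_subspace) (auto simp: aug_def intro!: A_conv)

text \<open>If \<open>1 = \<Sum> s t\<close> with \<open>s\<close> of weight \<open>1/c\<close>, then \<open>a = \<Sum> (a s) t\<close> with \<open>a s \<in> B\<^sup>+\<close>.\<close>

lemma wt_in_BA:
  assumes "inv_weight c" "a \<in> wt c" "a 1 = 0"
  shows "a \<in> BA"
proof -
  obtain ps where ps: "set ps \<subseteq> wt (\<lambda>i. inverse (c i)) \<times> A"
    "\<And>x. (\<Sum>(s, t)\<leftarrow>ps. conv s t x) = uq_counit x"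
    using assms(1) unfolding inv_weight_def by blast
  have "a x = (\<Sum>(s, t)\<leftarrow>ps. conv (conv a s) t x)" for x
  proof -
    have "a x = conv a (\<lambda>y. \<Sum>(s, t)\<leftarrow>ps. conv s t y) x"
      using A_lin[OF wt_A[OF assms(2)]] by (simp add: ps(2) conv_counit_right)
    then show ?thesis
      by (simp add: case_prod_unfold conv_sum_list_right conv_assoc)
  qed
  then have "a = (\<Sum>(s, t)\<leftarrow>ps. conv (conv a s) t)"
    unfolding case_prod_unfold by (auto simp: fun_eq_iff sum_list_fun_apply comp_def)
  also have "\<dots> \<in> BA"
  proof (intro fs_subspace_sum_list[OF BA_subspace], clarsimp)
    fix s t assume st: "(s, t) \<in> set ps"
    then have "s \<in> wt (\<lambda>i. inverse (c i))" "t \<in> A"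
      using ps(1) by auto
    moreover from this have "conv a s \<in> wt (\<lambda>i. 1)"
      using wt_conv[OF assms(2), of s "\<lambda>i. inverse (c i)"] inv_weight_nz[OF assms(1)] by simp
    ultimately show "conv (conv a s) t \<in> BA"
      using wt_one_subset_OF3 assms(3)
      unfolding piB_def snd_conv
      by (intro fs.span_base CollectI exI[of _ "conv a s"] exI[of _ t]) (auto simp: aug_def conv_1)
  qed
  finally show ?thesis .
qed

text \<open>The action of \<open>K_i\<close> is right translation and touches only the right tensor
  factor. For a monomial all right factors can be chosen of one common weight, which is what makes
  them comparable modulo \<open>B^+A\<close>.\<close>

lemma mon_sweedler:
  assumes "m \<in> mon q"
  shows "\<exists>c. inv_weight c \<and> comult m \<in> tens_space A (wt c)"
  using assms
proof induction
  case one
  then show ?case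
    using inv_weight_one comult_counit_in[OF A_counit counit_wt] by blast
next
  case (uu m j k)
  then obtain c where c: "inv_weight c" "comult m \<in> tens_space A (wt c)" by blast
  have "comult (uu q j k) \<in> tens_space A (wt (fund_wt k))"
    using uu by (intro comult_uu_in conjI A_uu uu_wt)
  then have "comult (conv (uu q j k) m) \<in> tens_space A (wt (\<lambda>i. fund_wt k i * c i))"
    using c(2) by (rule comult_conv_in_tens_space) (auto intro: A_subspace A_conv wt_conv)
  then show ?case
    using inv_weight_mult[OF inv_weight_fund_wt[OF uu(3)] c(1)] by blast
next
  case (su m j k)
  then obtain c where c: "inv_weight c" "comult m \<in> tens_space A (wt c)" by blast
  have "comult (su q j k) \<in> tens_space A (wt (\<lambda>i. inverse (fund_wt j i)))"
    using su by (intro comult_su_in conjI A_su su_wt)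
  then have "comult (conv (su q j k) m) \<in> tens_space A (wt (\<lambda>i. inverse (fund_wt j i) * c i))"
    using c(2) by (rule comult_conv_in_tens_space) (auto intro: A_subspace A_conv wt_conv)
  then show ?case
    using inv_weight_mult[OF inv_weight_inverse_fund_wt[OF su(2)] c(1)] by blast
qed

end

section \<open>The tangent space\<close>

lemma uq_star_single:
  "uq_star (Poly_Mapping.single w c) = scal (cnj c) * prod_list (rev (map gen_star (letters w)))"
  by (simp add: uq_star_def)

lemma uq_star_add: "uq_star (x + y) = uq_star x + uq_star y"
  unfolding uq_star_def
  by (rule setsum_keys_plus_distrib) (simp_all add: single_add algebra_simps)

lemma uq_star_diff: "uq_star (x - y) = uq_star x - uq_star y"
  using uq_star_add[of "x - y" y] by (simp add: algebra_simps)

text \<open>The star reverses products, so the factor for \<open>N1\<close> comes first in the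
  leading term; it is antilinear, but the coefficient \<open>1/q\<close> is real and stays the
  same.\<close>

lemma Froot_simps:
  "Froot q R1 = KK N1 * FF N1" "Froot q R2 = KK N2 * FF N2"
  "Froot q R12 = (KK N1 * FF N1) * (KK N2 * FF N2)
     - scal (inverse (complex_of_real q)) * ((KK N2 * FF N2) * (KK N1 * FF N1))"
proof -
  have "EE i * EE j = Poly_Mapping.single (Word [GE i, GE j]) 1" for i j
    by (simp add: gn_def mult_single plus_word_def)
  moreover have "scal c * EE i * EE j = Poly_Mapping.single (Word [GE i, GE j]) c" for i j c
    by (simp add: gn_def mult_single plus_word_def zero_word_def)
  ultimately show "Froot q R12 = (KK N1 * FF N1) * (KK N2 * FF N2)
     - scal (inverse (complex_of_real q)) * ((KK N2 * FF N2) * (KK N1 * FF N1))"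
    by (simp add: Froot_def uq_star_diff uq_star_single)
qed (simp_all add: Froot_def gn_def[of "GE _"] uq_star_single)

lemma tangent_basis_eq:
  "tangent_basis q =
    [EE N1, EE N2, EE N2 * EE N1 - scal (inverse (complex_of_real q)) * EE N1 * EE N2,
     KK N1 * FF N1, KK N2 * FF N2,
     (KK N1 * FF N1) * (KK N2 * FF N2)
     - scal (inverse (complex_of_real q)) * ((KK N2 * FF N2) * (KK N1 * FF N1))]"
  by (simp add: tangent_basis_def Froot_simps)

lemma length_tangent_basis: "length (tangent_basis q) = 6"
  by (simp add: tangent_basis_eq)

lemma less_6_cases: "n < 6 \<longleftrightarrow> n = 0 \<or> n = 1 \<or> n = 2 \<or> n = 3 \<or> n = 4 \<or> n = (5::nat)"
  by auto

lemma vanish_on_tangent_iff: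
  assumes "lin y"
  shows "(\<forall>X\<in>tangent q. y X = 0) \<longleftrightarrow> (\<forall>n<6. y (tangent_basis q ! n) = 0)"
proof -
  have R: "UNIV = {R1, R2, R12}"
    by (rule set_eqI, rename_tac x, case_tac x) simp_all
  have S: "range (Eroot q) \<union> range (Froot q) = set (tangent_basis q)"
    unfolding R by (simp add: tangent_basis_def insert_commute)
  have "(\<forall>X\<in>tangent q. y X = 0) \<longleftrightarrow> (\<forall>X\<in>set (tangent_basis q). y X = 0)"
  proof
    assume *: "\<forall>X\<in>set (tangent_basis q). y X = 0"
    show "\<forall>X\<in>tangent q. y X = 0"
    proof
      fix X assume "X \<in> tangent q"
      then show "y X = 0"
        unfolding tangent_def S
        by (induction rule: fa.span_induct_alt)
          (auto simp: * lin_zero lin_add lin_scal assms free_scale_def)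
    qed
  qed (auto simp: tangent_def S intro: fa.span_base)
  also have "\<dots> \<longleftrightarrow> (\<forall>n<6. y (tangent_basis q ! n) = 0)"
    by (simp add: all_set_conv_all_nth length_tangent_basis)
  finally show ?thesis .
qed

text \<open>\<open>K\<^sub>i X = c X K\<^sub>i\<close> in \<open>U\<^sub>q(sl\<^sub>3)\<close>, as seen by functionals.\<close>

definition kcomm :: "real \<Rightarrow> node \<Rightarrow> complex \<Rightarrow> free \<Rightarrow> bool" where
  "kcomm q i c X \<longleftrightarrow> (\<forall>a\<in>uq_dual q. \<forall>x y. a (x * (KK i * (X * y))) = c * a (x * (X * (KK i * y))))"

lemma kcomm_EE: "kcomm q i (complex_of_real q powi cartan i j) (EE j)"
  and kcomm_FF: "kcomm q i (complex_of_real q powi (- cartan i j)) (FF j)"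
  and kcomm_KK: "kcomm q i 1 (KK j)"
  by (auto simp: kcomm_def dual_K_E dual_K_F dual_K_KI(3)[of _ q _ i j])

lemma kcomm_mult:
  assumes "kcomm q i c X" "kcomm q i d Y"
  shows "kcomm q i (c * d) (X * Y)"
  unfolding kcomm_def
proof (intro ballI allI)
  fix a x y assume a: "a \<in> uq_dual q"
  have "a (x * (KK i * (X * (Y * y)))) = c * a (x * (X * (KK i * (Y * y))))"
    using assms(1) a by (auto simp: kcomm_def)
  also have "a (x * (X * (KK i * (Y * y)))) = d * a ((x * X) * (Y * (KK i * y)))"
    using assms(2) a by (auto simp: kcomm_def simp flip: mult.assoc[of x X])
  finally show "a (x * (KK i * (X * Y * y))) = c * d * a (x * (X * Y * (KK i * y)))"
    by (simp add: mult.assoc)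
qed

lemma kcomm_diff: "kcomm q i c X \<Longrightarrow> kcomm q i c Y \<Longrightarrow> kcomm q i c (X - Y)"
  by (auto simp: kcomm_def left_diff_distrib right_diff_distrib lin_diff[OF uq_dual_lin])

lemma kcomm_scal: "kcomm q i c X \<Longrightarrow> kcomm q i c (scal d * X)"
  by (auto simp: kcomm_def mult.assoc mult_scal_left lin_scal[OF uq_dual_lin])

text \<open>The \<open>n\<close>-th tangent vector pairs with \<open>u\<^sub>j\<^sub>k\<close> for \<open>j = upper ! n\<close>, \<open>k = lower ! n\<close> only.\<close>

definition upper :: "nat list" where "upper = [2, 3, 3, 1, 2, 1]"
definition lower :: "nat list" where "lower = [1, 2, 1, 2, 3, 3]"

lemma upper_lower_in: "n < 6 \<Longrightarrow> upper ! n \<in> {1..3}" "n < 6 \<Longrightarrow> lower ! n \<in> {1..3}"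
  by (auto simp: less_6_cases upper_def lower_def)

context su3
begin

abbreviation X :: "nat \<Rightarrow> free" where "X n \<equiv> tangent_basis q ! n"

text \<open>The factor in \<open>K_i X_n = c X_n K_i\<close>. Writing it as a quotient of
  fundamental weights, rather than as a power of \<open>q\<close> given by the root, makes
  \<open>inv_weight\<close> immediate.\<close>

definition root_wt :: "nat \<Rightarrow> node \<Rightarrow> complex" where
  "root_wt n i = fund_wt (upper ! n) i * inverse (fund_wt (lower ! n) i)"

lemma kcomm_X: assumes "n < 6" shows "kcomm q i (root_wt n i) (X n)"
proof -
  let ?E = "\<lambda>j. Q powi cartan i j" and ?F = "\<lambda>j. Q powi (- cartan i j)"
  have KF: "kcomm q i (?F j) (KK j * FF j)" for j
    using kcomm_mult[OF kcomm_KK kcomm_FF, of q i j j] by simp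
  have g: "root_wt 0 i = ?E N1" "root_wt 1 i = ?E N2" "root_wt 2 i = ?E N2 * ?E N1" "root_wt 3 i = ?F N1"
    "root_wt 4 i = ?F N2" "root_wt 5 i = ?F N1 * ?F N2"
    using q_nz by (cases i; simp add: root_wt_def upper_def lower_def fund_wt_def cartan_def power_int_minus
        power2_eq_square)+
  \<comment> \<open>Both monomials of a root vector of length two contain the same letters, hence
    have the same factor, and the difference inherits it.\<close>
  have "kcomm q i (root_wt 2 i) (X 2)"
    unfolding g tangent_basis_eq
    using kcomm_mult[OF kcomm_EE kcomm_EE, of q i N2 N1] kcomm_mult[OF kcomm_EE kcomm_EE, of q i N1 N2]
    by (auto intro!: kcomm_diff kcomm_scal simp: mult.assoc mult.commute)
  moreover have "kcomm q i (root_wt 5 i) (X 5)"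
    unfolding g tangent_basis_eq
    using kcomm_mult[OF KF KF, of N2 N1] kcomm_mult[OF KF KF, of N1 N2]
    by (auto intro!: kcomm_diff kcomm_scal simp: mult.commute)
  moreover have "kcomm q i (root_wt 0 i) (X 0)" "kcomm q i (root_wt 1 i) (X 1)" "kcomm q i (root_wt 3 i) (X 3)"
    "kcomm q i (root_wt 4 i) (X 4)"
    unfolding g by (simp_all add: tangent_basis_eq kcomm_EE KF)
  ultimately show ?thesis
    using assms by (auto simp: less_6_cases)
qed

lemma X_KK: "n < 6 \<Longrightarrow> a \<in> uq_dual q \<Longrightarrow> a (x * (KK i * (X n * y))) = root_wt n i * a (x * (X n * (KK i * y)))"
  using kcomm_X unfolding kcomm_def by blast

lemma counit_X: "n < 6 \<Longrightarrow> uq_counit (X n) = 0"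
  by (auto simp: less_6_cases tangent_basis_eq counit_mult counit_gn lin_diff[OF lin_counit])

lemma inv_weight_root_wt: "n < 6 \<Longrightarrow> inv_weight (root_wt n)"
  unfolding root_wt_def[abs_def] by (intro inv_weight_mult inv_weight_fund_wt inv_weight_inverse_fund_wt upper_lower_in)

text \<open>An element of weight \<open>root_wt n\<close> and counit 1, standing for the torus
  character that belongs to \<open>X_n\<close>; \<open>grp_neg\<close> stands for the inverse
  character.\<close>

definition grp_pos :: "nat \<Rightarrow> func" where
  "grp_pos n = conv (uu q (upper ! n) (upper ! n)) (su q (lower ! n) (lower ! n))"

definition grp_neg :: "nat \<Rightarrow> func" where
  "grp_neg n = conv (uu q (lower ! n) (lower ! n)) (su q (upper ! n) (upper ! n))"

lemma grp_pos_wt: "n < 6 \<Longrightarrow> grp_pos n \<in> wt (root_wt n)"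
  unfolding grp_pos_def root_wt_def[abs_def] by (intro wt_conv uu_wt su_wt upper_lower_in)

lemma grp_neg_wt:
  assumes "n < 6"
  shows "grp_neg n \<in> wt (\<lambda>i. inverse (root_wt n i))"
proof -
  note u = upper_lower_in(1)[OF assms] and l = upper_lower_in(2)[OF assms]
  show ?thesis
    using wt_conv[OF uu_wt[OF l l] su_wt[OF u u]] unfolding grp_neg_def root_wt_def
    by (simp add: mult.commute)
qed

lemma grp_pos_1: "grp_pos n 1 = 1" and grp_neg_1: "grp_neg n 1 = 1"
  by (simp_all add: grp_pos_def grp_neg_def conv_1 uu_1 su_1)

definition root_func :: "nat \<Rightarrow> func" where
  "root_func n = conv (uu q (upper ! n) (lower ! n)) (su q (lower ! n) (lower ! n))"

lemma root_func_wt: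
  assumes "n < 6"
  shows "root_func n \<in> wt (\<lambda>i. 1)"
proof -
  note u = upper_lower_in(1)[OF assms] and l = upper_lower_in(2)[OF assms]
  show ?thesis
    using wt_conv[OF uu_wt[OF u l] su_wt[OF l l]] unfolding root_func_def by (simp add: fund_wt_nz)
qed

lemma root_func_1: "n < 6 \<Longrightarrow> root_func n 1 = 0"
  by (auto simp: less_6_cases root_func_def conv_1 uu_1 su_1 upper_def lower_def)

lemma uu_lmult_gen:
  assumes "j \<in> {1..3}"
  shows "uu q j k (EE i * y) = (if j = nd i + 1 then uu q (nd i) k y else 0)"
    "uu q j k (FF i * y) = (if j = nd i then uu q (nd i + 1) k y else 0)"
    "uu q j k (KK i * y) = fund_wt j i * uu q j k y"
    "uu q j k (KI i * y) = inverse (fund_wt j i) * uu q j k y"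
proof -
  have j: "j = 1 \<or> j = 2 \<or> j = 3"
    using assms by (simp only: in_upto_3)
  show "uu q j k (EE i * y) = (if j = nd i + 1 then uu q (nd i) k y else 0)"
    "uu q j k (FF i * y) = (if j = nd i then uu q (nd i + 1) k y else 0)"
    by (cases i; simp add: uu_lmult sum_upto_3 numeral_3_eq_3 numeral_2_eq_2)+
  have "gen_pairing q (GK i) j a = (if a = j then fund_wt j i else 0)"
    "gen_pairing q (GKi i) j a = (if a = j then inverse (fund_wt j i) else 0)" for a
    by (simp_all add: fund_wt_def flip: power_int_minus)
  with j show "uu q j k (KK i * y) = fund_wt j i * uu q j k y"
    "uu q j k (KI i * y) = inverse (fund_wt j i) * uu q j k y"
    by (auto simp only: uu_lmult sum_upto_3) auto
qed

lemma su_lmult_gen: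
  assumes "j \<in> {1..3}" "k \<in> {1..3}"
  shows "su q j k (EE i * y) = (if k = nd i then - Q * su q j (nd i + 1) y else 0)"
    "su q j k (FF i * y) = (if k = nd i + 1 then - inverse Q * su q j (nd i) y else 0)"
    "su q j k (KK i * y) = inverse (fund_wt k i) * su q j k y"
    "su q j k (KI i * y) = fund_wt k i * su q j k y"
proof -
  have k: "k = 1 \<or> k = 2 \<or> k = 3"
    using assms(2) by (simp only: in_upto_3)
  note l = su_lmult[OF q_nz(1) assms]
  show "su q j k (EE i * y) = (if k = nd i then - Q * su q j (nd i + 1) y else 0)"
    "su q j k (FF i * y) = (if k = nd i + 1 then - inverse Q * su q j (nd i) y else 0)"
    by (cases i; simp add: l sum_upto_3 numeral_3_eq_3 numeral_2_eq_2)+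
  have "gen_pairing q (GK i) a k = (if a = k then fund_wt k i else 0)"
    "gen_pairing q (GKi i) a k = (if a = k then inverse (fund_wt k i) else 0)" for a
    by (simp_all add: fund_wt_def flip: power_int_minus)
  with k show "su q j k (KK i * y) = inverse (fund_wt k i) * su q j k y"
    "su q j k (KI i * y) = fund_wt k i * su q j k y"
    by (auto simp only: l sum_upto_3 antipode_pairing.simps) auto
qed

lemma root_func_X:
  assumes "n < 6" "m < 6"
  shows "root_func n (X m) = 0 \<longleftrightarrow> m \<noteq> n"
proof -
  \<comment> \<open>The trailing \<open>1\<close> puts every letter in front of a further argument,
    so the rules for left multiplication apply to the last letter too. Only the nonvanishing for
    \<open>m = n\<close> is recorded, as \<open>dual_func\<close> divides by the value.\<close>
  have "root_func n (X m * 1) = 0 \<longleftrightarrow> m \<noteq> n"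
    using assms unfolding less_6_cases root_func_def tangent_basis_eq
    by (elim disjE; simp del: mult_1_right add: upper_def lower_def mult.assoc left_diff_distrib
        lin_diff[OF lin_conv] lin_scal[OF lin_conv] conv_lmult conv_1 uu_lmult_gen su_lmult_gen
        uu_1 su_1 fund_wt_nz q_nz)
  then show ?thesis by simp
qed

end

section \<open>Quotient spaces\<close>

definition qsp :: "'x qspace \<Rightarrow> bool" where
  "qsp Q \<longleftrightarrow> fs.subspace (fst Q) \<and> fs.subspace (snd Q) \<and> snd Q \<subseteq> fst Q"

definition flin :: "(('x \<Rightarrow> complex) \<Rightarrow> 'y \<Rightarrow> complex) \<Rightarrow> bool" where
  "flin f \<longleftrightarrow> (\<forall>u v. f (u + v) = f u + f v) \<and> (\<forall>c v. f (fscale c v) = fscale c (f v))"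

lemma qspD: "qsp Q \<Longrightarrow> fs.subspace (fst Q)" "qsp Q \<Longrightarrow> fs.subspace (snd Q)" "qsp Q \<Longrightarrow> snd Q \<subseteq> fst Q"
  by (auto simp: qsp_def)

lemma coset_eqI:
  assumes "fs.subspace N" "v - w \<in> N"
  shows "v +o N = w +o N"
proof -
  have "v +o N \<subseteq> w +o N" if "v - w \<in> N" for v w
  proof
    fix x assume "x \<in> v +o N"
    then obtain n where n: "n \<in> N" "x = v + n" by (auto simp: elt_set_plus_def)
    have "(v - w) + n \<in> N" using assms(1) that n by (intro fs.subspace_add)
    moreover have "x = w + ((v - w) + n)" by (simp add: n)
    ultimately show "x \<in> w +o N" unfolding elt_set_plus_def by blast
  qed
  moreover have "w - v \<in> N"
    using fs.subspace_neg[OF assms] by simp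
  ultimately show ?thesis using assms(2) by blast
qed

lemma coset_zero: "(0 :: 'x \<Rightarrow> complex) +o N = N"
  by (auto simp: elt_set_plus_def)

lemma subspace_plus_self: "fs.subspace N \<Longrightarrow> N + N = N"
proof
  assume N: "fs.subspace N"
  then show "N + N \<subseteq> N"
    by (auto simp: set_plus_def intro: fs.subspace_add)
  show "N \<subseteq> N + N"
  proof
    fix x assume "x \<in> N"
    then have "x = x + 0" "0 \<in> N" using fs.subspace_0[OF N] by auto
    with \<open>x \<in> N\<close> show "x \<in> N + N" unfolding set_plus_def by blast
  qed
qed

lemma coset_plus: "fs.subspace N \<Longrightarrow> (v +o N) + (w +o N) = (v + w) +o N"
  by (simp add: set_plus_rearrange subspace_plus_self)

text \<open>The pattern behind all induced maps: apply \<open>f\<close> to the representatives in a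
  coset and add \<open>M\<close>, which completes the image to a full coset.\<close>

lemma image_coset:
  assumes "flin f" "f ` N \<subseteq> M" "fs.subspace N" "fs.subspace M"
  shows "f ` (v +o N) + M = f v +o M"
proof
  show "f ` (v +o N) + M \<subseteq> f v +o M"
  proof
    fix x assume "x \<in> f ` (v +o N) + M"
    then obtain n m where "n \<in> N" "m \<in> M" "x = f (v + n) + m"
      by (auto simp: set_plus_def elt_set_plus_def)
    moreover from this have "f n + m \<in> M"
      using assms(2,4) by (auto intro: fs.subspace_add)
    moreover have "f (v + n) + m = f v + (f n + m)"
      using assms(1) by (simp add: flin_def add.assoc)
    ultimately show "x \<in> f v +o M" unfolding elt_set_plus_def by blast
  qed
  show "f v +o M \<subseteq> f ` (v +o N) + M"
  proof
    fix x assume "x \<in> f v +o M"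
    then obtain m where "m \<in> M" "x = f v + m" by (auto simp: elt_set_plus_def)
    moreover have "v \<in> v +o N"
      using fs.subspace_0[OF assms(3)] unfolding elt_set_plus_def by force
    ultimately show "x \<in> f ` (v +o N) + M" unfolding set_plus_def by blast
  qed
qed

lemma flin_fscale: "flin (fscale c)"
  by (auto simp: flin_def fscale_def fun_eq_iff algebra_simps)

lemma qscale_coset: "fs.subspace (snd Q) \<Longrightarrow> qscale Q c (v +o snd Q) = fscale c v +o snd Q"
  unfolding qscale_def by (rule image_coset[OF flin_fscale]) (auto intro: fs.subspace_scale)

lemma qlinear_induced:
  assumes "flin f" "qsp Q" "qsp R" "f ` fst Q \<subseteq> fst R" "f ` snd Q \<subseteq> snd R"
  shows "qlinear Q R (\<lambda>X. f ` X + snd R)"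
proof -
  note im = image_coset[OF assms(1,5) qspD(2)[OF assms(2)] qspD(2)[OF assms(3)]]
  note N = qspD(2)[OF assms(2)] and M = qspD(2)[OF assms(3)]
  have f: "f (u + v) = f u + f v" "f (fscale c v) = fscale c (f v)" for u v c
    using assms(1) by (simp_all add: flin_def)
  show ?thesis
    unfolding qlinear_def
  proof (intro conjI ballI allI)
    fix X assume "X \<in> qcarrier Q"
    then obtain v where v: "v \<in> fst Q" "X = v +o snd Q" by (auto simp: qcarrier_def)
    show "f ` X + snd R \<in> qcarrier R"
      using v assms(4) by (auto simp: im qcarrier_def)
    show "f ` qscale Q c X + snd R = qscale R c (f ` X + snd R)" for c
      unfolding v by (simp only: qscale_coset[OF N] im qscale_coset[OF M] f)
    fix Y assume "Y \<in> qcarrier Q"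
    then obtain w where w: "w \<in> fst Q" "Y = w +o snd Q" by (auto simp: qcarrier_def)
    show "f ` (X + Y) + snd R = (f ` X + snd R) + (f ` Y + snd R)"
      unfolding v w by (simp only: coset_plus[OF N] coset_plus[OF M] im f)
  qed
qed

lemma qlinear_zero:
  assumes "qsp R"
  shows "qlinear Q R (\<lambda>_. qzero R)"
proof -
  have "snd R = 0 +o snd R" by (simp only: coset_zero)
  moreover have "0 \<in> fst R" using fs.subspace_0[OF qspD(1)[OF assms]] .
  ultimately have "snd R \<in> qcarrier R" unfolding qcarrier_def by blast
  moreover have "qscale R c (snd R) = snd R" for c
    using qscale_coset[OF qspD(2)[OF assms], of c 0]
    by (simp only: coset_zero fs.scale_zero_right)
  ultimately show ?thesis
    by (simp add: qlinear_def qzero_def subspace_plus_self qspD(2)[OF assms])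
qed

lemma sum_list_cosets:
  assumes "fs.subspace N"
  shows "sum_list (map (\<lambda>i. f i +o N) I) + N = (\<Sum>i\<leftarrow>I. f i) +o N"
proof (induction I)
  case Nil
  have "(0 :: ('a \<Rightarrow> complex) set) + N = N" by simp
  then show ?case by (simp only: list.map sum_list.Nil coset_zero)
next
  case (Cons i I)
  have "sum_list (map (\<lambda>i. f i +o N) (i # I)) + N
      = (f i +o N) + (sum_list (map (\<lambda>i. f i +o N) I) + N)"
    by (simp add: add.assoc)
  then show ?case
    by (simp only: Cons.IH coset_plus[OF assms] list.map sum_list.Cons)
qed

lemma subspace_set_plus:
  assumes "fs.subspace N" "fs.subspace M"
  shows "fs.subspace (N + M)"
proof -
  have "N + M = {x + y |x y. x \<in> N \<and> y \<in> M}"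
    by (auto simp: set_plus_def)
  then show ?thesis using fs.subspace_sums[OF assms] by simp
qed

lemma in_set_plus_right: "fs.subspace N \<Longrightarrow> x \<in> M \<Longrightarrow> x \<in> N + M"
  using fs.subspace_0[of N] by (metis add.left_neutral set_plus_intro)

lemma tens_zero: "tens 0 w = 0" "tens v 0 = 0"
  by (auto simp: fun_eq_iff tens_def)

lemma qsp_qtensor_space:
  assumes "qsp Q" "qsp R"
  shows "qsp (qtensor_space Q R)"
proof -
  have "tens_space (snd Q) (fst R) \<subseteq> tens_space (fst Q) (fst R)"
    "tens_space (fst Q) (snd R) \<subseteq> tens_space (fst Q) (fst R)"
    using assms by (intro tens_space_mono; simp add: qsp_def)+
  then have "tens_space (snd Q) (fst R) + tens_space (fst Q) (snd R) \<subseteq> tens_space (fst Q) (fst R)"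
    using fs.subspace_add[OF tens_space_subspace] by (fastforce simp: set_plus_def)
  then show ?thesis
    by (simp add: qsp_def qtensor_space_def tens_space_subspace subspace_set_plus)
qed

text \<open>Changing representatives costs
  \<open>(v + n) (x) (w + m) - v (x) w = n (x) (w + m) + v (x) m\<close>, which lies in the subspace
  divided out.\<close>

lemma qtensor_coset:
  assumes "qsp Q" "qsp R" "v \<in> fst Q" "w \<in> fst R"
  shows "qtensor Q R (v +o snd Q) (w +o snd R) = tens v w +o snd (qtensor_space Q R)"
proof -
  let ?S = "snd (qtensor_space Q R)"
  have S: "fs.subspace ?S" using qsp_qtensor_space[OF assms(1,2)] by (rule qspD)
  have *: "tens (v + n) (w + m) +o ?S = tens v w +o ?S" if "n \<in> snd Q" "m \<in> snd R" for n m
  proof (rule coset_eqI[OF S])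
    have "tens n (w + m) \<in> tens_space (snd Q) (fst R)"
      using that assms qspD(3)[OF assms(2)]
      by (intro tens_in_tens_space fs.subspace_add qspD(1)) auto
    moreover have "tens v m \<in> tens_space (fst Q) (snd R)"
      using that assms by (intro tens_in_tens_space)
    ultimately have "tens n (w + m) + tens v m \<in> ?S"
      unfolding qtensor_space_def snd_conv set_plus_def by blast
    moreover have "tens (v + n) (w + m) - tens v w = tens n (w + m) + tens v m"
      by (auto simp: fun_eq_iff tens_def algebra_simps)
    ultimately show "tens (v + n) (w + m) - tens v w \<in> ?S" by simp
  qed
  have "qtensor Q R (v +o snd Q) (w +o snd R)
      = (\<Union>n\<in>snd Q. \<Union>m\<in>snd R. tens (v + n) (w + m) +o ?S)"
    unfolding qtensor_def by (fastforce simp: set_plus_def elt_set_plus_def)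
  also have "\<dots> = (\<Union>n\<in>snd Q. \<Union>m\<in>snd R. tens v w +o ?S)"
    using * by auto
  also have "\<dots> = tens v w +o ?S"
    using fs.subspace_0[OF qspD(2)[OF assms(1)]] fs.subspace_0[OF qspD(2)[OF assms(2)]] by auto
  finally show ?thesis .
qed

lemma is_id_tensor_zero:
  assumes "qsp Q" "qsp R"
  shows "is_id_tensor Q R (\<lambda>_. qzero R) (\<lambda>_. qzero (qtensor_space Q R))"
  unfolding is_id_tensor_def
proof (intro conjI ballI qlinear_zero qsp_qtensor_space assms)
  fix X Y assume "X \<in> qcarrier Q"
  then obtain v where v: "v \<in> fst Q" "X = v +o snd Q" by (auto simp: qcarrier_def)
  have "qtensor Q R (v +o snd Q) (0 +o snd R) = tens v 0 +o snd (qtensor_space Q R)"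
    using fs.subspace_0[OF qspD(1)[OF assms(2)]] by (intro qtensor_coset assms v)
  then show "qzero (qtensor_space Q R) = qtensor Q R X (qzero R)"
    by (simp only: v qzero_def coset_zero tens_zero)
qed

section \<open>The cotangent space\<close>

lemma aug_subspace:
  assumes "fs.subspace C"
  shows "fs.subspace (aug C)"
proof (rule fs.subspaceI)
  show "0 \<in> aug C" using fs.subspace_0[OF assms] by (simp add: aug_def)
  show "x + y \<in> aug C" if "x \<in> aug C" "y \<in> aug C" for x y
    using that fs.subspace_add[OF assms, of x y] by (simp add: aug_def)
  show "fscale c x \<in> aug C" if "x \<in> aug C" for c x
    using that fs.subspace_scale[OF assms, of x c] by (simp add: aug_def) (simp add: fscale_def)
qed

lemma sum_fun_apply: "(\<Sum>i\<in>I. (f i :: 'x \<Rightarrow> complex)) x = (\<Sum>i\<in>I. f i x)"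
  by (induction I rule: infinite_finite_induct) auto

lemma sum_of_bool:
  assumes "m < (k::nat)"
  shows "(\<Sum>n<k. f n * of_bool (m = n)) = (f m :: complex)"
    "(\<Sum>n<k. f n * (g n * of_bool (m = n))) = (f m * g m :: complex)"
  using assms by (simp_all add: of_bool_def if_distrib sum.delta cong: if_cong)

lemma image_eq_of_representatives:
  "S \<subseteq> T \<Longrightarrow> (\<And>y. y \<in> T \<Longrightarrow> \<exists>b\<in>S. f b = f y) \<Longrightarrow> f ` S = f ` T"
  by (auto simp: image_iff) metis

context su3
begin

abbreviation Ap :: "func set" where "Ap \<equiv> aug A"
abbreviation N :: "func set" where "N \<equiv> snd (Lambda1 q)"

lemma fst_Lambda1: "fst (Lambda1 q) = Ap"
  by (simp add: Lambda1_def)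

lemma Ap_A: "y \<in> Ap \<Longrightarrow> y \<in> A"
  by (simp add: aug_def)

lemma N_iff: "y \<in> N \<longleftrightarrow> y \<in> Ap \<and> (\<forall>n<6. y (X n) = 0)"
  unfolding Lambda1_def using vanish_on_tangent_iff[OF A_lin] by (auto simp: aug_def)

lemma N_subspace: "fs.subspace N"
proof (rule fs.subspaceI)
  note s = aug_subspace[OF A_subspace]
  show "0 \<in> N" using fs.subspace_0[OF s] by (simp add: N_iff)
  show "x + y \<in> N" if "x \<in> N" "y \<in> N" for x y
    using that fs.subspace_add[OF s, of x y] by (simp add: N_iff)
  show "fscale c x \<in> N" if "x \<in> N" for c x
    using that fs.subspace_scale[OF s, of x c] by (simp add: N_iff) (simp add: fscale_def)
qed

lemma qsp_Lambda1: "qsp (Lambda1 q)"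
  using N_subspace aug_subspace[OF A_subspace] by (auto simp: qsp_def fst_Lambda1 N_iff)

lemma qsp_piB: "qsp (piB q)"
  using BA_subset_A BA_subspace A_subspace by (simp add: qsp_def piB_def)

lemma fst_piB: "fst (piB q) = A"
  by (simp add: piB_def)

lemma qsp_Aspace: "qsp (Aspace q)"
  using A_subspace fs.subspace_0[OF A_subspace] by (simp add: qsp_def Aspace_def fs.subspace_single_0)

lemma qsp_Omega1: "qsp (Omega1 q)"
  unfolding Omega1_def by (intro qsp_qtensor_space qsp_Aspace qsp_Lambda1)

definition dual_func :: "nat \<Rightarrow> func" where
  "dual_func n = fscale (inverse (root_func n (X n))) (root_func n)"

lemma dual_func_aug_OF3: "n < 6 \<Longrightarrow> dual_func n \<in> aug (OF3 q)"
  using fs.subspace_scale[OF wt_subspace root_func_wt, of n "inverse (root_func n (X n))"] wt_one_subset_OF3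
  by (auto simp: dual_func_def aug_def) (simp add: fscale_def root_func_1)

lemma dual_func_Ap: "n < 6 \<Longrightarrow> dual_func n \<in> Ap"
  using dual_func_aug_OF3 OF3_subset by (auto simp: aug_def)

lemma dual_func_1: "n < 6 \<Longrightarrow> dual_func n 1 = 0"
  using dual_func_Ap by (auto simp: aug_def)

lemma dual_func_X: "n < 6 \<Longrightarrow> m < 6 \<Longrightarrow> dual_func n (X m) = of_bool (m = n)"
  using root_func_X[of n m] root_func_X[of n n] by (auto simp: dual_func_def fscale_def)

text \<open>The component in \<open>N\<close> for \<open>A = N + span(dual_func) + C 1\<close>. The
  unit is included because the tensor factors to which this is applied lie in \<open>A\<close> and
  possibly outside \<open>A^+\<close>.\<close>

definition remainder :: "func \<Rightarrow> func" where
  "remainder y = y - (\<Sum>n<6. fscale (y (X n)) (dual_func n)) - fscale (y 1) uq_counit"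

lemma remainder_in_N: assumes "y \<in> A" shows "remainder y \<in> N"
  unfolding N_iff
proof (intro conjI allI impI)
  have "remainder y \<in> A"
    unfolding remainder_def using assms dual_func_Ap Ap_A A_counit
    by (intro fs.subspace_diff[OF A_subspace] fs.subspace_sum[OF A_subspace]
        fs.subspace_scale[OF A_subspace]) auto
  then show "remainder y \<in> Ap"
    by (simp add: aug_def) (simp add: remainder_def sum_fun_apply fscale_def dual_func_1 counit_1)
  fix m :: nat assume "m < 6"
  then show "remainder y (X m) = 0"
    by (simp add: remainder_def sum_fun_apply fscale_def dual_func_X counit_X sum_of_bool)
qed

lemma dual_form_eq:
  assumes "n < 6"
  shows "dual_form q n = dual_func n +o N"
proof
  show "dual_form q n \<subseteq> dual_func n +o N"
  proof
    fix y assume "y \<in> dual_form q n"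
    then have "y - dual_func n \<in> N"
      using fs.subspace_diff[OF aug_subspace[OF A_subspace] _ dual_func_Ap[OF assms]]
      by (auto simp: dual_form_def N_iff length_tangent_basis dual_func_X assms)
    moreover have "y = dual_func n + (y - dual_func n)" by simp
    ultimately show "y \<in> dual_func n +o N" unfolding elt_set_plus_def by blast
  qed
  show "dual_func n +o N \<subseteq> dual_form q n"
    using fs.subspace_add[OF aug_subspace[OF A_subspace] dual_func_Ap[OF assms]] assms
    by (auto simp: dual_form_def N_iff length_tangent_basis dual_func_X elt_set_plus_def)
qed

lemma V1_to_Lambda1_surj:
  "V1_to_Lambda1 q ` qcarrier (V1 q) = qcarrier (Lambda1 q)"
proof -
  have sub: "snd (V1 q) \<subseteq> N"
    using OF3_subset by (auto simp: V1_def Lambda1_def aug_def)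
  have 0: "0 \<in> snd (V1 q)"
    using fs.subspace_0[OF wt_subspace] wt_one_subset_OF3
    by (auto simp: V1_def aug_def zero_fun_def)
  \<comment> \<open>A coset in \<open>V^1\<close> is smaller than the corresponding coset in
    \<open>Lambda^1\<close>; adding \<open>N\<close> absorbs the subspace divided out for
    \<open>V^1\<close>.\<close>
  have im: "V1_to_Lambda1 q (b +o snd (V1 q)) = b +o N" for b
  proof -
    have "snd (V1 q) + N = N"
      using sub subspace_plus_self[OF N_subspace] set_plus_mono2[OF sub, of N N]
        set_zero_plus2[OF 0, of N] by auto
    then show ?thesis
      by (simp add: V1_to_Lambda1_def set_plus_rearrange3)
  qed
  have "fst (V1 q) \<subseteq> Ap"
    using OF3_subset by (auto simp: V1_def aug_def)
  moreover have "\<exists>b\<in>fst (V1 q). b +o N = y +o N" if "y \<in> Ap" for y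
  proof
    let ?b = "\<Sum>n<6. fscale (y (X n)) (dual_func n)"
    have "?b \<in> wt (\<lambda>i. 1)"
      unfolding dual_func_def
      by (intro fs.subspace_sum[OF wt_subspace] fs.subspace_scale[OF wt_subspace] root_func_wt) simp
    moreover have "?b 1 = 0"
      by (simp add: sum_fun_apply fscale_def dual_func_1)
    ultimately show "?b \<in> fst (V1 q)"
      using wt_one_subset_OF3 by (auto simp: V1_def aug_def)
    have "y - ?b = remainder y"
      using that by (simp add: remainder_def aug_def)
    then have "y - ?b \<in> N" using remainder_in_N[OF Ap_A[OF that]] by simp
    then show "?b +o N = y +o N"
      by (intro coset_eqI[symmetric] N_subspace)
  qed
  ultimately have "(\<lambda>b. b +o N) ` fst (V1 q) = (\<lambda>y. y +o N) ` Ap"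
    by (rule image_eq_of_representatives)
  moreover have "qcarrier R = (\<lambda>v. v +o snd R) ` fst R" for R :: "free qspace"
    unfolding qcarrier_def by (rule Setcompr_eq_image)
  moreover have "V1_to_Lambda1 q ` (\<lambda>b. b +o snd (V1 q)) ` fst (V1 q) = (\<lambda>b. b +o N) ` fst (V1 q)"
    by (simp only: image_image im)
  ultimately show ?thesis by (simp only: fst_Lambda1)
qed

section \<open>The coaction\<close>

abbreviation HL :: "(free \<times> free) qspace" where "HL \<equiv> qtensor_space (piB q) (Lambda1 q)"

lemma qsp_HL: "qsp HL"
  by (intro qsp_qtensor_space qsp_piB qsp_Lambda1)

lemma snd_HL: "snd HL = tens_space BA Ap + tens_space A N"
  by (simp add: qtensor_space_def fst_Lambda1 fst_piB)

text \<open>The decomposition by \<open>remainder\<close> applied to the second tensor factor;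
  \<open>R\<close> below is this operation, written without a choice of representatives.\<close>

lemma tens_remainder:
  assumes "t \<in> tens_space A A"
  shows "t - (\<Sum>n<6. tens (\<lambda>x. t (x, X n)) (dual_func n)) - tens (\<lambda>x. t (x, 1)) uq_counit \<in> tens_space A N"
proof -
  obtain ps where ps: "set ps \<subseteq> A \<times> A" "t = (\<Sum>(v, w)\<leftarrow>ps. tens v w)"
    using tens_space_obtain[OF assms A_subspace] .
  define R :: "(free \<times> free \<Rightarrow> complex) \<Rightarrow> free \<times> free \<Rightarrow> complex"
    where "R = (\<lambda>t (x, y). t (x, y) - (\<Sum>n<6. t (x, X n) * dual_func n y) - t (x, 1) * uq_counit y)"
  have add: "R (s + t) = R s + R t" for s t
    by (auto simp: R_def fun_eq_iff distrib_right sum.distrib)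
  have zero: "R 0 = 0"
    by (auto simp: R_def fun_eq_iff)
  have tens: "R (tens v w) = tens v (remainder w)" for v w
    by (auto simp: R_def fun_eq_iff remainder_def sum_fun_apply fscale_def right_diff_distrib
        sum_distrib_left mult.assoc)
  have "t - (\<Sum>n<6. tens (\<lambda>x. t (x, X n)) (dual_func n)) - tens (\<lambda>x. t (x, 1)) uq_counit = R t"
    by (auto simp: R_def fun_eq_iff sum_fun_apply)
  also have "R t = (\<Sum>(v, w)\<leftarrow>ps. tens v (remainder w))"
    unfolding ps(2) case_prod_unfold
    by (induction ps) (simp_all only: list.map sum_list.Nil sum_list.Cons add zero tens)
  also have "\<dots> \<in> tens_space A N"
    using ps(1) remainder_in_N
    by (intro fs_subspace_sum_list tens_space_subspace) (auto intro!: tens_in_tens_space)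
  finally show ?thesis .
qed

text \<open>The criterion for zero in \<open>(A / B^+A) (x) Lambda^1\<close>: the coefficients at
  the dual basis are \<open>t(-, X_n)\<close>, and vanishing at \<open>1\<close> removes the
  component along the unit.\<close>

lemma in_snd_HL:
  assumes "t \<in> tens_space A A" "\<And>x. t (x, 1) = 0" "\<And>n. n < 6 \<Longrightarrow> (\<lambda>x. t (x, X n)) \<in> BA"
  shows "t \<in> snd HL"
proof -
  let ?s = "\<Sum>n<6. tens (\<lambda>x. t (x, X n)) (dual_func n)"
  have "tens (\<lambda>x. t (x, 1)) uq_counit = 0"
    by (auto simp: fun_eq_iff assms(2))
  then have "t - ?s \<in> tens_space A N"
    using tens_remainder[OF assms(1)] by simp
  moreover have "?s \<in> tens_space BA Ap"
    using assms(3) dual_func_Ap by (auto intro!: fs.subspace_sum tens_space_subspace tens_in_tens_space)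
  moreover have "t = ?s + (t - ?s)" by simp
  ultimately show ?thesis
    unfolding snd_HL set_plus_def by blast
qed

text \<open>Representative of the left coaction in the dual basis, where it is diagonal: the
  \<open>n\<close>-th basis form goes to the class of \<open>grp_pos n\<close> tensored with
  itself.\<close>

definition coact :: "func \<Rightarrow> free \<times> free \<Rightarrow> complex" where
  "coact a = (\<Sum>n<6. fscale (a (X n)) (tens (grp_pos n) (dual_func n)))"

lemma coact_apply: "coact a (x, y) = (\<Sum>n<6. a (X n) * (grp_pos n x * dual_func n y))"
  by (simp add: coact_def sum_fun_apply fscale_def)

lemma flin_coact: "flin coact"
  unfolding flin_def by (auto simp: fun_eq_iff coact_apply fscale_def algebra_simps sum.distrib sum_distrib_left)

lemma coact_in: "coact a \<in> tens_space A Ap"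
  unfolding coact_def using grp_pos_wt wt_A dual_func_Ap
  by (auto intro!: fs.subspace_sum fs.subspace_scale tens_space_subspace tens_in_tens_space)

lemma coact_N: "a \<in> N \<Longrightarrow> coact a = 0"
  by (auto simp: fun_eq_iff coact_apply N_iff)

lemma coact_sweedler3:
  assumes a: "a \<in> Ap" and ps: "sweedler3 q a ps"
  shows "(\<Sum>(a1, a2, a3)\<leftarrow>ps. tens (conv a1 (antipode a3)) a2) - coact a \<in> snd HL" (is "?t - _ \<in> _")
proof (rule in_snd_HL)
  have aA: "a \<in> A" "a \<in> uq_dual q" and a1: "a 1 = 0"
    using a A_dual by (auto simp: aug_def)
  have mem: "fst p \<in> A" "fst (snd p) \<in> A" "snd (snd p) \<in> A" if "p \<in> set ps" for p
    using ps that by (auto simp: sweedler3_def)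
  have *: "a (x * y * z) = (\<Sum>p\<leftarrow>ps. fst p x * (fst (snd p) y * snd (snd p) z))" for x y z
    using ps unfolding sweedler3_def case_prod_unfold
    by (auto simp: fun_eq_iff sum_list_fun_apply comp_def)
  \<comment> \<open>The Sweedler sum as a function: the first tensor factor reads \<open>x_1\<close>
    and \<open>S(x_2)\<close>, the second reads \<open>y\<close>. The list \<open>ps\<close> has
    disappeared.\<close>
  have t: "?t (x, y) = cop (\<lambda>v w. a (v * y * uq_antipode w)) x" for x y
    unfolding * case_prod_unfold
    by (simp add: cop_fun_sum_list sum_list_fun_apply comp_def conv_eq_cop antipode_def
        cop_fun_scale[symmetric] mult.commute mult.left_commute)
  show tA: "?t - coact a \<in> tens_space A A"
  proof (intro fs.subspace_diff tens_space_subspace fs_subspace_sum_list)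
    have "Ap \<subseteq> A" using Ap_A by blast
    then show "coact a \<in> tens_space A A"
      using coact_in[of a] tens_space_mono[of A A Ap A] by blast
  qed (use mem in \<open>auto intro!: tens_in_tens_space A_conv A_antipode\<close>)
  show "(?t - coact a) (x, 1) = 0" for x
    using cop_antipode_right[OF aA(2), of x] by (simp add: t coact_apply dual_func_1 a1)
  fix n :: nat assume n: "n < 6"
  have c: "coact a (x, X n) = a (X n) * grp_pos n x" for x
    using n by (simp add: coact_apply dual_func_X sum_of_bool)
  define f where "f = (\<lambda>x. ?t (x, X n))"
  have "f = (\<Sum>p\<leftarrow>ps. fscale (fst (snd p) (X n)) (conv (fst p) (antipode (snd (snd p)))))"
    unfolding f_def case_prod_unfold
    by (auto simp: fun_eq_iff sum_list_fun_apply comp_def fscale_def mult.commute)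
  also have "\<dots> \<in> A"
    using mem by (auto intro!: A_sum_list fs.subspace_scale[OF A_subspace] A_conv A_antipode)
  finally have "f \<in> A" .
  moreover have "f (x * KK i) = root_wt n i * f x" for x i
  proof -
    \<comment> \<open>A \<open>KK i\<close> at the end of \<open>x\<close> surrounds
      \<open>X n\<close> as \<open>K_i X_n K_i^-1\<close>, which is \<open>root_wt n i\<close> times
      \<open>X_n\<close>.\<close>
    have "a (v * KK i * X n * uq_antipode (w * KK i)) = root_wt n i * a (v * X n * uq_antipode w)" for v w
      using X_KK[OF n aA(2), of v i "KI i * uq_antipode w"]
        dual_K_KI(1)[OF aA(2), of "v * X n" i "uq_antipode w"]
      by (simp add: uq_antipode_mult uq_antipode_gn mult.assoc)
    then show ?thesis
      by (simp add: f_def t cop_rmult cop_fun_scale)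
  qed
  ultimately have "f \<in> wt (root_wt n)"
    by (simp add: wt_def)
  then have "f - fscale (a (X n)) (grp_pos n) \<in> wt (root_wt n)"
    by (intro fs.subspace_diff[OF wt_subspace] fs.subspace_scale[OF wt_subspace] grp_pos_wt n)
  moreover have "(f - fscale (a (X n)) (grp_pos n)) 1 = 0"
    by (simp add: f_def t cop_1 uq_antipode_1 fscale_def grp_pos_1)
  ultimately have "f - fscale (a (X n)) (grp_pos n) \<in> BA"
    by (intro wt_in_BA[OF inv_weight_root_wt[OF n]])
  moreover have "(\<lambda>x. (?t - coact a) (x, X n)) = f - fscale (a (X n)) (grp_pos n)"
    by (auto simp: fun_eq_iff f_def c fscale_def)
  ultimately show "(\<lambda>x. (?t - coact a) (x, X n)) \<in> BA" by simp
qed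

lemma is_coaction_coact: "is_coaction q (\<lambda>Y. coact ` Y + snd HL)"
proof -
  have N0: "coact ` N \<subseteq> snd HL"
    using coact_N fs.subspace_0[OF qspD(2)[OF qsp_HL]] by auto
  have "qlinear (Lambda1 q) HL (\<lambda>Y. coact ` Y + snd HL)"
    using coact_in
    by (intro qlinear_induced flin_coact qsp_Lambda1 qsp_HL N0)
      (auto simp: qtensor_space_def fst_Lambda1 fst_piB)
  moreover have "coact ` (a +o N) + snd HL = (\<Sum>(a1, a2, a3)\<leftarrow>ps. tens (conv a1 (antipode a3)) a2) +o snd HL"
    if "a \<in> Ap" "sweedler3 q a ps" for a ps
  proof -
    have "coact ` (a +o N) + snd HL = coact a +o snd HL"
      by (rule image_coset[OF flin_coact N0 N_subspace qspD(2)[OF qsp_HL]])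
    also have "\<dots> = (\<Sum>(a1, a2, a3)\<leftarrow>ps. tens (conv a1 (antipode a3)) a2) +o snd HL"
      by (rule coset_eqI[OF qspD(2)[OF qsp_HL] coact_sweedler3[OF that], symmetric])
    finally show ?thesis .
  qed
  ultimately show ?thesis
    unfolding is_coaction_def Let_def by blast
qed

lemma principal_connection_zero: "principal_connection q (\<lambda>\<omega>. qzero (Omega1 q))"
  unfolding principal_connection_def
proof (intro exI conjI)
  let ?p = "\<lambda>_::func set. qzero (Lambda1 q)"
  show "is_id_tensor (Aspace q) (Lambda1 q) ?p (\<lambda>\<omega>. qzero (Omega1 q))"
    unfolding Omega1_def by (intro is_id_tensor_zero qsp_Aspace qsp_Lambda1)
  show "\<forall>X\<in>qcarrier (Lambda1 q). ?p (?p X) = ?p X" by simp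
  show "{X \<in> qcarrier (Lambda1 q). ?p X = qzero (Lambda1 q)} = V1_to_Lambda1 q ` qcarrier (V1 q)"
    by (simp add: V1_to_Lambda1_surj)
  \<comment> \<open>For \<open>p = 0\<close> the comodule condition only says that the coaction
    sends the zero coset to the zero coset.\<close>
  have "coact ` (0 +o N) + snd HL = coact 0 +o snd HL"
    using coact_N fs.subspace_0[OF qspD(2)[OF qsp_HL]]
    by (intro image_coset[OF flin_coact _ N_subspace qspD(2)[OF qsp_HL]]) auto
  moreover have "coact 0 = 0"
    by (rule coact_N[OF fs.subspace_0[OF N_subspace]])
  ultimately have "qzero HL = coact ` qzero (Lambda1 q) + snd HL"
    by (simp only: coset_zero qzero_def)
  then show "comodule_map q ?p"
    unfolding comodule_map_def
    by (intro conjI qlinear_zero qsp_Lambda1 exI[of _ "\<lambda>Y. coact ` Y + snd HL"]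
        exI[of _ "\<lambda>_. qzero HL"] is_coaction_coact is_id_tensor_zero qsp_piB ballI)
qed

end

section \<open>The quantum principal bundle\<close>

lemma flinD: "flin f \<Longrightarrow> f (u + v) = f u + f v" "flin f \<Longrightarrow> f (fscale c v) = fscale c (f v)"
  by (auto simp: flin_def)

lemma flin_zero: "flin f \<Longrightarrow> f 0 = 0"
  using flinD(1)[of f 0 0] by (simp only: add_0_right) (metis add_cancel_left_left)

lemma flin_span:
  assumes "flin f" "fs.subspace U" "\<And>v. v \<in> S \<Longrightarrow> f v \<in> U" "t \<in> fs.span S"
  shows "f t \<in> U"
  using assms(4)
  by (induction rule: fs.span_induct_alt)
    (simp_all only: flin_zero[OF assms(1)] flinD[OF assms(1)] fs.subspace_0[OF assms(2)]
      fs.subspace_add[OF assms(2)] fs.subspace_scale[OF assms(2)] assms(3))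

lemma flin_tens_space:
  assumes "flin f" "fs.subspace U" "\<And>v w. v \<in> V \<Longrightarrow> w \<in> W \<Longrightarrow> f (tens v w) \<in> U"
    "t \<in> tens_space V W"
  shows "f t \<in> U"
  by (rule flin_span[OF assms(1,2) _ assms(4)[unfolded tens_space_def]]) (use assms(3) in auto)

lemma conv_mult_const_right: "conv a (\<lambda>v. b v * c) x = conv a b x * c"
  by (simp only: mult.commute[of _ c] conv_times_right)

lemma sum_list_product:
  "(\<Sum>p\<leftarrow>I. f p) * (\<Sum>r\<leftarrow>J. g r) = (\<Sum>p\<leftarrow>I. \<Sum>r\<leftarrow>J. f p * (g r :: complex))"
  by (induction I) (simp_all add: distrib_right sum_list_const_mult)

lemma sum_list_sum_swap: "(\<Sum>p\<leftarrow>I. \<Sum>n\<in>J. f p n) = (\<Sum>n\<in>J. \<Sum>p\<leftarrow>I. (f p n :: complex))"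
  by (induction I) (simp_all add: sum.distrib)

lemma sum_list_double_cosets:
  assumes "fs.subspace N"
  shows "sum_list (concat (map (\<lambda>p. map (\<lambda>r. f p r +o N) J) I)) + N = (\<Sum>p\<leftarrow>I. \<Sum>r\<leftarrow>J. f p r) +o N"
proof -
  have "concat (map (\<lambda>p. map (\<lambda>r. f p r +o N) J) I) = map (\<lambda>(p, r). f p r +o N) (List.product I J)"
    by (induction I) (simp_all add: comp_def)
  moreover have "(\<Sum>p\<leftarrow>I. \<Sum>r\<leftarrow>J. f p r) = (\<Sum>(p, r)\<leftarrow>List.product I J. f p r)"
    by (induction I) (simp_all add: comp_def)
  ultimately show ?thesis
    using sum_list_cosets[OF assms, of "\<lambda>(p, r). f p r"] by (simp add: case_prod_unfold)
qed

context su3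
begin

section \<open>Representatives of one-forms and of the right coaction\<close>

abbreviation S1 :: "(free \<times> free \<Rightarrow> complex) set" where "S1 \<equiv> snd (Omega1 q)"
abbreviation OH :: "((free \<times> free) \<times> free) qspace" where "OH \<equiv> qtensor_space (Omega1 q) (piB q)"

lemma qsp_OH: "qsp OH"
  by (intro qsp_qtensor_space qsp_Omega1 qsp_piB)

lemma fst_Omega1: "fst (Omega1 q) = tens_space A Ap"
  by (simp add: Omega1_def qtensor_space_def Aspace_def fst_Lambda1)

lemma S1_eq: "S1 = tens_space {0} Ap + tens_space A N"
  by (simp add: Omega1_def qtensor_space_def Aspace_def fst_Lambda1)

lemma fst_OH: "fst OH = tens_space (tens_space A Ap) A"
  by (simp add: qtensor_space_def fst_Omega1 fst_piB)

lemma in_snd_OH: "t \<in> tens_space (tens_space A Ap) BA \<Longrightarrow> t \<in> snd OH"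
  by (simp add: qtensor_space_def fst_Omega1 in_set_plus_right tens_space_subspace)

lemma flin_S1:
  assumes "flin f" "fs.subspace U" "\<And>w. w \<in> Ap \<Longrightarrow> f (tens 0 w) \<in> U"
    "\<And>v w. v \<in> A \<Longrightarrow> w \<in> N \<Longrightarrow> f (tens v w) \<in> U" "t \<in> S1"
  shows "f t \<in> U"
proof -
  obtain s u where "s \<in> tens_space {0} Ap" "u \<in> tens_space A N" "t = s + u"
    using assms(5) by (auto simp: S1_eq set_plus_def)
  moreover have "f s \<in> U" if "s \<in> tens_space {0} Ap" for s
    by (rule flin_tens_space[OF assms(1,2) _ that]) (use assms(3) in auto)
  moreover have "f u \<in> U" if "u \<in> tens_space A N" for u
    by (rule flin_tens_space[OF assms(1,2) assms(4) that])
  ultimately show ?thesis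
    by (simp only: flinD[OF assms(1)] fs.subspace_add[OF assms(2)])
qed

definition lactf :: "func \<Rightarrow> (free \<times> free \<Rightarrow> complex) \<Rightarrow> free \<times> free \<Rightarrow> complex" where
  "lactf a t = (\<lambda>(x, y). conv a (\<lambda>z. t (z, y)) x)"

lemma flin_lactf: "flin (lactf a)"
  by (auto simp: flin_def lactf_def fun_eq_iff fscale_def conv_linear)

lemma lactf_tens: "lactf a (tens b y) = tens (conv a b) y"
  by (auto simp: lactf_def fun_eq_iff conv_mult_const_right)

lemma lact_coset:
  assumes "a \<in> A"
  shows "lact q a (t +o S1) = lactf a t +o S1"
proof -
  note S = qspD(2)[OF qsp_Omega1]
  have "lactf a t \<in> S1" if "t \<in> S1" for t
  proof (rule flin_S1[OF flin_lactf S _ _ that])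
    show "lactf a (tens 0 w) \<in> S1" for w
      unfolding lactf_tens by (simp only: conv_zero tens_zero fs.subspace_0[OF S])
    show "lactf a (tens v w) \<in> S1" if "v \<in> A" "w \<in> N" for v w
      unfolding lactf_tens S1_eq
      by (intro in_set_plus_right tens_space_subspace tens_in_tens_space A_conv assms that)
  qed
  then have "lactf a ` (t +o S1) + S1 = lactf a t +o S1"
    by (intro image_coset flin_lactf S) auto
  then show ?thesis
    by (simp add: lact_def lactf_def[abs_def])
qed

definition left_d :: "func \<Rightarrow> func \<Rightarrow> free \<times> free \<Rightarrow> complex" where
  "left_d a b = (\<Sum>n\<leftarrow>[0..<6]. tens (conv a (act (X n) b)) (dual_func n))"

lemma left_d_apply: "left_d a b (x, y) = (\<Sum>n<6. conv a (act (X n) b) x * dual_func n y)"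
  by (simp add: left_d_def sum_list_fun_apply comp_def sum_list_distinct_conv_sum_set atLeast0LessThan
      sum_fun_apply)

lemma left_d_in: "a \<in> A \<Longrightarrow> b \<in> A \<Longrightarrow> left_d a b \<in> tens_space A Ap"
  unfolding left_d_def
  by (intro fs_subspace_sum_list tens_space_subspace)
    (auto intro!: tens_in_tens_space A_conv A_act dual_func_Ap)

lemma dd_eq:
  assumes "b \<in> A"
  shows "dd q b = (\<Sum>n\<leftarrow>[0..<6]. tens (act (X n) b) (dual_func n)) +o S1"
proof -
  have "qtensor (Aspace q) (Lambda1 q) {act (X n) b} (dual_form q n) = tens (act (X n) b) (dual_func n) +o S1"
    if "n < 6" for n
  proof -
    have "{act (X n) b} = act (X n) b +o snd (Aspace q)"
      by (auto simp: Aspace_def elt_set_plus_def)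
    moreover have "act (X n) b \<in> fst (Aspace q)"
      by (simp add: Aspace_def A_act assms)
    ultimately show ?thesis
      using dual_func_Ap[OF that] unfolding dual_form_eq[OF that] Omega1_def
      by (simp only: qtensor_coset[OF qsp_Aspace qsp_Lambda1] fst_Lambda1)
  qed
  then have "dd q b = sum_list (map (\<lambda>n. tens (act (X n) b) (dual_func n) +o S1) [0..<6]) + S1"
    unfolding dd_def qsum_def length_tangent_basis
    by (intro arg_cong[of _ _ "\<lambda>Z. sum_list Z + S1"] map_cong) auto
  then show ?thesis
    by (simp only: sum_list_cosets[OF qspD(2)[OF qsp_Omega1]])
qed

lemma lact_dd:
  assumes "a \<in> A" "b \<in> A"
  shows "lact q a (dd q b) = left_d a b +o S1"
proof -
  have "lactf a (sum_list (map (\<lambda>n. tens (f n) (g n)) I)) = (\<Sum>n\<leftarrow>I. tens (conv a (f n)) (g n))" for f g and I :: "nat list"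
    by (induction I) (simp_all only: list.map sum_list.Nil sum_list.Cons flin_zero[OF flin_lactf]
        flinD[OF flin_lactf] lactf_tens)
  then show ?thesis
    unfolding dd_eq[OF assms(2)] lact_coset[OF assms(1)] left_d_def by simp
qed

text \<open>Representative of the right coaction: \<open>a\<close> tensored with the
  \<open>n\<close>-th basis form goes to \<open>a_1\<close>, that form, and \<open>a_2\<close> times
  \<open>grp_neg n\<close>. The factor \<open>grp_neg n\<close> compensates the shift of weight that
  \<open>act (X n)\<close> causes in \<open>db\<close>.\<close>

definition Dmap :: "(free \<times> free \<Rightarrow> complex) \<Rightarrow> (free \<times> free) \<times> free \<Rightarrow> complex" where
  "Dmap t = (\<lambda>((x, y), z). \<Sum>n<6. dual_func n y * conv (\<lambda>s. t (x * s, X n)) (grp_neg n) z)"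

lemma flin_Dmap: "flin Dmap"
  by (auto simp: flin_def Dmap_def fun_eq_iff fscale_def conv_linear distrib_left sum.distrib
      sum_distrib_left mult.left_commute)

lemma grp_neg_A: "n < 6 \<Longrightarrow> grp_neg n \<in> A"
  by (rule wt_A[OF grp_neg_wt])

lemma Dmap_in:
  assumes "t \<in> tens_space A Ap"
  shows "Dmap t \<in> fst OH"
  unfolding fst_OH
proof (rule flin_tens_space[OF flin_Dmap tens_space_subspace _ assms])
  fix a y assume a: "a \<in> A" and y: "y \<in> Ap"
  obtain ps where ps: "sweedler2 q a ps"
    using sweedler2_obtain[OF a] .
  have "conv (\<lambda>s. a (x * s) * y (X n)) (grp_neg n) z
      = (\<Sum>p\<leftarrow>ps. y (X n) * (fst p x * conv (snd p) (grp_neg n) z))" for x z n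
  proof -
    have "(\<lambda>s. a (x * s) * y (X n)) = (\<lambda>s. \<Sum>p\<leftarrow>ps. (y (X n) * fst p x) * snd p s)"
      by (simp add: fun_eq_iff sweedler2_apply[OF ps] case_prod_unfold sum_list_const_mult
          mult.assoc mult.commute[of _ "y (X n)"])
    then show ?thesis
      by (simp only: conv_sum_list_left conv_times_left mult.assoc)
  qed
  then have "Dmap (tens a y) = (\<Sum>n<6. \<Sum>p\<leftarrow>ps. fscale (y (X n)) (tens (tens (fst p) (dual_func n)) (conv (snd p) (grp_neg n))))"
    by (auto simp: Dmap_def fun_eq_iff sum_fun_apply sum_list_fun_apply comp_def fscale_def
        sum_list_const_mult[symmetric] mult.commute mult.left_commute mult.assoc)
  also have "\<dots> \<in> tens_space (tens_space A Ap) A"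
  proof -
    have "fst p \<in> A" "snd p \<in> A" if "p \<in> set ps" for p
      using ps that by (auto simp: sweedler2_def)
    then show ?thesis
      using dual_func_Ap grp_neg_A
      by (auto intro!: fs.subspace_sum fs_subspace_sum_list fs.subspace_scale tens_space_subspace
          tens_in_tens_space A_conv)
  qed
  finally show "Dmap (tens a y) \<in> tens_space (tens_space A Ap) A" .
qed

lemma Dmap_S1: "t \<in> S1 \<Longrightarrow> Dmap t = 0"
proof -
  have "Dmap t \<in> {0}" if "t \<in> S1"
  proof (rule flin_S1[OF flin_Dmap fs.subspace_single_0 _ _ that])
    show "Dmap (tens 0 w) \<in> {0}" for w
      by (simp only: tens_zero flin_zero[OF flin_Dmap] singleton_iff)
    show "Dmap (tens v w) \<in> {0}" if "w \<in> N" for v w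
      using that by (auto simp: Dmap_def fun_eq_iff N_iff conv_linear)
  qed
  then show "t \<in> S1 \<Longrightarrow> Dmap t = 0" by simp
qed

text \<open>
  The components at \<open>X\<^sub>n\<close> of the two sides of the covariance condition for \<open>a db\<close>:
  \<open>a\<^sub>1 b\<^sub>1 \<otimes> a\<^sub>2 (X\<^sub>n \<triangleright> b\<^sub>2) g\<close>, with \<open>g\<close> of weight opposite to \<open>X\<^sub>n\<close>, and
  \<open>a\<^sub>1 (X\<^sub>n \<triangleright> b\<^sub>1) \<otimes> a\<^sub>2 b\<^sub>2\<close>. Writing the latter without a choice of Sweedler representatives makes it
  visibly bilinear in \<open>a\<close> and \<open>b\<close>, which reduces the comparison to monomials.
\<close>

definition Lpart :: "nat \<Rightarrow> func \<Rightarrow> func \<Rightarrow> free \<times> free \<Rightarrow> complex" where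
  "Lpart n a b = (\<lambda>(x, z). conv (\<lambda>s. conv a (act (X n) b) (x * s)) (grp_neg n) z)"

definition Kpart :: "nat \<Rightarrow> func \<Rightarrow> func \<Rightarrow> free \<times> free \<Rightarrow> complex" where
  "Kpart n a b = (\<lambda>(x, z). cop (\<lambda>v w. cop (\<lambda>s t. a (v * s) * b (w * X n * t)) z) x)"

lemma act_apply: "act Y a x = a (x * Y)"
  by (simp add: act_def comult_def)

lemma Kpart_eq:
  assumes "\<And>x y. a (x * y) = (\<Sum>p\<leftarrow>ps. fst p x * snd p y)"
    and "\<And>x y. b (x * y) = (\<Sum>r\<leftarrow>qs. fst r x * snd r y)"
  shows "Kpart n a b = (\<Sum>p\<leftarrow>ps. \<Sum>r\<leftarrow>qs. tens (conv (fst p) (act (X n) (fst r))) (conv (snd p) (snd r)))"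
proof -
  have "a (v * s) * b (w * X n * t)
      = (\<Sum>p\<leftarrow>ps. \<Sum>r\<leftarrow>qs. (fst p v * fst r (w * X n)) * (snd p s * snd r t))" for v s w t
    unfolding assms(1) assms(2)[of "w * X n" t] sum_list_product by (simp add: mult.assoc mult.left_commute)
  then have "Kpart n a b (x, z)
      = (\<Sum>p\<leftarrow>ps. \<Sum>r\<leftarrow>qs. cop (\<lambda>v w. fst p v * fst r (w * X n)) x * cop (\<lambda>s t. snd p s * snd r t) z)" for x z
    unfolding Kpart_def
    by (simp add: cop_fun_sum_list cop_fun_scale)
      (simp add: mult.commute[of _ "cop _ z"] cop_fun_scale)
  then show ?thesis
    by (auto simp: fun_eq_iff sum_list_fun_apply comp_def conv_eq_cop act_apply)
qed

lemma act_comult: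
  assumes "\<And>x y. b (x * y) = (\<Sum>r\<leftarrow>qs. fst r x * snd r y)"
  shows "act Y b (x * y) = (\<Sum>r\<leftarrow>qs. fst r x * act Y (snd r) y)"
  by (simp add: act_apply mult.assoc assms)

lemma Lpart_eq:
  assumes "\<And>x y. a (x * y) = (\<Sum>p\<leftarrow>ps. fst p x * snd p y)"
    and "\<And>x y. b (x * y) = (\<Sum>r\<leftarrow>qs. fst r x * snd r y)"
  shows "Lpart n a b = (\<Sum>p\<leftarrow>ps. \<Sum>r\<leftarrow>qs.
    tens (conv (fst p) (fst r)) (conv (conv (snd p) (act (X n) (snd r))) (grp_neg n)))"
proof -
  have "conv a (act (X n) b) (x * s)
      = (\<Sum>p\<leftarrow>ps. \<Sum>r\<leftarrow>qs. conv (fst p) (fst r) x * conv (snd p) (act (X n) (snd r)) s)" for x s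
    using conv_comult[of a fst snd ps "act (X n) b" fst "\<lambda>r. act (X n) (snd r)" qs x s]
      assms(1) act_comult[OF assms(2)] by blast
  then show ?thesis
    by (auto simp: Lpart_def fun_eq_iff sum_list_fun_apply comp_def conv_sum_list_left conv_linear)
qed

lemma act_wt:
  assumes "n < 6" "b \<in> wt d"
  shows "act (X n) b \<in> wt (\<lambda>i. root_wt n i * d i)"
proof -
  note b = wt_A[OF assms(2)]
  have "b (x * KK i * X n) = root_wt n i * (d i * b (x * X n))" for x i
    using X_KK[OF assms(1) A_dual[OF b], of x i 1] wt_KK[OF assms(2), of "x * X n" i]
    by (simp add: mult.assoc)
  then show ?thesis
    by (simp add: wt_def A_act[OF b] act_apply)
qed

text \<open>With homogeneous right factors, every right-hand product on both sides has weight
  \<open>c d\<close>, so modulo \<open>B^+A\<close> it is its counit times one fixed element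
  \<open>e\<close>. What is left in the first factor is \<open>a (X_n \<triangleright> b)\<close> on
  both sides.\<close>

lemma part_diff_mon:
  assumes n: "n < 6" and a: "a \<in> mon q" and b: "b \<in> mon q"
  shows "Lpart n a b - Kpart n a b \<in> tens_space A BA"
proof -
  obtain c where c: "inv_weight c" "comult a \<in> tens_space A (wt c)" using mon_sweedler[OF a] by blast
  obtain d where d: "inv_weight d" "comult b \<in> tens_space A (wt d)" using mon_sweedler[OF b] by blast
  obtain ps where ps: "set ps \<subseteq> A \<times> wt c" "comult a = (\<Sum>(v, w)\<leftarrow>ps. tens v w)"
    using tens_space_obtain[OF c(2) A_subspace] .
  obtain qs where qs: "set qs \<subseteq> A \<times> wt d" "comult b = (\<Sum>(v, w)\<leftarrow>qs. tens v w)"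
    using tens_space_obtain[OF d(2) A_subspace] .
  have am: "a (x * y) = (\<Sum>p\<leftarrow>ps. fst p x * snd p y)"
    and bm: "b (x * y) = (\<Sum>r\<leftarrow>qs. fst r x * snd r y)" for x y
    using ps(2) qs(2) unfolding comult_apply unfolding case_prod_unfold by blast+
  have p: "fst p \<in> A" "snd p \<in> wt c" if "p \<in> set ps" for p using ps(1) that by auto
  have r: "fst r \<in> A" "snd r \<in> wt d" if "r \<in> set qs" for r using qs(1) that by auto
  have cd: "inv_weight (\<lambda>i. c i * d i)" using inv_weight_mult[OF c(1) d(1)] .
  then obtain e where e: "e \<in> wt (\<lambda>i. c i * d i)" "e 1 = 1"
    unfolding inv_weight_def by blast
  define k where "k p r = conv (snd p) (snd r) - fscale (snd p 1 * snd r 1) e" for p r :: "func \<times> func"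
  define l where "l p r = conv (conv (snd p) (act (X n) (snd r))) (grp_neg n)
      - fscale (snd p 1 * snd r (X n)) e" for p r :: "func \<times> func"
  have kBA: "k p r \<in> BA" if "p \<in> set ps" "r \<in> set qs" for p r
  proof (rule wt_in_BA[OF cd])
    show "k p r \<in> wt (\<lambda>i. c i * d i)"
      unfolding k_def
      by (intro fs.subspace_diff[OF wt_subspace] fs.subspace_scale[OF wt_subspace] e wt_conv
          p r that)
    show "k p r 1 = 0" by (simp add: k_def conv_1 fscale_def e)
  qed
  have lBA: "l p r \<in> BA" if "p \<in> set ps" "r \<in> set qs" for p r
  proof (rule wt_in_BA[OF cd])
    have "conv (conv (snd p) (act (X n) (snd r))) (grp_neg n)
        \<in> wt (\<lambda>i. c i * (root_wt n i * d i) * inverse (root_wt n i))"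
      by (intro wt_conv act_wt grp_neg_wt n p
          r that)
    moreover have "(\<lambda>i. c i * (root_wt n i * d i) * inverse (root_wt n i)) = (\<lambda>i. c i * d i)"
      using inv_weight_nz[OF inv_weight_root_wt[OF n]] by (auto simp: fun_eq_iff)
    ultimately show "l p r \<in> wt (\<lambda>i. c i * d i)"
      unfolding l_def
      by (intro fs.subspace_diff[OF wt_subspace] fs.subspace_scale[OF wt_subspace] e) simp
    show "l p r 1 = 0" by (simp add: l_def conv_1 fscale_def e act_apply grp_neg_1)
  qed
  have a': "a = (\<lambda>x. \<Sum>p\<leftarrow>ps. snd p 1 * fst p x)"
    using am[of _ 1] by (auto simp: fun_eq_iff mult.commute)
  have b': "act (X n) b = (\<lambda>x. \<Sum>r\<leftarrow>qs. snd r (X n) * fst r x)"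
    using bm[of _ "X n"] by (auto simp: fun_eq_iff mult.commute act_apply)
  have b'': "act (X n) b = (\<lambda>x. \<Sum>r\<leftarrow>qs. snd r 1 * act (X n) (fst r) x)"
    using bm[of "_ * X n" 1] by (auto simp: fun_eq_iff mult.commute act_apply)
  \<comment> \<open>Two ways to recover \<open>X_n \<triangleright> b\<close> from the coproduct of
    \<open>b\<close>: evaluate the right factors at \<open>X_n\<close>, or apply \<open>X_n\<close>
    to the left factors and evaluate the right ones at 1.\<close>
  have H: "(\<Sum>p\<leftarrow>ps. \<Sum>r\<leftarrow>qs. snd p 1 * (snd r (X n) * conv (fst p) (fst r) x))
      = (\<Sum>p\<leftarrow>ps. \<Sum>r\<leftarrow>qs. snd p 1 * (snd r 1 * conv (fst p) (act (X n) (fst r)) x))" for x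
  proof -
    have "(\<Sum>p\<leftarrow>ps. \<Sum>r\<leftarrow>qs. snd p 1 * (snd r (X n) * conv (fst p) (fst r) x))
        = conv (\<lambda>x. \<Sum>p\<leftarrow>ps. snd p 1 * fst p x) (\<lambda>x. \<Sum>r\<leftarrow>qs. snd r (X n) * fst r x) x"
      by (simp add: conv_sum_list_left conv_sum_list_right conv_linear sum_list_const_mult[symmetric])
    also have "\<dots> = conv (\<lambda>x. \<Sum>p\<leftarrow>ps. snd p 1 * fst p x)
        (\<lambda>x. \<Sum>r\<leftarrow>qs. snd r 1 * act (X n) (fst r) x) x"
      unfolding b'[symmetric] b''[symmetric] ..
    also have "\<dots> = (\<Sum>p\<leftarrow>ps. \<Sum>r\<leftarrow>qs. snd p 1 * (snd r 1 * conv (fst p) (act (X n) (fst r)) x))"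
      by (simp add: conv_sum_list_left conv_sum_list_right conv_linear sum_list_const_mult[symmetric])
    finally show ?thesis .
  qed
  have "Lpart n a b - Kpart n a b = (\<Sum>p\<leftarrow>ps. \<Sum>r\<leftarrow>qs. tens (conv (fst p) (fst r)) (l p r))
      - (\<Sum>p\<leftarrow>ps. \<Sum>r\<leftarrow>qs. tens (conv (fst p) (act (X n) (fst r))) (k p r))"
  proof
    fix xz :: "free \<times> free"
    obtain x z where xz: "xz = (x, z)" by (cases xz)
    have "Lpart n a b (x, z) = (\<Sum>p\<leftarrow>ps. \<Sum>r\<leftarrow>qs. conv (fst p) (fst r) x * l p r z)
        + (\<Sum>p\<leftarrow>ps. \<Sum>r\<leftarrow>qs. snd p 1 * (snd r (X n) * conv (fst p) (fst r) x)) * e z"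
      unfolding Lpart_eq[OF am bm] l_def
      by (simp add: sum_list_fun_apply comp_def fscale_def right_diff_distrib sum_list_subtractf
          sum_list_const_mult[symmetric] mult.commute mult.left_commute mult.assoc)
    moreover have "Kpart n a b (x, z) = (\<Sum>p\<leftarrow>ps. \<Sum>r\<leftarrow>qs. conv (fst p) (act (X n) (fst r)) x * k p r z)
        + (\<Sum>p\<leftarrow>ps. \<Sum>r\<leftarrow>qs. snd p 1 * (snd r 1 * conv (fst p) (act (X n) (fst r)) x)) * e z"
      unfolding Kpart_eq[OF am bm] k_def
      by (simp add: sum_list_fun_apply comp_def fscale_def right_diff_distrib sum_list_subtractf
          sum_list_const_mult[symmetric] mult.commute mult.left_commute mult.assoc)
    ultimately show "(Lpart n a b - Kpart n a b) xz
      = ((\<Sum>p\<leftarrow>ps. \<Sum>r\<leftarrow>qs. tens (conv (fst p) (fst r)) (l p r))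
      - (\<Sum>p\<leftarrow>ps. \<Sum>r\<leftarrow>qs. tens (conv (fst p) (act (X n) (fst r))) (k p r))) xz"
      by (simp add: xz H sum_list_fun_apply comp_def)
  qed
  also have "\<dots> \<in> tens_space A BA"
    by (rule fs.subspace_diff[OF tens_space_subspace])
      (use p r kBA lBA in \<open>auto intro!: fs_subspace_sum_list tens_space_subspace tens_in_tens_space
        A_conv A_act\<close>)
  finally show ?thesis .
qed

lemma flin_part_diff:
  "flin (\<lambda>a. Lpart n a b - Kpart n a b)" "flin (\<lambda>b. Lpart n a b - Kpart n a b)"
proof -
  have act: "act Y (u + v) = (\<lambda>x. act Y u x + act Y v x)" "act Y (fscale c v) = (\<lambda>x. c * act Y v x)"
    for Y u v c
    by (auto simp: fun_eq_iff act_apply fscale_def)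
  show "flin (\<lambda>a. Lpart n a b - Kpart n a b)"
    by (auto simp: flin_def fun_eq_iff Lpart_def Kpart_def conv_add conv_fscale)
      (auto simp: fscale_def conv_linear cop_fun_add cop_fun_scale distrib_right mult.assoc right_diff_distrib)
  show "flin (\<lambda>b. Lpart n a b - Kpart n a b)"
    by (auto simp: flin_def fun_eq_iff Lpart_def Kpart_def act conv_linear)
      (auto simp: fscale_def cop_fun_add cop_fun_scale distrib_left mult.left_commute right_diff_distrib)
qed

lemma part_diff_in:
  assumes n: "n < 6" and a: "a \<in> A" and b: "b \<in> A"
  shows "Lpart n a b - Kpart n a b \<in> tens_space A BA"
proof (rule flin_span[OF flin_part_diff(1) tens_space_subspace _ a[unfolded OSU3_eq]])
  fix m assume m: "m \<in> mon q"
  show "Lpart n m b - Kpart n m b \<in> tens_space A BA"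
    by (rule flin_span[OF flin_part_diff(2) tens_space_subspace _ b[unfolded OSU3_eq]])
      (rule part_diff_mon[OF n m])
qed

text \<open>Places the \<open>n\<close>-th basis form between the two factors of \<open>g\<close>,
  matching the order of factors in \<open>A (x) Lambda^1 (x) A / B^+A\<close>.\<close>

definition insert_form :: "nat \<Rightarrow> (free \<times> free \<Rightarrow> complex) \<Rightarrow> (free \<times> free) \<times> free \<Rightarrow> complex" where
  "insert_form n g = (\<lambda>((x, y), z). dual_func n y * g (x, z))"

lemma insert_form_in:
  assumes "n < 6" "g \<in> tens_space A BA"
  shows "insert_form n g \<in> tens_space (tens_space A Ap) BA"
proof (rule flin_tens_space[OF _ tens_space_subspace _ assms(2)])
  show "flin (insert_form n)"
    by (auto simp: flin_def fun_eq_iff insert_form_def fscale_def algebra_simps)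
  fix v w assume "v \<in> A" "w \<in> BA"
  moreover have "insert_form n (tens v w) = tens (tens v (dual_func n)) w"
    by (auto simp: fun_eq_iff insert_form_def)
  ultimately show "insert_form n (tens v w) \<in> tens_space (tens_space A Ap) BA"
    by (simp add: tens_in_tens_space dual_func_Ap assms(1))
qed

lemma Dmap_dab:
  assumes a: "a \<in> A" and b: "b \<in> A" and ps: "sweedler2 q a ps" and qs: "sweedler2 q b qs"
  shows "Dmap (left_d a b) - (\<Sum>p\<leftarrow>ps. \<Sum>r\<leftarrow>qs. tens (left_d (fst p) (fst r)) (conv (snd p) (snd r))) \<in> snd OH"
    (is "_ - ?R \<in> _")
proof -
  have am: "a (x * y) = (\<Sum>p\<leftarrow>ps. fst p x * snd p y)"
    and bm: "b (x * y) = (\<Sum>r\<leftarrow>qs. fst r x * snd r y)" for x y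
    using sweedler2_apply[OF ps] sweedler2_apply[OF qs] by (simp_all add: case_prod_unfold)
  have D: "Dmap (left_d a b) ((x, y), z) = (\<Sum>n<6. dual_func n y * Lpart n a b (x, z))" for x y z
    unfolding Dmap_def by (auto intro!: sum.cong simp: left_d_apply dual_func_X sum_of_bool Lpart_def)
  have R: "?R ((x, y), z) = (\<Sum>n<6. dual_func n y * Kpart n a b (x, z))" for x y z
  proof -
    have "?R ((x, y), z) = (\<Sum>p\<leftarrow>ps. \<Sum>r\<leftarrow>qs. \<Sum>n<6. dual_func n y *
        (conv (fst p) (act (X n) (fst r)) x * conv (snd p) (snd r) z))"
      by (simp add: sum_list_fun_apply comp_def left_d_apply sum_distrib_right mult.assoc mult.left_commute)
    also have "\<dots> = (\<Sum>n<6. \<Sum>p\<leftarrow>ps. \<Sum>r\<leftarrow>qs. dual_func n y *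
        (conv (fst p) (act (X n) (fst r)) x * conv (snd p) (snd r) z))"
      by (simp only: sum_list_sum_swap)
    also have "\<dots> = (\<Sum>n<6. dual_func n y * Kpart n a b (x, z))"
      unfolding Kpart_eq[OF am bm]
      by (simp add: sum_list_fun_apply comp_def sum_list_const_mult)
    finally show ?thesis .
  qed
  \<comment> \<open>Both sides are expanded in the same representatives \<open>dual_func n\<close>,
    so their difference is compared one component at a time and falls entirely into the part with
    last factor in \<open>B^+A\<close>.\<close>
  have "Dmap (left_d a b) - ?R = (\<Sum>n<6. insert_form n (Lpart n a b - Kpart n a b))"
  proof
    fix t :: "(free \<times> free) \<times> free"
    obtain x y z where t: "t = ((x, y), z)" by (metis surj_pair)
    show "(Dmap (left_d a b) - ?R) t = (\<Sum>n<6. insert_form n (Lpart n a b - Kpart n a b)) t"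
      unfolding t minus_apply D R
      by (simp add: sum_fun_apply insert_form_def right_diff_distrib sum_subtractf)
  qed
  also have "\<dots> \<in> tens_space (tens_space A Ap) BA"
    using part_diff_in[OF _ a b] by (auto intro!: fs.subspace_sum tens_space_subspace insert_form_in)
  finally show ?thesis by (rule in_snd_OH)
qed

lemma quantum_principal_bundle_SU3: "quantum_principal_bundle q"
proof -
  note S = qspD(2)[OF qsp_OH]
  let ?D = "\<lambda>\<omega>. Dmap ` \<omega> + snd OH"
  have D0: "Dmap ` S1 \<subseteq> snd OH"
    using Dmap_S1 fs.subspace_0[OF S] by auto
  have lin: "qlinear (Omega1 q) OH ?D"
    using Dmap_in by (intro qlinear_induced flin_Dmap qsp_Omega1 qsp_OH D0) (auto simp: fst_Omega1)
  have eq: "?D (lact q a (dd q b)) =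
      qsum OH [qtensor (Omega1 q) (piB q) (lact q a1 (dd q b1)) (piB_proj q (conv a2 b2)).
                 (a1, a2) \<leftarrow> ps, (b1, b2) \<leftarrow> qs]"
    if a: "a \<in> A" and b: "b \<in> A" and ps: "sweedler2 q a ps" and qs: "sweedler2 q b qs" for a b ps qs
  proof -
    let ?f = "\<lambda>p r. tens (left_d (fst p) (fst r)) (conv (snd p) (snd r))"
    have t: "qtensor (Omega1 q) (piB q) (lact q (fst p) (dd q (fst r))) (piB_proj q (conv (snd p) (snd r)))
        = ?f p r +o snd OH" if "p \<in> set ps" "r \<in> set qs" for p r
    proof -
      have m: "fst p \<in> A" "snd p \<in> A" "fst r \<in> A" "snd r \<in> A"
        using that ps qs by (auto simp: sweedler2_def)
      show ?thesis
        unfolding lact_dd[OF m(1,3)] piB_proj_def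
        by (rule qtensor_coset[OF qsp_Omega1 qsp_piB])
          (simp_all add: fst_Omega1 fst_piB left_d_in A_conv m)
    qed
    have "[qtensor (Omega1 q) (piB q) (lact q a1 (dd q b1)) (piB_proj q (conv a2 b2)).
                 (a1, a2) \<leftarrow> ps, (b1, b2) \<leftarrow> qs]
        = concat (map (\<lambda>p. map (\<lambda>r. qtensor (Omega1 q) (piB q) (lact q (fst p) (dd q (fst r)))
            (piB_proj q (conv (snd p) (snd r)))) qs) ps)"
      by (simp add: case_prod_unfold)
    also have "\<dots> = concat (map (\<lambda>p. map (\<lambda>r. ?f p r +o snd OH) qs) ps)"
      using t by (intro arg_cong[of _ _ concat] map_cong refl) auto
    finally have "qsum OH [qtensor (Omega1 q) (piB q) (lact q a1 (dd q b1)) (piB_proj q (conv a2 b2)).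
                 (a1, a2) \<leftarrow> ps, (b1, b2) \<leftarrow> qs] = (\<Sum>p\<leftarrow>ps. \<Sum>r\<leftarrow>qs. ?f p r) +o snd OH"
      unfolding qsum_def by (simp only: sum_list_double_cosets[OF S])
    also have "\<dots> = Dmap (left_d a b) +o snd OH"
      by (rule coset_eqI[OF S Dmap_dab[OF that], symmetric])
    also have "\<dots> = ?D (left_d a b +o S1)"
      by (rule image_coset[OF flin_Dmap D0 qspD(2)[OF qsp_Omega1] S, symmetric])
    finally show ?thesis
      unfolding lact_dd[OF a b] ..
  qed
  show ?thesis
    unfolding quantum_principal_bundle_def Let_def
    by (intro exI[of _ ?D] conjI lin ballI allI impI eq)
qed

end

theorem corollary3p5:
  fixes q :: real
  assumes "q \<notin> {-1, 0, 1}"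
  shows "quantum_principal_bundle q \<and> principal_connection q (\<lambda>\<omega>. qzero (Omega1 q))"
proof -
  interpret su3 q by (rule su3.intro[OF assms])
  show ?thesis
    using quantum_principal_bundle_SU3 principal_connection_zero by blast
qed

end
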